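(* For any integers $n,k\ge1$, $$I(\mathbb H_n\times\mathbb R^k)\ge I(\mathbb R^{2n+2+k})\left(\frac{I(\mathbb H_n)}{I(\mathbb R^{2n+2})}\right)^{\frac{2n+2}{2n+2+k}}.$$
   Context: For $n\ge1$, $k\ge0$, $\mathbb H_n\times\mathbb R^k$ is $\mathbb R^{2n+1+k}$ with coordinates $(x,y,z,w)$, $x,y\in\mathbb R^n$, $z\in\mathbb R$, $w\in\mathbb R^k$, Lebesgue measure $|\cdot|$, and the vector fields $X_j=\partial_{x_j}+2y_j\partial_z$, $Y_j=\partial_{y_j}-2x_j\partial_z$ ($1\le j\le n$), $W_i=\partial_{w_i}$ ($1\le i\le k$). For $k=0$ one writes $\mathbb H_n$. The (horizontal) perimeter of a measurable set $E\subset\mathbb H_n\times\mathbb R^k$ is $\mathrm{Per}_{\mathbb H_n\times\mathbb R^k}(E)=\sup\{\int_E(\sum_{j=1}^n(X_j\varphi_j+Y_j\varphi_{n+j})+\sum_{i=1}^kW_i\varphi_{2n+i})\,dx\,dy\,dz\,dw:\ \varphi\in C_c^1(\mathbb H_n\times\mathbb R^k,\mathbb R^{2n+k}),\ |\varphi|\le1\}$. $I(\mathbb H_n\times\mathbb R^k)$ is the largest constant such that $\mathrm{Per}_{\mathbb H_n\times\mathbb R^k}(E)\ge I(\mathbb H_n\times\mathbb R^k)|E|^{\frac{2n+1+k}{2n+2+k}}$ for every measurable $E$ of finite measure. $I(\mathbb R^d)$ is the largest constant in the Euclidean isoperimetric inequality $\mathrm{Per}_{\mathbb R^d}(E)\ge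 I(\mathbb R^d)|E|^{\frac{d-1}d}$; explicitly $I(\mathbb R^d)=d^{\frac{d-1}d}|\mathbb S^{d-1}|^{\frac1d}$. *)

theory Defs
  imports "HOL-Analysis.Analysis"
begin

text \<open>Heisenberg group coordinates \<open>(x, y, z)\<close>. The underlying space is used only as a Euclidean
  space: products and powers of \<open>real\<close> carry the Euclidean norm and (via \<open>lebesgue\<close>) Lebesgue
  measure.\<close>

type_synonym 'n heis = "(real ^ 'n) \<times> (real ^ 'n) \<times> real"

text \<open>A vector field on \<open>'a\<close> is represented by its coefficient function \<open>'a \<Rightarrow> 'a\<close>; it acts on a
  function as the directional derivative along that coefficient vector.\<close>

definition field_deriv ::
  "('a::euclidean_space \<Rightarrow> 'a) \<Rightarrow> ('a \<Rightarrow> real) \<Rightarrow> 'a \<Rightarrow> real" where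
  "field_deriv V f p = frechet_derivative f (at p) (V p)"

text \<open>\<open>Inl j\<close> gives \<open>X\<^sub>j = \<partial>\<^sub>x\<^sub>j + 2 y\<^sub>j \<partial>\<^sub>z\<close> and \<open>Inr j\<close> gives \<open>Y\<^sub>j = \<partial>\<^sub>y\<^sub>j - 2 x\<^sub>j \<partial>\<^sub>z\<close>.\<close>

fun heis_fields :: "'n + 'n \<Rightarrow> ('n::finite) heis \<Rightarrow> 'n heis" where
  "heis_fields (Inl j) (x, y, z) = (axis j 1, 0, 2 * y $ j)"
| "heis_fields (Inr j) (x, y, z) = (0, axis j 1, - 2 * x $ j)"

text \<open>The fields \<open>X\<^sub>j, Y\<^sub>j\<close> (index \<open>Inl _\<close>) and \<open>W\<^sub>i = \<partial>\<^sub>w\<^sub>i\<close> (index \<open>Inr i\<close>) on the product of the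
  Heisenberg group with a Euclidean space of positive dimension. As index types are nonempty, the
  case without Euclidean factor is \<open>heis_fields\<close>.\<close>

fun heis_prod_fields ::
  "('n + 'n) + 'k \<Rightarrow> ('n::finite) heis \<times> (real ^ ('k::finite)) \<Rightarrow> 'n heis \<times> (real ^ 'k)" where
  "heis_prod_fields (Inl i) (p, w) = (heis_fields i p, 0)"
| "heis_prod_fields (Inr i) (p, w) = (0, axis i 1)"

definition euclid_fields :: "'d \<Rightarrow> real ^ ('d::finite) \<Rightarrow> real ^ 'd" where
  "euclid_fields i p = axis i 1"

definition C1_compact_support :: "('a::euclidean_space \<Rightarrow> 'b::euclidean_space) set" where
  "C1_compact_support = {\<phi>.
     (\<exists>\<phi>'. (\<forall>p. (\<phi> has_derivative blinfun_apply (\<phi>' p)) (at p)) \<and> continuous_on UNIV \<phi>') \<and>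
     compact (closure {p. \<phi> p \<noteq> 0})}"

text \<open>Perimeter with respect to a finite family \<open>V\<close> of vector fields, possibly \<open>\<infinity>\<close>.\<close>

definition perimeter ::
  "('i::finite \<Rightarrow> 'a::euclidean_space \<Rightarrow> 'a) \<Rightarrow> 'a set \<Rightarrow> ereal" where
  "perimeter V E =
     (SUP \<phi> \<in> {\<phi> :: 'a \<Rightarrow> real ^ 'i. \<phi> \<in> C1_compact_support \<and> (\<forall>p. norm (\<phi> p) \<le> 1)}.
        ereal (LINT p:E|lebesgue. (\<Sum>i\<in>UNIV. field_deriv (V i) (\<lambda>q. \<phi> q $ i) p)))"

text \<open>For the families used here, the admissible constants form a nonempty closed set bounded
  above, so the supremum is the largest one. \<open>Q\<close> is the homogeneous dimension.\<close>

definition isoperimetric_constant ::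
  "('i::finite \<Rightarrow> 'a::euclidean_space \<Rightarrow> 'a) \<Rightarrow> nat \<Rightarrow> real" where
  "isoperimetric_constant V Q =
     Sup {c :: real. \<forall>E \<in> lmeasurable.
        perimeter V E \<ge> ereal (c * measure lebesgue E powr ((real Q - 1) / real Q))}"

definition I_heis :: "'n::finite itself \<Rightarrow> real" where
  "I_heis (n :: 'n itself) =
     isoperimetric_constant (heis_fields :: _ \<Rightarrow> 'n heis \<Rightarrow> _) (2 * CARD('n) + 2)"

definition I_heis_prod :: "'n::finite itself \<Rightarrow> 'k::finite itself \<Rightarrow> real" where
  "I_heis_prod (n :: 'n itself) (k :: 'k itself) =
     isoperimetric_constant (heis_prod_fields :: _ \<Rightarrow> 'n heis \<times> (real ^ 'k) \<Rightarrow> _)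
       (2 * CARD('n) + 2 + CARD('k))"

text \<open>The dimension of the Euclidean space is the cardinality of the index type.\<close>

definition I_euclid :: "'d::finite itself \<Rightarrow> real" where
  "I_euclid (d :: 'd itself) =
     isoperimetric_constant (euclid_fields :: _ \<Rightarrow> real ^ 'd \<Rightarrow> _) CARD('d)"

end

theory Submission
  imports Defs
begin

text \<open>Write \<open>\<omega>\<^sub>d\<close> for the volume of the unit ball of \<open>\<real>\<^sup>d\<close> and \<open>b\<^sub>d = d \<omega>\<^sub>d\<^bsup>1/d\<^esup>\<close>. Testing with the unit ball gives
  \<open>I(\<real>\<^sup>d) \<le> b\<^sub>d\<close>; the opposite inequality follows from Brunn-Minkowski applied to the superlevel sets of
  mollified indicators. For \<open>Q = 2n+2\<close> it remains to bound the perimeter of \<open>E\<close> in the product from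
  below when the slices \<open>E\<^sub>w\<close> satisfy \<open>Per(E\<^sub>w) \<ge> c V(w)\<^bsup>(Q-1)/Q\<^esup>\<close> with \<open>V(w) = |E\<^sub>w|\<close>.

  Test fields of the form \<open>(\<Sum>\<^sub>m \<alpha>\<^sub>m(w) \<psi>\<^sub>m(p), \<beta>(w))\<close>, where the \<open>\<psi>\<^sub>m\<close> come from a countable dense family of
  test fields of the factor and \<open>\<alpha>\<^sub>m\<close>, \<open>\<beta>\<close> are mollifications of measurable functions, show that
  \<open>Per(E)\<close> is at least \<open>\<integral> ((c V\<^bsup>(Q-1)/Q\<^esup>)\<^sup>2 + |\<nabla>V\<^sub>\<epsilon>|\<^sup>2)\<^bsup>1/2\<^esup> dw\<close> up to an error that vanishes with the
  mollification parameter. For the smooth function \<open>V\<^sub>\<epsilon>\<close> this integral is the surface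
  area of a body of revolution in \<open>\<real>\<^bsup>Q+k\<^esup>\<close> with balls of \<open>\<real>\<^sup>Q\<close> as slices, and
  Brunn-Minkowski bounds it by \<open>b\<^bsub>Q+k\<^esub> (c/b\<^sub>Q)\<^bsup>Q/(Q+k)\<^esup> |E|\<^bsup>(Q+k-1)/(Q+k)\<^esup>\<close>.\<close>

section \<open>The Brunn-Minkowski inequality\<close>

text \<open>The slices \<open>E\<^sub>w\<close> of a measurable set vary without any regularity in
  \<open>w\<close>, so a near-optimal test field for \<open>E\<^sub>w\<close> has to be chosen
  measurably in \<open>w\<close>. This is why the fields are drawn from a sequence, the least good
  index being the choice; only finitely many members enter at a time, which keeps the total
  mollification error under control. The kernel is moved by duality from the coefficients onto the
  slice integrals: on \<open>V\<close> it produces exactly the gradient of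
  \<open>V\<^sub>\<epsilon>\<close>, on the slice integrals of the divergences it costs an L1 error.
  No coarea formula enters. Superlevel sets of a function are compared with those of a slightly
  larger one, and gradients appear through first-order remainders that are uniform in the point. In
  the body of revolution the radii are scaled by \<open>Q / c\<close>, so that a slice ball of
  volume \<open>A * V\<close> has surface \<open>A * (c * V powr ((Q - 1) / Q))\<close> with the
  same factor \<open>A\<close>. As the claim speaks of the Euclidean constants themselves,
  \<open>b\<close> must bound them from above in dimension \<open>Q + k\<close> and from below in
  dimension \<open>Q\<close>.\<close>

definition sumset :: "'a::euclidean_space set \<Rightarrow> 'a set \<Rightarrow> 'a set" where
  "sumset A B = (\<lambda>(x, y). x + y) ` (A \<times> B)"

lemma sumset_mono: "A \<subseteq> A' \<Longrightarrow> B \<subseteq> B' \<Longrightarrow> sumset A B \<subseteq> sumset A' B'"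
  unfolding sumset_def by auto

lemma sumset_commute: "sumset A B = sumset B A"
proof -
  have "sumset A B \<subseteq> sumset B A" for A B :: "'a set"
  proof
    fix z assume "z \<in> sumset A B"
    then obtain x y where "x \<in> A" "y \<in> B" "z = x + y" unfolding sumset_def by auto
    then have "z = (\<lambda>(x, y). x + y) (y, x)" "(y, x) \<in> B \<times> A" by (auto simp: add.commute)
    then show "z \<in> sumset B A" unfolding sumset_def by (rule image_eqI)
  qed
  then show ?thesis by blast
qed

lemma open_sumset: "open A \<Longrightarrow> open B \<Longrightarrow> open (sumset A B)"
proof -
  assume "open A" "open B"
  have "sumset A B = (\<Union>y\<in>B. (+) y ` A)"
    unfolding sumset_def image_def by (auto intro: add.commute)
  then show ?thesis
    using \<open>open A\<close> by (auto intro!: open_translation)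
qed

lemma bounded_sumset: "bounded A \<Longrightarrow> bounded B \<Longrightarrow> bounded (sumset A B)"
  unfolding sumset_def using bounded_plus by blast

section \<open>Families of disjoint boxes and their cuts by hyperplanes\<close>

lemma fmeasurable_bounded_open:
  "bounded (A :: 'a::euclidean_space set) \<Longrightarrow> open A \<Longrightarrow> A \<in> fmeasurable lborel"
  by (rule fmeasurableI) (use emeasure_bounded_finite[of A] in auto)

text \<open>Empty boxes are excluded so that cardinality counts boxes of positive volume: it is the
  induction measure below, and a cut has to drop the pieces it empties.\<close>

definition box_family :: "'a::euclidean_space set set \<Rightarrow> bool" where
  "box_family \<A> \<longleftrightarrow> finite \<A> \<and> disjoint \<A> \<and> (\<forall>K\<in>\<A>. K \<noteq> {} \<and> (\<exists>a b. K = box a b))"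

lemma box_familyD:
  assumes "box_family \<A>"
  shows "open (\<Union>\<A>)" "bounded (\<Union>\<A>)" "\<Union>\<A> \<in> fmeasurable lborel"
proof -
  show o: "open (\<Union>\<A>)" and b: "bounded (\<Union>\<A>)"
    using assms unfolding box_family_def by (auto intro!: bounded_Union open_Union bounded_box open_box)
  show "\<Union>\<A> \<in> fmeasurable lborel"
    by (rule fmeasurable_bounded_open[OF b o])
qed

lemma measure_box_family_pos:
  assumes "box_family \<A>" "\<A> \<noteq> {}"
  shows "measure lborel (\<Union>\<A>) > 0"
proof -
  obtain K where K: "K \<in> \<A>" using assms by auto
  then obtain a b where ab: "K = box a b" "K \<noteq> {}" using assms unfolding box_family_def by blast
  have "0 < measure lborel K"
    using ab by (simp add: content_pos_lt_eq box_ne_empty measure_lborel_box_eq)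
       (auto simp: inner_diff_left intro!: prod_pos less_imp_le)
  also have "\<dots> \<le> measure lborel (\<Union>\<A>)"
    using K box_familyD[OF assms(1)] ab by (intro measure_mono_fmeasurable) auto
  finally show ?thesis .
qed

definition cut_family :: "'a::euclidean_space set \<Rightarrow> 'a set set \<Rightarrow> 'a set set" where
  "cut_family H \<A> = (\<lambda>K. K \<inter> H) ` \<A> - {{}}"

lemma box_Int_lower:
  fixes a b :: "'a::euclidean_space"
  assumes u: "u \<in> Basis"
  shows "box a b \<inter> {x. x \<bullet> u < t} = box a (\<Sum>i\<in>Basis. (if i = u then min (b \<bullet> u) t else b \<bullet> i) *\<^sub>R i)"
proof (intro set_eqI)
  fix x
  have "x \<in> box a (\<Sum>i\<in>Basis. (if i = u then min (b \<bullet> u) t else b \<bullet> i) *\<^sub>R i) \<longleftrightarrow>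
      (\<forall>i\<in>Basis. a \<bullet> i < x \<bullet> i \<and> x \<bullet> i < (if i = u then min (b \<bullet> u) t else b \<bullet> i))"
    by (simp add: mem_box)
  also have "\<dots> \<longleftrightarrow> x \<in> box a b \<inter> {x. x \<bullet> u < t}"
    using u by (auto simp: mem_box split: if_splits; metis)
  finally show "x \<in> box a b \<inter> {x. x \<bullet> u < t} \<longleftrightarrow>
      x \<in> box a (\<Sum>i\<in>Basis. (if i = u then min (b \<bullet> u) t else b \<bullet> i) *\<^sub>R i)" by blast
qed

lemma box_Int_upper:
  fixes a b :: "'a::euclidean_space"
  assumes u: "u \<in> Basis"
  shows "box a b \<inter> {x. x \<bullet> u > t} = box (\<Sum>i\<in>Basis. (if i = u then max (a \<bullet> u) t else a \<bullet> i) *\<^sub>R i) b"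
proof (intro set_eqI)
  fix x
  have "x \<in> box (\<Sum>i\<in>Basis. (if i = u then max (a \<bullet> u) t else a \<bullet> i) *\<^sub>R i) b \<longleftrightarrow>
      (\<forall>i\<in>Basis. (if i = u then max (a \<bullet> u) t else a \<bullet> i) < x \<bullet> i \<and> x \<bullet> i < b \<bullet> i)"
    by (simp add: mem_box)
  also have "\<dots> \<longleftrightarrow> x \<in> box a b \<inter> {x. x \<bullet> u > t}"
    using u by (auto simp: mem_box split: if_splits; metis)
  finally show "x \<in> box a b \<inter> {x. x \<bullet> u > t} \<longleftrightarrow>
      x \<in> box (\<Sum>i\<in>Basis. (if i = u then max (a \<bullet> u) t else a \<bullet> i) *\<^sub>R i) b" by blast
qed

lemma box_family_cut:
  assumes "box_family \<A>" "\<And>a b. \<exists>c d. box a b \<inter> H = box c d"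
  shows "box_family (cut_family H \<A>)"
  unfolding box_family_def cut_family_def
proof (intro conjI ballI)
  show "finite ((\<lambda>K. K \<inter> H) ` \<A> - {{}})" using assms(1) by (simp add: box_family_def)
  show "disjoint ((\<lambda>K. K \<inter> H) ` \<A> - {{}})"
    unfolding disjoint_def
  proof (intro ballI impI)
    fix K L assume "K \<in> (\<lambda>K. K \<inter> H) ` \<A> - {{}}" "L \<in> (\<lambda>K. K \<inter> H) ` \<A> - {{}}" "K \<noteq> L"
    then obtain K' L' where "K' \<in> \<A>" "L' \<in> \<A>" "K = K' \<inter> H" "L = L' \<inter> H" by auto
    with \<open>K \<noteq> L\<close> show "K \<inter> L = {}"
      using assms(1) unfolding box_family_def disjoint_def by blast
  qed
  fix K assume K: "K \<in> (\<lambda>K. K \<inter> H) ` \<A> - {{}}"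
  then show "K \<noteq> {}" by simp
  obtain L where L: "L \<in> \<A>" "K = L \<inter> H" using K by auto
  then obtain a b where "L = box a b" using assms(1) unfolding box_family_def by meson
  then show "\<exists>a b. K = box a b" using assms(2) L by auto
qed

lemma Union_cut_family: "\<Union>(cut_family H \<A>) = \<Union>\<A> \<inter> H"
  by (auto simp: cut_family_def)

lemma card_cut_family: "finite \<A> \<Longrightarrow> card (cut_family H \<A>) \<le> card \<A>"
  unfolding cut_family_def
  by (meson Diff_subset card_image_le card_mono finite_imageI le_trans)

text \<open>The box that misses \<open>H\<close> leaves only the empty set behind, which is
  discarded; this strict drop lets the induction over boxes descend.\<close>

lemma card_cut_family_less:
  assumes "finite \<A>" "K \<in> \<A>" "K \<inter> H = {}"
  shows "card (cut_family H \<A>) < card \<A>"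
proof -
  have "cut_family H \<A> = cut_family H (\<A> - {K})"
    using assms by (auto simp: cut_family_def)
  then have "card (cut_family H \<A>) \<le> card (\<A> - {K})"
    using card_cut_family assms by (metis finite_Diff)
  also have "\<dots> < card \<A>" using assms by (metis card_Diff1_less)
  finally show ?thesis .
qed

text \<open>The intersection of two boxes is the box between coordinatewise maxima and minima, so it
  is empty only if it degenerates in one coordinate. As both boxes are nonempty, their intervals in
  that coordinate lie side by side.\<close>

lemma disjoint_boxes_separated:
  fixes a b c d :: "'a::euclidean_space"
  assumes "box a b \<inter> box c d = {}" "box a b \<noteq> {}" "box c d \<noteq> {}"
  obtains u where "u \<in> Basis" "b \<bullet> u \<le> c \<bullet> u \<or> d \<bullet> u \<le> a \<bullet> u"
proof -
  have "\<exists>u\<in>Basis. b \<bullet> u \<le> c \<bullet> u \<or> d \<bullet> u \<le> a \<bullet> u"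
  proof -
    obtain i where i: "i \<in> Basis" "min (b \<bullet> i) (d \<bullet> i) \<le> max (a \<bullet> i) (c \<bullet> i)"
      using assms(1) unfolding box_Int_box box_eq_empty by auto
    moreover have "a \<bullet> i < b \<bullet> i" "c \<bullet> i < d \<bullet> i" using assms(2,3) i unfolding box_ne_empty by auto
    ultimately show ?thesis by (intro bexI[of _ i]) (auto simp: max_def min_def split: if_splits)
  qed
  then show ?thesis using that by blast
qed

text \<open>Dominated convergence: off the hyperplane \<open>x \<bullet> u = s\<close>, a null set,
  the indicators of the half-spaces are eventually constant along any sequence tending to
  \<open>s\<close>.\<close>

lemma continuous_measure_halfspace:
  fixes B :: "'a::euclidean_space set"
  assumes "B \<in> fmeasurable lborel" "u \<in> Basis"
  shows "continuous_on UNIV (\<lambda>s. measure lborel (B \<inter> {x. x \<bullet> u < s}))"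
proof -
  have B: "B \<in> sets borel" "emeasure lborel B < \<infinity>" using assms by (auto simp: fmeasurable_def)
  have I: "measure lborel (B \<inter> {x. x \<bullet> u < s}) = (LBINT x. indicator (B \<inter> {x. x \<bullet> u < s}) x)" for s
    by simp
  show ?thesis
    unfolding continuous_on_sequentially I
  proof (intro ballI allI impI, elim conjE)
    fix s :: real and S assume S: "S \<longlonglongrightarrow> s"
    show "((\<lambda>s. LBINT x. indicator (B \<inter> {x. x \<bullet> u < s}) x) \<circ> S) \<longlonglongrightarrow>
       (LBINT x. indicat_real (B \<inter> {x. x \<bullet> u < s}) x)"
      unfolding o_def
    proof (rule integral_dominated_convergence[where w="indicator B"])
      show "integrable lborel (indicat_real B)" using B by (simp add: integrable_real_indicator)
      show "AE x in lborel. (\<lambda>i. indicat_real (B \<inter> {x. x \<bullet> u < S i}) x) \<longlonglongrightarrow> indicator (B \<inter> {x. x \<bullet> u < s}) x"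
        using AE_lborel_inner_neq[OF assms(2), of s]
      proof eventually_elim
        case (elim x)
        then consider "x \<bullet> u < s" | "x \<bullet> u > s" by linarith
        then show ?case
        proof cases
          case 1
          then have "eventually (\<lambda>i. x \<bullet> u < S i) sequentially"
            using S by (rule order_tendstoD(1)[rotated])
          then show ?thesis using 1 
            by (intro tendsto_eventually) (auto elim!: eventually_mono simp: indicator_def)
        next
          case 2
          then have "eventually (\<lambda>i. x \<bullet> u > S i) sequentially"
            using S by (rule order_tendstoD(2)[rotated])
          then show ?thesis using 2 
            by (intro tendsto_eventually) (auto elim!: eventually_mono simp: indicator_def)
        qed
      qed
    qed (use B in \<open>auto simp: indicator_def\<close>)
  qed
qed

lemma measure_halfspace_split:
  fixes B :: "'a::euclidean_space set"
  assumes "B \<in> fmeasurable lborel" "u \<in> Basis"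
  shows "measure lborel B = measure lborel (B \<inter> {x. x \<bullet> u < s}) + measure lborel (B \<inter> {x. x \<bullet> u > s})"
proof -
  have B[measurable]: "B \<in> sets borel" "emeasure lborel B < \<infinity>" using assms by (auto simp: fmeasurable_def)
  have "measure lborel B = measure lborel (B \<inter> {x. x \<bullet> u < s} \<union> B \<inter> {x. x \<bullet> u > s})"
    using AE_lborel_inner_neq[OF assms(2), of s]
    by (intro measure_eq_AE) (auto elim!: eventually_mono)
  also have "\<dots> = measure lborel (B \<inter> {x. x \<bullet> u < s}) + measure lborel (B \<inter> {x. x \<bullet> u > s})"
  proof (rule measure_Un_AE)
    show "B \<inter> {x. x \<bullet> u < s} \<in> fmeasurable lborel" "B \<inter> {x. s < x \<bullet> u} \<in> fmeasurable lborel"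
      by (auto intro!: fmeasurable_Int_fmeasurable assms)
  qed (intro AE_I2, auto)
  finally show ?thesis .
qed

text \<open>Intermediate value theorem: beyond the range of the coordinate on the bounded set, the
  half-space catches nothing or everything.\<close>

lemma exists_halfspace_measure:
  fixes B :: "'a::euclidean_space set"
  assumes "bounded B" "open B" "u \<in> Basis" "0 \<le> \<theta>" "\<theta> \<le> 1"
  obtains s where "measure lborel (B \<inter> {x. x \<bullet> u < s}) = \<theta> * measure lborel B"
proof -
  have Bf: "B \<in> fmeasurable lborel" by (rule fmeasurable_bounded_open) fact+
  obtain r where r: "\<And>x. x \<in> B \<Longrightarrow> norm x \<le> r" using assms(1) unfolding bounded_iff by metis
  have le: "\<bar>x \<bullet> u\<bar> \<le> r" if "x \<in> B" for x
    using Basis_le_norm[OF assms(3), of x] r[OF that] by linarith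
  have 1: "B \<inter> {x. x \<bullet> u < - \<bar>r\<bar> - 1} = {}" using le by fastforce
  have 2: "B \<inter> {x. x \<bullet> u < \<bar>r\<bar> + 1} = B" using le by fastforce
  have "\<exists>s. - \<bar>r\<bar> - 1 \<le> s \<and> s \<le> \<bar>r\<bar> + 1 \<and> measure lborel (B \<inter> {x. x \<bullet> u < s}) = \<theta> * measure lborel B"
  proof (rule IVT')
    show "continuous_on {- \<bar>r\<bar> - 1..\<bar>r\<bar> + 1} (\<lambda>s. measure lborel (B \<inter> {x. x \<bullet> u < s}))"
      using continuous_measure_halfspace[OF Bf assms(3)] continuous_on_subset by blast
    show "\<theta> * measure lborel B \<le> measure lborel (B \<inter> {x. x \<bullet> u < \<bar>r\<bar> + 1})"
      unfolding 2 using assms by (simp add: mult_left_le_one_le)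
  qed (use assms in \<open>auto simp: 1\<close>)
  then show ?thesis using that by blast
qed

section \<open>The inequality for single boxes, finite unions of boxes and open sets\<close>

definition bm_sum :: "'a::euclidean_space set \<Rightarrow> 'a set \<Rightarrow> real" where
  "bm_sum A B = measure lborel A powr (1 / DIM('a)) + measure lborel B powr (1 / DIM('a))"

lemma bm_box:
  fixes a b c d :: "'a::euclidean_space"
  assumes "box a b \<noteq> {}" "box c d \<noteq> {}"
  shows "bm_sum (box a b) (box c d) powr DIM('a) \<le> measure lborel (sumset (box a b) (box c d))"
proof -
  define n where "n = real DIM('a)"
  have n: "n > 0" unfolding n_def by simp
  define l where "l i = (b - a) \<bullet> i" for i
  define m where "m i = (d - c) \<bullet> i" for i
  have lm: "l i > 0" "m i > 0" if "i \<in> Basis" for i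
    using assms that unfolding l_def m_def box_ne_empty by (auto simp: inner_diff_left)
  have Al: "measure lborel (box a b) = (\<Prod>i\<in>Basis. l i)"
    using assms unfolding measure_lborel_box_eq box_ne_empty l_def by (auto intro: less_imp_le)
  have Bm: "measure lborel (box c d) = (\<Prod>i\<in>Basis. m i)"
    using assms unfolding measure_lborel_box_eq box_ne_empty m_def by (auto intro: less_imp_le)
  have sub: "box (a + c) (b + d) \<subseteq> sumset (box a b) (box c d)"
  proof
    fix z assume z: "z \<in> box (a + c) (b + d)"
    \<comment> \<open>Relative position of \<open>z\<close> in the sum box, coordinate by
      coordinate; \<open>x\<close> and \<open>y\<close> sit at the same relative position in their
      own boxes.\<close>
    define \<theta> where "\<theta> i = (z - (a + c)) \<bullet> i / (l i + m i)" for i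
    define x where "x = (\<Sum>i\<in>Basis. (a \<bullet> i + \<theta> i * l i) *\<^sub>R i)"
    define y where "y = (\<Sum>i\<in>Basis. (c \<bullet> i + \<theta> i * m i) *\<^sub>R i)"
    have \<theta>: "0 < \<theta> i" "\<theta> i < 1" if i: "i \<in> Basis" for i
    proof -
      have "(a + c) \<bullet> i < z \<bullet> i" "z \<bullet> i < (b + d) \<bullet> i" using z i by (auto simp: mem_box)
      then have "0 < (z - (a + c)) \<bullet> i" "(z - (a + c)) \<bullet> i < l i + m i"
        by (auto simp: l_def m_def algebra_simps)
      then show "0 < \<theta> i" "\<theta> i < 1" using lm[OF i] by (auto simp: \<theta>_def)
    qed
    have "x \<in> box a b"
      unfolding mem_box x_def
    proof
      fix i :: 'a assume i: "i \<in> Basis"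
      have "\<theta> i * l i > 0" using \<theta>[OF i] lm[OF i] by simp
      moreover have "\<theta> i * l i < 1 * l i" using \<theta>[OF i] lm[OF i] by (intro mult_strict_right_mono) auto
      ultimately show "a \<bullet> i < (\<Sum>i\<in>Basis. (a \<bullet> i + \<theta> i * l i) *\<^sub>R i) \<bullet> i \<and>
         (\<Sum>i\<in>Basis. (a \<bullet> i + \<theta> i * l i) *\<^sub>R i) \<bullet> i < b \<bullet> i"
        using i by (simp add: l_def inner_diff_left)
    qed
    moreover have "y \<in> box c d"
      unfolding mem_box y_def
    proof
      fix i :: 'a assume i: "i \<in> Basis"
      have "\<theta> i * m i > 0" using \<theta>[OF i] lm[OF i] by simp
      moreover have "\<theta> i * m i < 1 * m i" using \<theta>[OF i] lm[OF i] by (intro mult_strict_right_mono) auto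
      ultimately show "c \<bullet> i < (\<Sum>i\<in>Basis. (c \<bullet> i + \<theta> i * m i) *\<^sub>R i) \<bullet> i \<and>
         (\<Sum>i\<in>Basis. (c \<bullet> i + \<theta> i * m i) *\<^sub>R i) \<bullet> i < d \<bullet> i"
        using i by (simp add: m_def inner_diff_left)
    qed
    moreover have "z = x + y"
    proof (rule euclidean_eqI)
      fix i :: 'a assume i: "i \<in> Basis"
      have "\<theta> i * (l i + m i) = (z - (a + c)) \<bullet> i" using lm[OF i] by (simp add: \<theta>_def)
      then show "z \<bullet> i = (x + y) \<bullet> i" using i
        by (simp add: x_def y_def inner_add_left inner_diff_left distrib_left)
    qed
    ultimately show "z \<in> sumset (box a b) (box c d)" unfolding sumset_def by force
  qed
  have S: "measure lborel (box (a + c) (b + d)) = (\<Prod>i\<in>Basis. l i + m i)"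
  proof -
    have "\<forall>i\<in>Basis. (a + c) \<bullet> i \<le> (b + d) \<bullet> i"
      using assms unfolding box_ne_empty inner_add_left by (meson add_mono less_imp_le)
    then show ?thesis
      unfolding measure_lborel_box_eq l_def m_def by (simp add: algebra_simps inner_add_left)
  qed
  \<comment> \<open>Arithmetic-geometric mean for the ratios \<open>l i / (l i + m i)\<close> and
    for \<open>m i / (l i + m i)\<close>; the two arithmetic means add up to 1.\<close>
  have amgm: "(\<Prod>i\<in>Basis. l i) powr (1/n) + (\<Prod>i\<in>Basis. m i) powr (1/n) \<le> (\<Prod>i\<in>Basis. l i + m i) powr (1/n)"
  proof -
    have P: "(\<Prod>i\<in>Basis. l i + m i) > 0" using lm by (intro prod_pos) (simp add: add_pos_pos)
    have "(\<Prod>i\<in>Basis. l i / (l i + m i)) powr (1/n) \<le> (\<Sum>i\<in>Basis. (l i / (l i + m i)) / n)"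
      unfolding n_def using lm by (intro arith_geom_mean) (auto intro!: divide_nonneg_pos add_pos_pos intro: less_imp_le)
    moreover have "(\<Prod>i\<in>Basis. m i / (l i + m i)) powr (1/n) \<le> (\<Sum>i\<in>Basis. (m i / (l i + m i)) / n)"
      unfolding n_def using lm by (intro arith_geom_mean) (auto intro!: divide_nonneg_pos add_pos_pos intro: less_imp_le)
    moreover have "(\<Sum>i\<in>Basis. (l i / (l i + m i)) / n) + (\<Sum>i\<in>Basis. (m i / (l i + m i)) / n) = 1"
    proof -
      have "(l i / (l i + m i)) / n + (m i / (l i + m i)) / n = 1/n" if "i \<in> Basis" for i
        using lm[OF that] by (simp flip: add_divide_distrib)
      then show ?thesis using n by (simp add: sum.distrib[symmetric] n_def)
    qed
    ultimately have "(\<Prod>i\<in>Basis. l i / (l i + m i)) powr (1/n) + (\<Prod>i\<in>Basis. m i / (l i + m i)) powr (1/n) \<le> 1"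
      by linarith
    moreover have "(\<Prod>i\<in>Basis. l i) \<ge> 0" "(\<Prod>i\<in>Basis. m i) \<ge> 0"
      using lm by (meson prod_nonneg less_imp_le)+
    ultimately have "((\<Prod>i\<in>Basis. l i) powr (1/n) + (\<Prod>i\<in>Basis. m i) powr (1/n)) / (\<Prod>i\<in>Basis. l i + m i) powr (1/n) \<le> 1"
      using P by (simp add: prod_dividef powr_divide flip: add_divide_distrib)
    moreover have "(\<Prod>i\<in>Basis. l i + m i) powr (1/n) > 0" using P unfolding powr_gt_zero by (metis less_irrefl)
    ultimately show ?thesis by (simp only: divide_le_eq_1_pos)
  qed
  have "bm_sum (box a b) (box c d) powr n \<le> ((\<Prod>i\<in>Basis. l i + m i) powr (1/n)) powr n"
    unfolding bm_sum_def Al Bm using amgm n by (intro powr_mono2) (auto simp: n_def)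
  also have "\<dots> = (\<Prod>i\<in>Basis. l i + m i)"
    using n lm by (simp add: powr_powr prod_nonneg add_nonneg_nonneg less_imp_le)
  also have "\<dots> \<le> measure lborel (sumset (box a b) (box c d))"
    unfolding S[symmetric]
    by (intro measure_mono_fmeasurable sub fmeasurable_bounded_open bounded_sumset open_sumset) auto
  finally show ?thesis unfolding n_def .
qed

text \<open>The power \<open>DIM('a)\<close> of \<open>bm_sum\<close> is homogeneous of degree one
  in the two measures. Hence it splits additively when both sets are cut in the same proportion,
  just as the measure does.\<close>

lemma bm_sum_scale:
  fixes A B A' B' :: "'a::euclidean_space set"
  assumes "measure lborel A' = \<theta> * measure lborel A" "measure lborel B' = \<theta> * measure lborel B" "0 \<le> \<theta>"
  shows "bm_sum A' B' powr DIM('a) = \<theta> * bm_sum A B powr DIM('a)"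
proof -
  have "bm_sum A' B' = \<theta> powr (1 / DIM('a)) * bm_sum A B"
    unfolding bm_sum_def assms by (simp add: powr_mult assms algebra_simps)
  moreover have "bm_sum A B \<ge> 0" by (simp add: bm_sum_def)
  ultimately show ?thesis using assms by (simp add: powr_mult powr_powr)
qed

lemma bm_sum_commute: "bm_sum A B = bm_sum B A"
  by (simp add: bm_sum_def)

text \<open>The Hadwiger-Ohmann argument: a hyperplane separates two boxes of one family, and a parallel
  hyperplane cuts the other family in the same proportion; both halves contain fewer boxes.\<close>

lemma brunn_minkowski_boxes:
  fixes \<A> \<B> :: "'a::euclidean_space set set"
  assumes "box_family \<A>" "box_family \<B>" "\<A> \<noteq> {}" "\<B> \<noteq> {}"
  shows "bm_sum (\<Union>\<A>) (\<Union>\<B>) powr DIM('a) \<le> measure lborel (sumset (\<Union>\<A>) (\<Union>\<B>))"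
  using assms
proof (induction "card \<A> + card \<B>" arbitrary: \<A> \<B> rule: less_induct)
  case less
  \<comment> \<open>Stated for any pair with the same total number of boxes, so that it also serves
    with the two families exchanged.\<close>
  have step: "bm_sum (\<Union>\<C>) (\<Union>\<D>) powr DIM('a) \<le> measure lborel (sumset (\<Union>\<C>) (\<Union>\<D>))"
    if CD: "box_family \<C>" "box_family \<D>" "\<C> \<noteq> {}" "\<D> \<noteq> {}" "card \<C> \<noteq> 1"
      and eq: "card \<C> + card \<D> = card \<A> + card \<B>" for \<C> \<D> :: "'a set set"
  proof -
    have fin: "finite \<C>" "finite \<D>" using CD by (auto simp: box_family_def)
    obtain K where K: "K \<in> \<C>" using CD by auto
    have "\<C> \<noteq> {K}" using CD by auto
    then obtain L where L: "L \<in> \<C>" "L \<noteq> K" using K by auto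
    obtain a b c d where abcd: "K = box a b" "L = box c d"
      using CD(1) K L unfolding box_family_def by meson
    have ne: "K \<noteq> {}" "L \<noteq> {}" using CD(1) K L unfolding box_family_def by blast+
    have KL: "K \<inter> L = {}" using CD(1) K L unfolding box_family_def disjoint_def by blast
    obtain u where u: "u \<in> Basis" "b \<bullet> u \<le> c \<bullet> u \<or> d \<bullet> u \<le> a \<bullet> u"
      using disjoint_boxes_separated[OF KL[unfolded abcd] ne[unfolded abcd]] by blast
    \<comment> \<open>The left face, in direction \<open>u\<close>, of whichever of the two boxes
      lies to the right.\<close>
    define t where "t = (if b \<bullet> u \<le> c \<bullet> u then c \<bullet> u else a \<bullet> u)"
    have sep: "K \<subseteq> {x. x \<bullet> u < t} \<and> L \<subseteq> {x. x \<bullet> u > t} \<or> L \<subseteq> {x. x \<bullet> u < t} \<and> K \<subseteq> {x. x \<bullet> u > t}"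
    proof (cases "b \<bullet> u \<le> c \<bullet> u")
      case True
      have "x \<bullet> u < t" if "x \<in> K" for x
        using that u(1) True unfolding abcd t_def mem_box by (auto intro: less_le_trans)
      moreover have "x \<bullet> u > t" if "x \<in> L" for x
        using that u(1) True unfolding abcd t_def mem_box by auto
      ultimately show ?thesis by blast
    next
      case False
      then have False': "d \<bullet> u \<le> a \<bullet> u" using u(2) by blast
      have "x \<bullet> u < t" if "x \<in> L" for x
        using that u(1) False False' unfolding abcd t_def mem_box by (auto intro: less_le_trans)
      moreover have "x \<bullet> u > t" if "x \<in> K" for x
        using that u(1) False unfolding abcd t_def mem_box by auto
      ultimately show ?thesis by blast
    qed
    have lower: "\<exists>c d. box a b \<inter> {x. x \<bullet> u < r} = box c d" for a b r
      by (intro exI) (rule box_Int_lower[OF u(1)])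
    have upper: "\<exists>c d. box a b \<inter> {x. r < x \<bullet> u} = box c d" for a b r
      by (intro exI) (rule box_Int_upper[OF u(1)])
    define C1 where "C1 = cut_family {x. x \<bullet> u < t} \<C>"
    define C2 where "C2 = cut_family {x. x \<bullet> u > t} \<C>"
    have bf: "box_family C1" "box_family C2"
      unfolding C1_def C2_def
      by (rule box_family_cut[OF CD(1) lower], rule box_family_cut[OF CD(1) upper])
    have card: "card C1 < card \<C>" "card C2 < card \<C>"
    proof -
      have dj: "{x. x \<bullet> u < t} \<inter> {x. x \<bullet> u > t} = {}" by auto
      have "\<exists>M\<in>\<C>. M \<inter> {x. x \<bullet> u < t} = {}"
        using sep K L(1) dj by (elim disjE) blast+
      moreover have "\<exists>M\<in>\<C>. M \<inter> {x. x \<bullet> u > t} = {}"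
        using sep K L(1) dj by (elim disjE) blast+
      ultimately      show "card C1 < card \<C>" "card C2 < card \<C>"
        using card_cut_family_less[OF fin(1)] unfolding C1_def C2_def by blast+
    qed
    have Cne: "C1 \<noteq> {}" "C2 \<noteq> {}"
    proof -
      have "\<Union>C1 \<noteq> {}" "\<Union>C2 \<noteq> {}"
        using sep ne K L unfolding C1_def C2_def Union_cut_family by blast+
      then show "C1 \<noteq> {}" "C2 \<noteq> {}" by auto
    qed
    note C = box_familyD[OF CD(1)] note D = box_familyD[OF CD(2)]
    \<comment> \<open>The share of the first family below the separating hyperplane;
      \<open>s\<close> is then found so that the second family is divided in the same ratio.\<close>
    define \<theta> where "\<theta> = measure lborel (\<Union>C1) / measure lborel (\<Union>\<C>)"
    have Cpos: "measure lborel (\<Union>\<C>) > 0" "measure lborel (\<Union>C1) > 0" "measure lborel (\<Union>C2) > 0"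
      using measure_box_family_pos CD bf Cne by blast+
    have Csplit: "measure lborel (\<Union>\<C>) = measure lborel (\<Union>C1) + measure lborel (\<Union>C2)"
      unfolding C1_def C2_def Union_cut_family by (rule measure_halfspace_split[OF C(3) u(1)])
    have \<theta>: "0 < \<theta>" "\<theta> < 1" using Cpos Csplit by (auto simp: \<theta>_def)
    obtain s where s: "measure lborel (\<Union>\<D> \<inter> {x. x \<bullet> u < s}) = \<theta> * measure lborel (\<Union>\<D>)"
      using exists_halfspace_measure[OF D(2,1) u(1)] \<theta> by (metis less_imp_le)
    define D1 where "D1 = cut_family {x. x \<bullet> u < s} \<D>"
    define D2 where "D2 = cut_family {x. x \<bullet> u > s} \<D>"
    have bfD: "box_family D1" "box_family D2"
      unfolding D1_def D2_def
      by (rule box_family_cut[OF CD(2) lower], rule box_family_cut[OF CD(2) upper])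
    have cardD: "card D1 \<le> card \<D>" "card D2 \<le> card \<D>"
      unfolding D1_def D2_def using card_cut_family fin by auto
    have Dsplit: "measure lborel (\<Union>\<D>) = measure lborel (\<Union>D1) + measure lborel (\<Union>D2)"
      unfolding D1_def D2_def Union_cut_family by (rule measure_halfspace_split[OF D(3) u(1)])
    have Dpos: "measure lborel (\<Union>\<D>) > 0" using measure_box_family_pos CD by blast
    have mD: "measure lborel (\<Union>D1) = \<theta> * measure lborel (\<Union>\<D>)"
      using s unfolding D1_def Union_cut_family .
    then have mD2: "measure lborel (\<Union>D2) = (1 - \<theta>) * measure lborel (\<Union>\<D>)"
      using Dsplit by (simp add: algebra_simps)
    have mC: "measure lborel (\<Union>C1) = \<theta> * measure lborel (\<Union>\<C>)" using Cpos by (simp add: \<theta>_def)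
    then have mC2: "measure lborel (\<Union>C2) = (1 - \<theta>) * measure lborel (\<Union>\<C>)"
      using Csplit by (simp add: algebra_simps)
    have "measure lborel (\<Union>D1) > 0" "measure lborel (\<Union>D2) > 0" using mD mD2 Dpos \<theta> by simp_all
    then have Dne: "D1 \<noteq> {}" "D2 \<noteq> {}" by auto
    have "bm_sum (\<Union>\<C>) (\<Union>\<D>) powr DIM('a)
        = \<theta> * bm_sum (\<Union>\<C>) (\<Union>\<D>) powr DIM('a) + (1 - \<theta>) * bm_sum (\<Union>\<C>) (\<Union>\<D>) powr DIM('a)"
      by (simp add: algebra_simps)
    also have "\<dots> = bm_sum (\<Union>C1) (\<Union>D1) powr DIM('a) + bm_sum (\<Union>C2) (\<Union>D2) powr DIM('a)"
      using bm_sum_scale[OF mC mD] bm_sum_scale[OF mC2 mD2] \<theta> by simp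
    also have "\<dots> \<le> measure lborel (sumset (\<Union>C1) (\<Union>D1)) + measure lborel (sumset (\<Union>C2) (\<Union>D2))"
      by (intro add_mono less(1)) (use card cardD eq bf bfD Cne Dne in linarith)+
    also have "\<dots> = measure lborel (sumset (\<Union>C1) (\<Union>D1) \<union> sumset (\<Union>C2) (\<Union>D2))"
    proof -
      have f: "sumset (\<Union>C1) (\<Union>D1) \<in> fmeasurable lborel" "sumset (\<Union>C2) (\<Union>D2) \<in> fmeasurable lborel"
        using box_familyD[OF bf(1)] box_familyD[OF bf(2)] box_familyD[OF bfD(1)] box_familyD[OF bfD(2)]
        by (auto intro!: fmeasurable_bounded_open bounded_sumset open_sumset)
      \<comment> \<open>The two partial sumsets lie on opposite sides of the hyperplane at height
        \<open>t + s\<close>, so their measures add.\<close>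
      have "sumset (\<Union>C1) (\<Union>D1) \<subseteq> {x. x \<bullet> u < t + s}" "sumset (\<Union>C2) (\<Union>D2) \<subseteq> {x. x \<bullet> u > t + s}"
        unfolding C1_def C2_def D1_def D2_def Union_cut_family sumset_def
        by (auto simp: inner_add_left)
      then have "sumset (\<Union>C1) (\<Union>D1) \<inter> sumset (\<Union>C2) (\<Union>D2) = {}" by fastforce
      then show ?thesis using f by (intro measure_Un_AE[symmetric] AE_I2) auto
    qed
    also have "\<dots> \<le> measure lborel (sumset (\<Union>\<C>) (\<Union>\<D>))"
    proof (rule measure_mono_fmeasurable)
      show "sumset (\<Union>C1) (\<Union>D1) \<union> sumset (\<Union>C2) (\<Union>D2) \<subseteq> sumset (\<Union>\<C>) (\<Union>\<D>)"
        unfolding C1_def C2_def D1_def D2_def Union_cut_family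
        by (intro Un_least sumset_mono) auto
      have "open (sumset (\<Union>C1) (\<Union>D1) \<union> sumset (\<Union>C2) (\<Union>D2))"
        using box_familyD[OF bf(1)] box_familyD[OF bf(2)] box_familyD[OF bfD(1)] box_familyD[OF bfD(2)]
        by (auto intro!: open_sumset open_Un)
      then show "sumset (\<Union>C1) (\<Union>D1) \<union> sumset (\<Union>C2) (\<Union>D2) \<in> sets lborel" by simp
      show "sumset (\<Union>\<C>) (\<Union>\<D>) \<in> fmeasurable lborel"
        using C D by (auto intro!: fmeasurable_bounded_open bounded_sumset open_sumset)
    qed
    finally show ?thesis .
  qed
  consider "card \<A> \<noteq> 1" | "card \<B> \<noteq> 1" | "card \<A> = 1" "card \<B> = 1" by blast
  then show ?case
  proof cases
    case 1
    then show ?thesis using step less by blast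
  next
    case 2
    then show ?thesis
      using step[of \<B> \<A>] less by (simp add: bm_sum_commute sumset_commute add.commute)
  next
    case 3
    then obtain K L where "\<A> = {K}" "\<B> = {L}" by (metis card_1_singletonE)
    moreover from this obtain a b c d where "K = box a b" "L = box c d"
      using less.prems unfolding box_family_def by auto
    ultimately show ?thesis using bm_box[of a b c d] less.prems by (auto simp: box_family_def)
  qed
qed

text \<open>The covering lemma of gauge integration, with a gauge whose balls around points of
  \<open>U\<close> stay in \<open>U\<close>, fills \<open>U\<close> with countably many closed boxes
  with disjoint interiors. Their boundaries are null, so finitely many of the interiors carry almost
  all of the measure.\<close>

lemma inner_box_family:
  fixes U :: "'a::euclidean_space set"
  assumes "open U" "bounded U" "e > 0"
  obtains \<A> where "box_family \<A>" "\<Union>\<A> \<subseteq> U" "measure lborel U - e < measure lborel (\<Union>\<A>)"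
proof -
  obtain c where c: "U \<subseteq> cbox (- c) c" using bounded_subset_cbox_symmetric[OF assms(2)] by blast
  \<comment> \<open>Enlarged by 1 in every coordinate so that the open box is nonempty, as the
    covering lemma demands.\<close>
  define b where "b = (\<Sum>i\<in>Basis. (\<bar>c \<bullet> i\<bar> + 1) *\<^sub>R i)"
  have b: "U \<subseteq> cbox (- b) b" "box (- b) b \<noteq> {}"
  proof -
    have "- (\<bar>c \<bullet> i\<bar> + 1) \<le> x \<bullet> i \<and> x \<bullet> i \<le> \<bar>c \<bullet> i\<bar> + 1" if "x \<in> U" "i \<in> Basis" for x i
      using c that by (force simp: mem_box)
    then show "U \<subseteq> cbox (- b) b" by (auto simp: mem_box b_def)
    show "box (- b) b \<noteq> {}" unfolding box_ne_empty b_def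
      by (auto intro: le_less_trans[OF _ zero_less_one] add_nonneg_pos simp: neg_less_pos)
  qed
  define g where "g x = (if x \<in> U then ball x (SOME r. r > 0 \<and> ball x r \<subseteq> U) else ball x 1)" for x
  have r: "(SOME r. r > 0 \<and> ball x r \<subseteq> U) > 0 \<and> ball x (SOME r. r > 0 \<and> ball x r \<subseteq> U) \<subseteq> U" if "x \<in> U" for x
    using assms(1) that by (intro someI_ex[of "\<lambda>r. r > 0 \<and> ball x r \<subseteq> U"]) (auto simp: open_contains_ball)
  have g: "gauge g" unfolding gauge_def g_def using r by auto
  have gU: "g x \<subseteq> U" if "x \<in> U" for x using r[OF that] that by (simp add: g_def)
  obtain \<D> where D: "countable \<D>" "\<And>K. K \<in> \<D> \<Longrightarrow> interior K \<noteq> {} \<and> (\<exists>c d. K = cbox c d)"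
    "pairwise (\<lambda>A B. interior A \<inter> interior B = {}) \<D>" "\<And>K. K \<in> \<D> \<Longrightarrow> \<exists>x \<in> U \<inter> K. K \<subseteq> g x" "U \<subseteq> \<Union>\<D>"
    using covering_lemma[OF b g] by metis
  have KU: "K \<subseteq> U" if "K \<in> \<D>" for K using D(4)[OF that] gU by blast
  show ?thesis
  proof (cases "\<D> = {}")
    case True
    then have "U = {}" using D by auto
    then show ?thesis using that[of "{}"] assms by (simp add: box_family_def)
  next
    case False
    define f where "f = from_nat_into \<D>"
    have f: "range f = \<D>" unfolding f_def using False D(1) by (rule range_from_nat_into)
    define S where "S n = (\<Union>i<n. interior (f i))" for n :: nat
    have oS: "open (S n)" for n unfolding S_def by auto
    have SU: "S n \<subseteq> U" for n unfolding S_def using KU f interior_subset by blast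
    have "(\<lambda>n. measure lborel (S n)) \<longlonglongrightarrow> measure lborel (\<Union>n. S n)"
    proof (rule Lim_measure_incseq)
      show "incseq S" unfolding S_def by (intro incseq_SucI) (auto intro: less_SucI)
      have "(\<Union>n. S n) \<subseteq> U" using SU by blast
      then show "emeasure lborel (\<Union>n. S n) \<noteq> \<infinity>"
        using emeasure_bounded_finite bounded_subset[OF assms(2)] by (metis less_irrefl)
    qed (use oS in auto)
    moreover have "measure lborel (\<Union>n. S n) = measure lborel U"
    proof (rule measure_eq_AE)
      have "AE x in lborel. \<forall>K\<in>\<D>. x \<notin> K - interior K"
      proof (subst AE_ball_countable[OF D(1)], intro ballI)
        fix K assume "K \<in> \<D>"
        then obtain c d where cd: "K = cbox c d" using D by blast
        have "cbox c d - box c d \<in> null_sets lborel"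
        proof -
          have "box c d \<subseteq> cbox c d" by (rule box_subset_cbox)
          then show ?thesis
            by (simp add: null_sets_def emeasure_Diff emeasure_lborel_box_eq emeasure_lborel_cbox_eq)
        qed
        then show "AE x in lborel. x \<notin> K - interior K"
          unfolding cd interior_cbox by (rule AE_not_in)
      qed
      then show "AE x in lborel. (x \<in> (\<Union>n. S n)) = (x \<in> U)"
      proof eventually_elim
        case (elim x)
        show ?case
        proof
          assume "x \<in> U"
          then obtain K where "K \<in> \<D>" "x \<in> K" using D(5) by blast
          then have "x \<in> interior K" using elim by blast
          moreover obtain i where "K = f i" using \<open>K \<in> \<D>\<close> f by blast
          ultimately have "x \<in> S (Suc i)" unfolding S_def by blast
          then show "x \<in> (\<Union>n. S n)" by blast
        qed (use SU in blast)
      qed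
    qed (use oS assms in \<open>auto intro!: borel_open\<close>)
    ultimately have "eventually (\<lambda>n. measure lborel U - e < measure lborel (S n)) sequentially"
      using assms(3) by (intro order_tendstoD(1)) auto
    then obtain n where n: "measure lborel U - e < measure lborel (S n)"
      by (auto simp: eventually_sequentially)
    have "box_family (interior ` f ` {..<n})"
      unfolding box_family_def
    proof (intro conjI ballI)
      show "disjoint (interior ` f ` {..<n})"
        unfolding disjoint_def
      proof (intro ballI impI)
        fix K L assume KL: "K \<in> interior ` f ` {..<n}" "L \<in> interior ` f ` {..<n}" "K \<noteq> L"
        then obtain i j where ij: "K = interior (f i)" "L = interior (f j)" by auto
        then have "f i \<noteq> f j" using KL(3) by auto
        then show "K \<inter> L = {}" using D(3) f unfolding ij pairwise_def by blast
      qed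
      fix K assume "K \<in> interior ` f ` {..<n}"
      then obtain L where L: "L \<in> \<D>" "K = interior L" using f by auto
      then show "K \<noteq> {}" using D by blast
      obtain c d where "L = cbox c d" using D(2)[OF L(1)] by blast
      then show "\<exists>a b. K = box a b" using L(2) interior_cbox by blast
    qed auto
    moreover have "\<Union>(interior ` f ` {..<n}) = S n" unfolding S_def by auto
    ultimately show ?thesis using SU n by (intro that[of "interior ` f ` {..<n}"]) auto
  qed
qed

text \<open>Only \<open>A\<close> and \<open>B\<close> are approximated, and from inside: the sumset
  of the inner families lies in \<open>sumset A B\<close>, so the right-hand side needs no
  limit.\<close>

lemma brunn_minkowski:
  fixes A B :: "'a::euclidean_space set"
  assumes "open A" "bounded A" "A \<noteq> {}" "open B" "bounded B" "B \<noteq> {}"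
  shows "measure lborel A powr (1 / DIM('a)) + measure lborel B powr (1 / DIM('a))
     \<le> measure lborel (sumset A B) powr (1 / DIM('a))"
proof -
  have pos: "measure lborel U > 0" if U: "open U" "bounded U" "U \<noteq> {}" for U :: "'a set"
  proof -
    obtain x where "x \<in> U" using U by blast
    then obtain r where x: "r > 0" "ball x r \<subseteq> U" using U(1) unfolding open_contains_ball by blast
    have "0 < measure lborel (ball x r)" using x by simp
    also have "\<dots> \<le> measure lborel U"
      using x fmeasurable_bounded_open[OF U(2,1)] by (intro measure_mono_fmeasurable) auto
    finally show ?thesis .
  qed
  have ex: "\<exists>F. \<forall>n. box_family (F n) \<and> \<Union>(F n) \<subseteq> U \<and> F n \<noteq> {} \<and> \<bar>measure lborel (\<Union>(F n)) - measure lborel U\<bar> < inverse (real (Suc n))"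
    if U: "open U" "bounded U" "U \<noteq> {}" for U :: "'a set"
  proof (rule choice, intro allI)
    fix n
    \<comment> \<open>The cap by the measure of \<open>U\<close> forces the approximating family to
      have positive measure, hence to be nonempty.\<close>
    define e where "e = min (inverse (real (Suc n))) (measure lborel U)"
    have "e > 0" using pos[OF U] by (simp add: e_def)
    obtain \<A> where A: "box_family \<A>" "\<Union>\<A> \<subseteq> U" "measure lborel U - e < measure lborel (\<Union>\<A>)"
      using inner_box_family[OF U(1,2) \<open>e > 0\<close>] by blast
    have "measure lborel (\<Union>\<A>) > 0" using A(3) by (simp add: e_def)
    then have "\<A> \<noteq> {}" by auto
    moreover have "measure lborel (\<Union>\<A>) \<le> measure lborel U"
      using A fmeasurable_bounded_open[OF U(2,1)] box_familyD[OF A(1)] by (intro measure_mono_fmeasurable) auto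
    then have "\<bar>measure lborel (\<Union>\<A>) - measure lborel U\<bar> < e" using A(3) by linarith
    then have "\<bar>measure lborel (\<Union>\<A>) - measure lborel U\<bar> < inverse (real (Suc n))" by (simp add: e_def)
    ultimately show "\<exists>F. box_family F \<and> \<Union>F \<subseteq> U \<and> F \<noteq> {} \<and> \<bar>measure lborel (\<Union>F) - measure lborel U\<bar> < inverse (real (Suc n))"
      using A(1,2) by (intro exI[of _ \<A>] conjI)
  qed
  have lim: "(\<lambda>n. measure lborel (\<Union>(F n))) \<longlonglongrightarrow> measure lborel U"
    if "\<forall>n. box_family (F n) \<and> \<Union>(F n) \<subseteq> U \<and> F n \<noteq> {} \<and> \<bar>measure lborel (\<Union>(F n)) - measure lborel U\<bar> < inverse (real (Suc n))"
    for F and U :: "'a set"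
  proof (rule LIM_zero_cancel, rule Lim_null_comparison[OF _ LIMSEQ_inverse_real_of_nat], intro always_eventually allI)
    fix n show "norm (measure lborel (\<Union>(F n)) - measure lborel U) \<le> inverse (real (Suc n))"
      using that[rule_format, of n] unfolding real_norm_def by linarith
  qed
  obtain F where F: "\<forall>n. box_family (F n) \<and> \<Union>(F n) \<subseteq> A \<and> F n \<noteq> {} \<and> \<bar>measure lborel (\<Union>(F n)) - measure lborel A\<bar> < inverse (real (Suc n))"
    using ex[OF assms(1-3)] by blast
  obtain G where G: "\<forall>n. box_family (G n) \<and> \<Union>(G n) \<subseteq> B \<and> G n \<noteq> {} \<and> \<bar>measure lborel (\<Union>(G n)) - measure lborel B\<bar> < inverse (real (Suc n))"
    using ex[OF assms(4-6)] by blast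
  have d: "real DIM('a) > 0" by simp
  have sf: "sumset A B \<in> fmeasurable lborel"
    using assms by (intro fmeasurable_bounded_open bounded_sumset open_sumset)
  have le: "bm_sum (\<Union>(F n)) (\<Union>(G n)) \<le> measure lborel (sumset A B) powr (1 / DIM('a))" for n
  proof -
    have "bm_sum (\<Union>(F n)) (\<Union>(G n)) powr DIM('a) \<le> measure lborel (sumset (\<Union>(F n)) (\<Union>(G n)))"
      using F G by (intro brunn_minkowski_boxes) auto
    also have "\<dots> \<le> measure lborel (sumset A B)"
    proof (rule measure_mono_fmeasurable[OF _ _ sf])
      show "sumset (\<Union>(F n)) (\<Union>(G n)) \<subseteq> sumset A B" using F G by (intro sumset_mono) auto
      have "open (sumset (\<Union>(F n)) (\<Union>(G n)))" using F G by (intro open_sumset box_familyD(1)) auto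
      then show "sumset (\<Union>(F n)) (\<Union>(G n)) \<in> sets lborel" by simp
    qed
    finally have "(bm_sum (\<Union>(F n)) (\<Union>(G n)) powr DIM('a)) powr (1 / DIM('a)) \<le> measure lborel (sumset A B) powr (1 / DIM('a))"
      by (intro powr_mono2) auto
    then show ?thesis using d by (simp add: powr_powr bm_sum_def)
  qed
  have "(\<lambda>n. bm_sum (\<Union>(F n)) (\<Union>(G n))) \<longlonglongrightarrow> bm_sum A B"
    unfolding bm_sum_def
    using pos[OF assms(1-3)] pos[OF assms(4-6)]
    by (intro tendsto_add tendsto_powr lim[OF F] lim[OF G] tendsto_const) auto
  then have "bm_sum A B \<le> measure lborel (sumset A B) powr (1 / DIM('a))"
    by (rule LIMSEQ_le_const2) (use le in auto)
  then show ?thesis unfolding bm_sum_def .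
qed

section \<open>Continuously differentiable functions and mollification\<close>

text \<open>The gradient is carried along as an explicit argument, so that products, compositions
  and convolutions return a formula for it.\<close>

definition C1 :: "('a::euclidean_space \<Rightarrow> real) \<Rightarrow> ('a \<Rightarrow> 'a) \<Rightarrow> bool" where
  "C1 f G \<longleftrightarrow> (\<forall>x. (f has_derivative (\<lambda>h. G x \<bullet> h)) (at x)) \<and> continuous_on UNIV G"

definition C1c :: "('a::euclidean_space \<Rightarrow> real) \<Rightarrow> ('a \<Rightarrow> 'a) \<Rightarrow> bool" where
  "C1c f G \<longleftrightarrow> C1 f G \<and> bounded {x. f x \<noteq> 0}"

lemma C1_continuous: "C1 f G \<Longrightarrow> continuous_on UNIV f"
  unfolding C1_def by (meson continuous_at_imp_continuous_on has_derivative_continuous)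

lemma C1c_C1: "C1c f G \<Longrightarrow> C1 f G"
  by (simp add: C1c_def)

text \<open>Outside a large ball \<open>f\<close> vanishes on an open set, so uniqueness of the
  derivative makes the gradient vanish there as well.\<close>

lemma C1c_support:
  assumes "C1c f G"
  obtains R where "R > 0" "\<And>x. norm x > R \<Longrightarrow> f x = 0" "\<And>x. norm x > R \<Longrightarrow> G x = 0"
proof -
  obtain R where R: "R > 0" "\<And>x. f x \<noteq> 0 \<Longrightarrow> norm x \<le> R"
    using assms unfolding C1c_def bounded_pos by auto
  have f0: "f x = 0" if "norm x > R" for x using R(2)[of x] that by linarith
  have "G x = 0" if x: "norm x > R" for x
  proof -
    have op: "open {x::'a. norm x > R}" by (intro open_Collect_less continuous_intros)
    have "((\<lambda>_. 0) has_derivative (\<lambda>h. G x \<bullet> h)) (at x)"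
    proof (rule has_derivative_transform_within_open[OF _ op])
      show "(f has_derivative (\<lambda>h. G x \<bullet> h)) (at x)" using assms by (simp add: C1c_def C1_def)
    qed (use x f0 in auto)
    then have "(\<lambda>h. G x \<bullet> h) = (\<lambda>h. 0)"
      using has_derivative_unique has_derivative_const by blast
    then have "G x \<bullet> G x = 0" by metis
    then show ?thesis by simp
  qed
  then show ?thesis using that[OF R(1) f0] by blast
qed

text \<open>Heine-Cantor on the ball of radius \<open>R + 1\<close>. If two points at distance below
  1 are not both in it, neither lies in the ball of radius \<open>R\<close>.\<close>

lemma compact_support_uniform:
  fixes f :: "'a::euclidean_space \<Rightarrow> 'b::real_normed_vector"
  assumes "continuous_on UNIV f" "\<And>x. norm x > R \<Longrightarrow> f x = 0" "e > 0"
  obtains d where "d > 0" "\<And>x y. norm (x - y) < d \<Longrightarrow> norm (f x - f y) < e"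
proof -
  have "uniformly_continuous_on (cball 0 (R + 1)) f"
    by (rule compact_uniformly_continuous) (auto intro: continuous_on_subset[OF assms(1)])
  then obtain d where d: "d > 0" "\<And>x y. x \<in> cball 0 (R + 1) \<Longrightarrow> y \<in> cball 0 (R + 1) \<Longrightarrow> dist y x < d \<Longrightarrow> dist (f y) (f x) < e"
    using assms(3) unfolding uniformly_continuous_on_def by metis
  show ?thesis
  proof (rule that[of "min d 1"])
    fix x y :: 'a assume xy: "norm (x - y) < min d 1"
    show "norm (f x - f y) < e"
    proof (cases "norm x \<le> R + 1 \<and> norm y \<le> R + 1")
      case True
      then show ?thesis using d(2)[of y x] xy by (simp add: dist_norm)
    next
      case False
      then have "norm x > R \<and> norm y > R"
        using xy norm_triangle_ineq2[of x y] norm_triangle_ineq3[of x y] by auto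
      then show ?thesis using assms by simp
    qed
  qed (use d in auto)
qed

lemma compact_support_bounded:
  fixes f :: "'a::euclidean_space \<Rightarrow> 'b::real_normed_vector"
  assumes "continuous_on UNIV f" "\<And>x. norm x > R \<Longrightarrow> f x = 0"
  obtains B where "B > 0" "\<And>x. norm (f x) \<le> B"
proof -
  have "bounded (f ` cball 0 R)"
    by (intro compact_imp_bounded compact_continuous_image continuous_on_subset[OF assms(1)]) auto
  then obtain B where B: "B > 0" "\<And>x. x \<in> cball 0 R \<Longrightarrow> norm (f x) \<le> B"
    unfolding bounded_pos by blast
  have "norm (f x) \<le> B" for x
    using B assms(2)[of x] by (cases "norm x \<le> R") auto
  then show ?thesis using that B(1) by blast
qed

lemma compact_support_integrable:
  fixes f :: "'a::euclidean_space \<Rightarrow> 'b::{banach, second_countable_topology}"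
  assumes "continuous_on UNIV f" "\<And>x. norm x > R \<Longrightarrow> f x = 0"
  shows "integrable lborel f"
proof -
  have "integrable lborel (\<lambda>x. indicator (cball 0 R) x *\<^sub>R f x)"
    by (intro borel_integrable_compact continuous_on_subset[OF assms(1)]) auto
  moreover have "(\<lambda>x. indicator (cball 0 R) x *\<^sub>R f x) = f"
    using assms(2) by (fastforce simp: indicator_def)
  ultimately show ?thesis by simp
qed

lemma C1c_integrable:
  assumes "C1c f G"
  shows "integrable lborel f" "integrable lborel G"
proof -
  obtain R where R: "\<And>x. norm x > R \<Longrightarrow> f x = 0" "\<And>x. norm x > R \<Longrightarrow> G x = 0"
    using C1c_support[OF assms] by metis
  show "integrable lborel f"
    by (rule compact_support_integrable[OF C1_continuous[OF C1c_C1[OF assms]] R(1)])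
  show "integrable lborel G"
    using assms by (intro compact_support_integrable[OF _ R(2)]) (auto simp: C1c_def C1_def)
qed

lemma C1_measurable [measurable_dest]:
  assumes "C1 f G"
  shows "f \<in> borel_measurable borel" "G \<in> borel_measurable borel"
  using assms C1_continuous[OF assms] unfolding C1_def
  by (auto intro: borel_measurable_continuous_onI)

text \<open>The mean value theorem along the segment from \<open>x\<close> to \<open>x + h\<close>,
  with uniform continuity of \<open>G\<close>, makes the first-order remainder small uniformly in
  \<open>x\<close>. Differentiation of convolutions and the comparison of neighbourhoods of
  superlevel sets rest on this.\<close>

lemma C1c_uniform:
  fixes f :: "'a::euclidean_space \<Rightarrow> real"
  assumes "C1c f G" "e > 0"
  obtains d where "d > 0" "\<And>x h. norm h < d \<Longrightarrow> \<bar>f (x + h) - f x - G x \<bullet> h\<bar> \<le> e * norm h"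
    "\<And>x h. norm h < d \<Longrightarrow> norm (G (x + h) - G x) \<le> e"
proof -
  obtain R where R: "\<And>x. norm x > R \<Longrightarrow> G x = 0"
    using C1c_support[OF assms(1)] by metis
  have G: "continuous_on UNIV G" and der: "(f has_derivative (\<lambda>h. G x \<bullet> h)) (at x)" for x
    using assms by (auto simp: C1c_def C1_def)
  obtain d where d: "d > 0" "\<And>x y. norm (x - y) < d \<Longrightarrow> norm (G x - G y) < e"
    using compact_support_uniform[OF G R assms(2)] by metis
  show ?thesis
  proof (rule that[OF d(1)])
    fix x h :: 'a assume h: "norm h < d"
    then show "norm (G (x + h) - G x) \<le> e" using d(2)[of "x + h" x] by simp
    have "\<exists>t\<in>{0<..<1}. f (x + 1 *\<^sub>R h) - f (x + 0 *\<^sub>R h) = (\<lambda>s. G (x + t *\<^sub>R h) \<bullet> (s *\<^sub>R h)) (1 - 0)"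
    proof (rule mvt_simple)
      fix t :: real
      show "((\<lambda>a. f (x + a *\<^sub>R h)) has_derivative (\<lambda>s. G (x + t *\<^sub>R h) \<bullet> (s *\<^sub>R h))) (at t within {0..1})"
        by (rule has_derivative_compose[of "\<lambda>a. x + a *\<^sub>R h" "\<lambda>s. s *\<^sub>R h", OF _ der])
           (auto intro!: derivative_eq_intros)
    qed auto
    then obtain t where t: "0 < t" "t < 1" "f (x + h) - f x = G (x + t *\<^sub>R h) \<bullet> h" by auto
    have "t * norm h \<le> norm h" using t by (simp add: mult_left_le_one_le)
    then have "norm (G (x + t *\<^sub>R h) - G x) < e" using t h by (intro d(2)) simp
    then have "\<bar>(G (x + t *\<^sub>R h) - G x) \<bullet> h\<bar> \<le> e * norm h"
      using Cauchy_Schwarz_ineq2[of "G (x + t *\<^sub>R h) - G x" h]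
      by (meson less_imp_le mult_right_mono norm_ge_zero order_trans)
    then show "\<bar>f (x + h) - f x - G x \<bullet> h\<bar> \<le> e * norm h"
      using t by (simp add: inner_diff_left)
  qed
qed

section \<open>Calculus of C1 functions\<close>

lemma C1_mult:
  assumes "C1 f F" "C1 g G"
  shows "C1 (\<lambda>x. f x * g x) (\<lambda>x. f x *\<^sub>R G x + g x *\<^sub>R F x)"
  unfolding C1_def
proof (intro conjI allI)
  fix x
  have "(f has_derivative (\<lambda>h. F x \<bullet> h)) (at x)" "(g has_derivative (\<lambda>h. G x \<bullet> h)) (at x)"
    using assms by (auto simp: C1_def)
  from has_derivative_mult[OF this]
  show "((\<lambda>x. f x * g x) has_derivative (\<lambda>h. (f x *\<^sub>R G x + g x *\<^sub>R F x) \<bullet> h)) (at x)"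
    by (simp add: inner_add_left mult.commute)
  show "continuous_on UNIV (\<lambda>x. f x *\<^sub>R G x + g x *\<^sub>R F x)"
    using assms C1_continuous by (intro continuous_intros) (auto simp: C1_def)
qed

lemma C1c_mult:
  assumes "C1 f F" "C1c g G"
  shows "C1c (\<lambda>x. f x * g x) (\<lambda>x. f x *\<^sub>R G x + g x *\<^sub>R F x)"
proof -
  have "bounded {x. f x * g x \<noteq> 0}"
    by (rule bounded_subset[of "{x. g x \<noteq> 0}"]) (use assms in \<open>auto simp: C1c_def\<close>)
  then show ?thesis using C1_mult assms by (auto simp: C1c_def)
qed

lemma C1_add:
  assumes "C1 f F" "C1 g G"
  shows "C1 (\<lambda>x. f x + g x) (\<lambda>x. F x + G x)"
  using assms unfolding C1_def by (auto simp: inner_add_left intro!: derivative_eq_intros continuous_intros)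

lemma C1c_add:
  assumes "C1c f F" "C1c g G"
  shows "C1c (\<lambda>x. f x + g x) (\<lambda>x. F x + G x)"
proof -
  have "bounded {x. f x + g x \<noteq> 0}"
    by (rule bounded_subset[of "{x. f x \<noteq> 0} \<union> {x. g x \<noteq> 0}"]) (use assms in \<open>auto simp: C1c_def\<close>)
  then show ?thesis using C1_add assms by (auto simp: C1c_def)
qed

lemma C1c_zero: "C1c (\<lambda>x. 0) (\<lambda>x. 0)"
  by (simp add: C1c_def C1_def)

lemma C1c_sum:
  assumes "\<And>i. i \<in> I \<Longrightarrow> C1c (f i) (F i)"
  shows "C1c (\<lambda>x. \<Sum>i\<in>I. f i x) (\<lambda>x. \<Sum>i\<in>I. F i x)"
  using assms by (induction I rule: infinite_finite_induct) (auto intro: C1c_zero C1c_add)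

lemma C1_const: "C1 (\<lambda>x. c) (\<lambda>x. 0)"
  by (simp add: C1_def)

lemma C1_inner: "C1 (\<lambda>x. x \<bullet> v) (\<lambda>x. v)"
  unfolding C1_def by (auto intro!: derivative_eq_intros simp: inner_commute)

lemma C1_norm_sq: "C1 (\<lambda>x. x \<bullet> x) (\<lambda>x. 2 *\<^sub>R x)"
  unfolding C1_def by (auto intro!: derivative_eq_intros continuous_intros simp: inner_commute)

lemma C1_compose_real:
  assumes "C1 f F" "\<And>t. (s has_real_derivative s' t) (at t)" "continuous_on UNIV s'"
  shows "C1 (\<lambda>x. s (f x)) (\<lambda>x. s' (f x) *\<^sub>R F x)"
  unfolding C1_def
proof (intro conjI allI)
  fix x
  have "(f has_derivative (\<lambda>h. F x \<bullet> h)) (at x)" using assms by (auto simp: C1_def)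
  moreover have "(s has_derivative (\<lambda>h. s' (f x) * h)) (at (f x))"
    using assms(2) by (simp add: has_field_derivative_def)
  ultimately show "((\<lambda>x. s (f x)) has_derivative (\<lambda>h. (s' (f x) *\<^sub>R F x) \<bullet> h)) (at x)"
    using has_derivative_compose[of f] by fastforce
  show "continuous_on UNIV (\<lambda>x. s' (f x) *\<^sub>R F x)"
    using assms C1_continuous[OF assms(1)]
    by (intro continuous_intros continuous_on_compose2[OF assms(3)]) (auto simp: C1_def)
qed

lemma C1_compose_fst:
  fixes f :: "'a::euclidean_space \<Rightarrow> real"
  shows "C1 f F \<Longrightarrow> C1 (\<lambda>(p, w::'b::euclidean_space). f p) (\<lambda>(p, w). (F p, 0))"
  unfolding C1_def split_beta
proof (intro conjI allI; elim conjE)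
  fix x :: "'a \<times> 'b" assume "\<forall>x. (f has_derivative (\<bullet>) (F x)) (at x)"
  then have "(f has_derivative (\<lambda>h. F (fst x) \<bullet> h)) (at (fst x))" by blast
  with has_derivative_fst[OF has_derivative_ident]
  have "((\<lambda>x. f (fst x)) has_derivative (\<lambda>h. F (fst x) \<bullet> fst h)) (at x)"
    by (rule has_derivative_compose)
  moreover have "(\<bullet>) (F (fst x), 0::'b) = (\<lambda>h. F (fst x) \<bullet> fst h)" by (auto simp: inner_prod_def)
  ultimately show "((\<lambda>p. f (fst p)) has_derivative (\<bullet>) (F (fst x), 0)) (at x)" by simp
next
  assume "continuous_on UNIV F"
  then have "continuous_on UNIV (\<lambda>p::'a\<times>'b. F (fst p))"
    by (rule continuous_on_compose2) (auto intro: continuous_intros)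
  then show "continuous_on UNIV (\<lambda>p::'a \<times> 'b. (F (fst p), 0::'b))"
    by (intro continuous_intros)
qed

lemma C1_compose_snd:
  fixes f :: "'a::euclidean_space \<Rightarrow> real"
  shows "C1 f F \<Longrightarrow> C1 (\<lambda>(p::'b::euclidean_space, w). f w) (\<lambda>(p, w). (0, F w))"
  unfolding C1_def split_beta
proof (intro conjI allI; elim conjE)
  fix x :: "'b \<times> 'a" assume "\<forall>x. (f has_derivative (\<bullet>) (F x)) (at x)"
  then have "(f has_derivative (\<lambda>h. F (snd x) \<bullet> h)) (at (snd x))" by blast
  with has_derivative_snd[OF has_derivative_ident]
  have "((\<lambda>x. f (snd x)) has_derivative (\<lambda>h. F (snd x) \<bullet> snd h)) (at x)"
    by (rule has_derivative_compose)
  moreover have "(\<bullet>) (0::'b, F (snd x)) = (\<lambda>h. F (snd x) \<bullet> snd h)" by (auto simp: inner_prod_def)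
  ultimately show "((\<lambda>p. f (snd p)) has_derivative (\<bullet>) (0, F (snd x))) (at x)" by simp
next
  assume "continuous_on UNIV F"
  then have "continuous_on UNIV (\<lambda>p::'b \<times> 'a. F (snd p))"
    by (rule continuous_on_compose2) (auto intro: continuous_intros)
  then show "continuous_on UNIV (\<lambda>p::'b \<times> 'a. (0::'b, F (snd p)))"
    by (intro continuous_intros)
qed

lemma C1c_tensor:
  assumes "C1c f F" "C1c g G"
  shows "C1c (\<lambda>(p, w). f p * g w) (\<lambda>(p, w). (g w *\<^sub>R F p, f p *\<^sub>R G w))"
proof -
  have "bounded {x. (case x of (p, w) \<Rightarrow> f p * g w) \<noteq> 0}"
    by (rule bounded_subset[of "{x. f x \<noteq> 0} \<times> {x. g x \<noteq> 0}"])
       (use assms in \<open>auto simp: C1c_def intro!: bounded_Times\<close>)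
  then show ?thesis
    using C1_mult[OF C1_compose_fst[OF C1c_C1[OF assms(1)]] C1_compose_snd[OF C1c_C1[OF assms(2)]]]
    by (simp add: C1c_def split_beta')
qed

section \<open>Invariance of Lebesgue measure and integrals of gradients\<close>

lemma distr_lborel_isometry:
  assumes "\<bar>c\<bar> = (1::real)"
  shows "distr lborel borel (\<lambda>x::'a::euclidean_space. a + c *\<^sub>R x) = lborel"
proof -
  have "c \<noteq> 0" using assms by auto
  from lborel_affine[OF this, of a] show ?thesis using assms by (simp add: density_1)
qed

lemma lborel_isometry:
  fixes f :: "'a::euclidean_space \<Rightarrow> 'b::{banach, second_countable_topology}"
  assumes [measurable]: "f \<in> borel_measurable borel" and c: "\<bar>c\<bar> = 1"
  shows "(LBINT x. f (a + c *\<^sub>R x)) = (LBINT x. f x)"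
    and "integrable lborel (\<lambda>x. f (a + c *\<^sub>R x)) \<longleftrightarrow> integrable lborel f"
proof -
  have m: "(\<lambda>x::'a. a + c *\<^sub>R x) \<in> borel_measurable lborel" by measurable
  show "(LBINT x. f (a + c *\<^sub>R x)) = (LBINT x. f x)"
    using integral_distr[OF m assms(1)] by (simp add: distr_lborel_isometry[OF c])
  show "integrable lborel (\<lambda>x. f (a + c *\<^sub>R x)) \<longleftrightarrow> integrable lborel f"
    using integrable_distr_eq[OF m assms(1)] by (simp add: distr_lborel_isometry[OF c])
qed

lemma lborel_translation:
  fixes f :: "'a::euclidean_space \<Rightarrow> 'b::{banach, second_countable_topology}"
  assumes "f \<in> borel_measurable borel"
  shows "(LBINT x. f (x + a)) = (LBINT x. f x)"
    and "integrable lborel (\<lambda>x. f (x + a)) \<longleftrightarrow> integrable lborel f"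
  using lborel_isometry[OF assms, of 1 a] by (simp_all add: add.commute)

lemma lborel_reflection:
  fixes f :: "'a::euclidean_space \<Rightarrow> 'b::{banach, second_countable_topology}"
  assumes "f \<in> borel_measurable borel"
  shows "(LBINT x. f (a - x)) = (LBINT x. f x)"
    and "integrable lborel (\<lambda>x. f (a - x)) \<longleftrightarrow> integrable lborel f"
  using lborel_isometry[OF assms, of "-1" a] by simp_all

lemma divide_Suc_mult_le:
  fixes e M :: real
  assumes "0 < e" "0 \<le> M"
  shows "e / (M + 1) * M \<le> e * 1"
proof -
  have "e / (M + 1) * M = e * (M / (M + 1))" by simp
  also have "\<dots> \<le> e * 1" using assms by (intro mult_left_mono) auto
  finally show ?thesis .
qed

text \<open>Division by \<open>M + 1\<close> instead of \<open>M\<close> covers \<open>M = 0\<close>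
  as well.\<close>

lemma le_if_le_add_mult:
  fixes x y M :: real
  assumes le: "\<And>e. e > 0 \<Longrightarrow> x \<le> y + e * M" and M: "M \<ge> 0"
  shows "x \<le> y"
proof (rule field_le_epsilon)
  fix e :: real assume e: "e > 0"
  have "x \<le> y + e / (M + 1) * M" using e M by (intro le divide_pos_pos add_nonneg_pos) auto
  also have "e / (M + 1) * M \<le> e * 1" using e M by (rule divide_Suc_mult_le)
  finally show "x \<le> y + e" by simp
qed

text \<open>Translation invariance makes the integral of \<open>f (x + t *\<^sub>R v) - f x\<close>
  vanish, while this difference equals \<open>t * (G x \<bullet> v)\<close> up to an error
  \<open>e * (t * norm v)\<close> supported in a fixed ball.\<close>

lemma integral_C1c_gradient:
  fixes f :: "'a::euclidean_space \<Rightarrow> real"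
  assumes "C1c f G"
  shows "(LBINT x. G x \<bullet> v) = 0"
proof -
  obtain R where R: "R > 0" "\<And>x. norm x > R \<Longrightarrow> f x = 0" "\<And>x. norm x > R \<Longrightarrow> G x = 0"
    using C1c_support[OF assms] by metis
  have [measurable]: "f \<in> borel_measurable borel" "G \<in> borel_measurable borel"
    using C1_measurable[OF C1c_C1[OF assms]] by auto
  define M where "M = measure lborel (cball (0::'a) (R + norm v))"
  have "\<bar>\<integral>x. G x \<bullet> v \<partial>lborel\<bar> \<le> e * (norm v * M)" if "e > 0" for e
  proof -
    obtain d where d: "d > 0" "\<And>x h. norm h < d \<Longrightarrow> \<bar>f (x + h) - f x - G x \<bullet> h\<bar> \<le> e * norm h"
      using C1c_uniform[OF assms \<open>e > 0\<close>] by metis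
    \<comment> \<open>Small enough for the remainder estimate, also when \<open>v = 0\<close>;
      \<open>t \<le> 1\<close> keeps the translated support in the ball of radius
      \<open>R + norm v\<close>.\<close>
    define t where "t = min 1 (d / (norm v + 1) / 2)"
    have t: "0 < t" "t \<le> 1" using d(1) by (auto simp: t_def add_nonneg_pos)
    have "t * norm v < d"
    proof -
      have "t * (norm v + 1) \<le> (d / (norm v + 1) / 2) * (norm v + 1)"
        by (intro mult_right_mono) (auto simp: t_def)
      also have "\<dots> = d / 2" by (simp add: field_simps add_nonneg_eq_0_iff)
      finally show ?thesis using t d(1) by (simp add: algebra_simps)
    qed
    then have nd: "norm (t *\<^sub>R v) < d" using t by simp
    have q: "\<bar>(f (x + t *\<^sub>R v) - f x) - t * (G x \<bullet> v)\<bar> \<le> e * (t * norm v) * indicator (cball 0 (R + norm v)) x" for x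
    proof (cases "norm x \<le> R + norm v")
      case True
      then show ?thesis using d(2)[OF nd, of x] t by simp
    next
      case False
      have "t * norm v \<le> norm v" using t by (simp add: mult_left_le_one_le)
      then have "norm (x + t *\<^sub>R v) > R" using False norm_triangle_ineq4[of "x + t *\<^sub>R v" "t *\<^sub>R v"] t by simp
      moreover have "norm x > R" using False norm_ge_zero[of v] by linarith
      ultimately show ?thesis using R False by simp
    qed
    have i1: "integrable lborel f" "integrable lborel (\<lambda>x. f (x + t *\<^sub>R v))" "integrable lborel (\<lambda>x. G x \<bullet> v)"
      using C1c_integrable[OF assms] lborel_translation(2)[of f "t *\<^sub>R v"] by auto
    have "t * (LBINT x. G x \<bullet> v) = - (LBINT x. (f (x + t *\<^sub>R v) - f x) - t * (G x \<bullet> v))"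
      using i1 by (simp add: lborel_translation(1))
    then have "t * \<bar>\<integral>x. G x \<bullet> v \<partial>lborel\<bar> = \<bar>\<integral>x. (f (x + t *\<^sub>R v) - f x) - t * (G x \<bullet> v) \<partial>lborel\<bar>"
      using t by (metis abs_minus_cancel abs_mult abs_of_pos)
    also have "\<dots> \<le> (LBINT x. \<bar>(f (x + t *\<^sub>R v) - f x) - t * (G x \<bullet> v)\<bar>)"
      by (rule integral_abs_bound)
    also have "\<dots> \<le> (\<integral>x. e * (t * norm v) * indicator (cball 0 (R + norm v)) x \<partial>(lborel :: 'a measure))"
    proof (rule integral_mono)
      show "integrable lborel (\<lambda>x. e * (t * norm v) * indicat_real (cball (0::'a) (R + norm v)) x)"
        using emeasure_lborel_cball_finite[of "0::'a" "R + norm v"]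
        by (intro integrable_mult_right integrable_real_indicator) auto
    qed (use i1 q in auto)
    also have "\<dots> = e * (t * norm v) * M" by (simp add: M_def)
    finally have "t * \<bar>\<integral>x. G x \<bullet> v \<partial>lborel\<bar> \<le> t * (e * (norm v * M))" by (simp add: algebra_simps)
    then show ?thesis using t by simp
  qed
  moreover have "norm v * M \<ge> 0" by (simp add: M_def)
  ultimately have "\<bar>\<integral>x. G x \<bullet> v \<partial>lborel\<bar> \<le> 0"
    using le_if_le_add_mult[of "\<bar>\<integral>x. G x \<bullet> v \<partial>lborel\<bar>" 0 "norm v * M"] by simp
  then show ?thesis by simp
qed

section \<open>Convolution with C1 kernels and mollifiers\<close>

definition conv :: "('a::euclidean_space \<Rightarrow> real) \<Rightarrow> ('a \<Rightarrow> 'b::{banach, second_countable_topology}) \<Rightarrow> 'a \<Rightarrow> 'b" where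
  "conv g k x = (LBINT y. g y *\<^sub>R k (x - y))"

lemma conv_integrable:
  fixes k :: "'a::euclidean_space \<Rightarrow> 'b::{banach, second_countable_topology}"
  assumes "integrable lborel g" "k \<in> borel_measurable borel" "\<And>x. norm (k x) \<le> B"
  shows "integrable lborel (\<lambda>y. g y *\<^sub>R k (x - y))"
proof (rule Bochner_Integration.integrable_bound)
  show "integrable lborel (\<lambda>y. B * norm (g y))" using assms(1) by auto
  have [measurable]: "g \<in> borel_measurable borel" "k \<in> borel_measurable borel" using assms by auto
  show "(\<lambda>y. g y *\<^sub>R k (x - y)) \<in> borel_measurable lborel" by measurable
  show "AE y in lborel. norm (g y *\<^sub>R k (x - y)) \<le> norm (B * norm (g y))"
  proof (intro AE_I2)
    fix y
    have "norm (g y *\<^sub>R k (x - y)) \<le> \<bar>g y\<bar> * B" using assms(3) by (simp add: mult_left_mono)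
    moreover have "0 \<le> B" using assms(3)[of 0] norm_ge_zero order_trans by blast
    ultimately show "norm (g y *\<^sub>R k (x - y)) \<le> norm (B * norm (g y))" by (simp add: abs_mult mult.commute)
  qed
qed

text \<open>The uniform first-order remainder of \<open>k\<close>, integrated against the absolute
  value of \<open>g\<close>, bounds the remainder of the convolution with the L1 norm
  \<open>I\<close> of \<open>g\<close> as factor. Thus any integrable \<open>g\<close> becomes
  C1.\<close>

lemma C1_conv:
  fixes g :: "'a::euclidean_space \<Rightarrow> real"
  assumes g: "integrable lborel g" and k: "C1c k K"
  shows "C1 (conv g k) (conv g K)"
proof -
  obtain R where R: "R > 0" "\<And>x. norm x > R \<Longrightarrow> k x = 0" "\<And>x. norm x > R \<Longrightarrow> K x = 0"
    using C1c_support[OF k] by metis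
  have c: "continuous_on UNIV k" "continuous_on UNIV K" 
    using C1_continuous[OF C1c_C1[OF k]] k by (auto simp: C1c_def C1_def)
  have m: "k \<in> borel_measurable borel" "K \<in> borel_measurable borel"
    using C1_measurable[OF C1c_C1[OF k]] by auto
  obtain B1 where B1: "\<And>x. norm (k x) \<le> B1" using compact_support_bounded[OF c(1) R(2)] by metis
  obtain B2 where B2: "\<And>x. norm (K x) \<le> B2" using compact_support_bounded[OF c(2) R(3)] by metis
  note i1 = conv_integrable[OF g m(1) B1] and i2 = conv_integrable[OF g m(2) B2]
  define I where "I = (LBINT y. \<bar>g y\<bar>)"
  have I: "I \<ge> 0" by (simp add: I_def)
  have key: "\<exists>d>0. \<forall>x h. norm h < d \<longrightarrow> \<bar>conv g k (x + h) - conv g k x - conv g K x \<bullet> h\<bar> \<le> e * norm h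
     \<and> norm (conv g K (x + h) - conv g K x) \<le> e" if "e > 0" for e
  proof -
    define e' where "e' = e / (I + 1)"
    have e': "e' > 0" "e' * I \<le> e"
      using that I by (auto simp: e'_def field_simps)
    obtain d where d: "d > 0" "\<And>x h. norm h < d \<Longrightarrow> \<bar>k (x + h) - k x - K x \<bullet> h\<bar> \<le> e' * norm h"
      "\<And>x h. norm h < d \<Longrightarrow> norm (K (x + h) - K x) \<le> e'"
      using C1c_uniform[OF k e'(1)] by metis
    show ?thesis
    proof (intro exI[of _ d] conjI d(1) allI impI)
      fix x h :: 'a assume h: "norm h < d"
      have i3: "integrable lborel (\<lambda>y. g y * (K (x - y) \<bullet> h))"
        using integrable_inner_left[of h, OF i2[of x]] by simp
      have "conv g k (x + h) - conv g k x - conv g K x \<bullet> h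
          = (LBINT y. g y * k (x + h - y)) - (LBINT y. g y * k (x - y)) - (LBINT y. g y * (K (x - y) \<bullet> h))"
        unfolding conv_def using integral_inner_left[of h, OF i2[of x]] by simp
      also have "\<dots> = (LBINT y. g y * k (x + h - y) - g y * k (x - y) - g y * (K (x - y) \<bullet> h))"
        using i1[of "x + h"] i1[of x] i3 by simp
      finally have "\<bar>conv g k (x + h) - conv g k x - conv g K x \<bullet> h\<bar> 
          \<le> (LBINT y. \<bar>g y * k (x + h - y) - g y * k (x - y) - g y * (K (x - y) \<bullet> h)\<bar>)"
        by (simp only: integral_abs_bound)
      also have "\<dots> \<le> (LBINT y. (e' * norm h) * \<bar>g y\<bar>)"
      proof (rule integral_mono)
        show "integrable lborel (\<lambda>y. \<bar>g y * k (x + h - y) - g y * k (x - y) - g y * (K (x - y) \<bullet> h)\<bar>)"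
          using i1[of "x + h"] i1[of x] i3 by (intro integrable_abs integrable_diff) auto
        fix y
        have "\<bar>g y * k (x + h - y) - g y * k (x - y) - g y * (K (x - y) \<bullet> h)\<bar> 
            = \<bar>g y\<bar> * \<bar>k ((x - y) + h) - k (x - y) - K (x - y) \<bullet> h\<bar>"
          by (simp add: abs_mult[symmetric] algebra_simps)
        also have "\<dots> \<le> \<bar>g y\<bar> * (e' * norm h)" by (intro mult_left_mono d(2) h) auto
        finally show "\<bar>g y * k (x + h - y) - g y * k (x - y) - g y * (K (x - y) \<bullet> h)\<bar> \<le> (e' * norm h) * \<bar>g y\<bar>"
          by (simp add: mult.commute)
      qed (use g in auto)
      also have "\<dots> = (e' * I) * norm h" by (simp add: I_def)
      also have "\<dots> \<le> e * norm h" using e' by (intro mult_right_mono) auto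
      finally show "\<bar>conv g k (x + h) - conv g k x - conv g K x \<bullet> h\<bar> \<le> e * norm h" .
      have "conv g K (x + h) - conv g K x = (LBINT y. g y *\<^sub>R K (x + h - y) - g y *\<^sub>R K (x - y))"
        unfolding conv_def using i2 by simp
      then have "norm (conv g K (x + h) - conv g K x) \<le> (LBINT y. norm (g y *\<^sub>R K (x + h - y) - g y *\<^sub>R K (x - y)))"
        by (simp only: integral_norm_bound)
      also have "\<dots> \<le> (LBINT y. e' * \<bar>g y\<bar>)"
      proof (rule integral_mono)
        fix y
        have "norm (g y *\<^sub>R K (x + h - y) - g y *\<^sub>R K (x - y)) = \<bar>g y\<bar> * norm (K ((x - y) + h) - K (x - y))"
          by (simp add: algebra_simps flip: norm_scaleR)
        also have "\<dots> \<le> \<bar>g y\<bar> * e'" by (intro mult_left_mono d(3) h) auto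
        finally show "norm (g y *\<^sub>R K (x + h - y) - g y *\<^sub>R K (x - y)) \<le> e' * \<bar>g y\<bar>" by (simp add: mult.commute)
      qed (use g i2 in auto)
      also have "\<dots> \<le> e" using e' by (simp add: I_def)
      finally show "norm (conv g K (x + h) - conv g K x) \<le> e" .
    qed
  qed
  show ?thesis
    unfolding C1_def
  proof (intro conjI allI)
    fix x
    show "(conv g k has_derivative (\<lambda>h. conv g K x \<bullet> h)) (at x)"
      unfolding has_derivative_at_alt
    proof (intro conjI allI impI bounded_linear_inner_right)
      fix e :: real assume "e > 0"
      from key[OF this] obtain d where d: "d > 0" "\<And>x h. norm h < d \<Longrightarrow> \<bar>conv g k (x + h) - conv g k x - conv g K x \<bullet> h\<bar> \<le> e * norm h"
        by blast
      show "\<exists>d>0. \<forall>y. norm (y - x) < d \<longrightarrow> norm (conv g k y - conv g k x - conv g K x \<bullet> (y - x)) \<le> e * norm (y - x)"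
      proof (intro exI[of _ d] conjI allI impI d(1))
        fix y assume "norm (y - x) < d"
        from d(2)[OF this, of x] show "norm (conv g k y - conv g k x - conv g K x \<bullet> (y - x)) \<le> e * norm (y - x)" by simp
      qed
    qed
  next
    show "continuous_on UNIV (conv g K)"
      unfolding continuous_on_iff
    proof (intro ballI allI impI)
      fix x and e :: real assume "e > 0"
      then have "e / 2 > 0" by simp
      from key[OF this] obtain d where d: "d > 0" "\<And>x h. norm h < d \<Longrightarrow> norm (conv g K (x + h) - conv g K x) \<le> e / 2"
        by blast
      show "\<exists>d>0. \<forall>x'\<in>UNIV. dist x' x < d \<longrightarrow> dist (conv g K x') (conv g K x) < e"
      proof (intro exI[of _ d] conjI ballI impI d(1))
        fix y assume "dist y x < d"
        then have "norm (conv g K (x + (y - x)) - conv g K x) \<le> e / 2" by (intro d(2)) (simp add: dist_norm)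
        then show "dist (conv g K y) (conv g K x) < e" using \<open>e > 0\<close> by (simp add: dist_norm)
      qed
    qed
  qed
qed

lemma C1c_conv:
  fixes g :: "'a::euclidean_space \<Rightarrow> real"
  assumes g: "integrable lborel g" and k: "C1c k K" and b: "\<And>x. norm x > B \<Longrightarrow> g x = 0"
  shows "C1c (conv g k) (conv g K)"
proof -
  obtain R where R: "R > 0" "\<And>x. norm x > R \<Longrightarrow> k x = 0" using C1c_support[OF k] by metis
  have "conv g k x = 0" if "norm x > R + B" for x
  proof -
    have "g y * k (x - y) = 0" for y
    proof (cases "norm y > B")
      case False
      then have "norm (x - y) > R" using that norm_triangle_ineq2[of x y] by linarith
      then show ?thesis using R by simp
    qed (use b in simp)
    then show ?thesis unfolding conv_def real_scaleR_def by (simp only: integral_zero)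
  qed
  then have "norm x \<le> R + B" if "conv g k x \<noteq> 0" for x using that by force
  then have "bounded {x. conv g k x \<noteq> 0}" unfolding bounded_iff by blast
  then show ?thesis using C1_conv[OF g k] by (simp add: C1c_def)
qed

text \<open>The squared positive part is a simple C1 function vanishing on a half-line, with
  first-order remainder at most \<open>h\<^sup>2\<close>; the mollifier and the radial cutoffs are
  assembled from it.\<close>

lemma has_real_derivative_pos_part_sq:
  "((\<lambda>t. (max 0 t)\<^sup>2) has_real_derivative 2 * max 0 t) (at t)"
proof -
  have "\<bar>(max 0 (t + h))\<^sup>2 - (max 0 t)\<^sup>2 - 2 * max 0 t * h\<bar> \<le> h\<^sup>2" for h :: real
  proof (cases "t \<ge> 0")
    case True
    show ?thesis
    proof (cases "t + h \<ge> 0")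
      case True
      then show ?thesis using \<open>t \<ge> 0\<close> by (simp add: max_def power2_eq_square algebra_simps)
    next
      case False
      have "t * t + 2 * t * h \<le> 0"
        using mult_left_mono[of "t + 2 * h" 0 t] False True by (simp add: algebra_simps)
      moreover have "0 \<le> (t + h)\<^sup>2" by simp
      ultimately show ?thesis using False True by (simp add: max_def power2_eq_square algebra_simps)
    qed
  next
    case False
    have "\<bar>(max 0 (t + h))\<^sup>2\<bar> \<le> h\<^sup>2"
      using False by (cases "t + h \<ge> 0") (auto simp: max_def intro!: power_mono)
    then show ?thesis using False by (simp add: max_def)
  qed
  note b = this
  show ?thesis
    unfolding has_field_derivative_def has_derivative_at_alt
  proof (intro conjI allI impI bounded_linear_mult_right)
    fix e :: real assume e: "e > 0"
    show "\<exists>d>0. \<forall>y. norm (y - t) < d \<longrightarrow> norm ((max 0 y)\<^sup>2 - (max 0 t)\<^sup>2 - 2 * max 0 t * (y - t)) \<le> e * norm (y - t)"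
    proof (intro exI[of _ e] conjI allI impI e)
      fix y assume y: "norm (y - t) < e"
      have "norm ((max 0 y)\<^sup>2 - (max 0 t)\<^sup>2 - 2 * max 0 t * (y - t)) \<le> (y - t)\<^sup>2"
        using b[of "y - t"] by simp
      also have "\<dots> = \<bar>y - t\<bar> * \<bar>y - t\<bar>" by (simp add: power2_eq_square)
      also have "\<dots> \<le> e * \<bar>y - t\<bar>" using y by (intro mult_right_mono) auto
      finally show "norm ((max 0 y)\<^sup>2 - (max 0 t)\<^sup>2 - 2 * max 0 t * (y - t)) \<le> e * norm (y - t)" by simp
    qed
  qed
qed

text \<open>Evenness of \<open>k\<close> and oddness of \<open>K\<close> are demanded because parity
  is what moves a mollification from one factor of an integral to the other, with sign 1 for
  \<open>k\<close> and -1 for \<open>K\<close>.\<close>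

definition mollifier :: "real \<Rightarrow> ('a::euclidean_space \<Rightarrow> real) \<Rightarrow> ('a \<Rightarrow> 'a) \<Rightarrow> bool" where
  "mollifier \<epsilon> k K \<longleftrightarrow> C1c k K \<and> (\<forall>x. k x \<ge> 0) \<and> (\<forall>x. norm x > \<epsilon> \<longrightarrow> k x = 0) \<and>
     (\<forall>x. k (- x) = k x) \<and> (\<forall>x. K (- x) = - K x) \<and> (LBINT x. k x) = 1"

lemma mollifier_exists:
  assumes "\<epsilon> > 0"
  obtains k :: "'a::euclidean_space \<Rightarrow> real" and K where "mollifier \<epsilon> k K"
proof -
  define k0 :: "'a \<Rightarrow> real" where "k0 x = (max 0 (\<epsilon>\<^sup>2 + (-1) * (x \<bullet> x)))\<^sup>2" for x
  define K0 :: "'a \<Rightarrow> 'a" where "K0 x = (2 * max 0 (\<epsilon>\<^sup>2 + (-1) * (x \<bullet> x))) *\<^sub>R (- 2 *\<^sub>R x)" for x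
  have "C1 (\<lambda>x::'a. \<epsilon>\<^sup>2 + (-1) * (x \<bullet> x)) (\<lambda>x. 0 + ((-1) *\<^sub>R (2 *\<^sub>R x) + (x \<bullet> x) *\<^sub>R 0))"
    by (intro C1_add C1_mult C1_const C1_norm_sq)
  then have "C1 (\<lambda>x::'a. \<epsilon>\<^sup>2 + (-1) * (x \<bullet> x)) (\<lambda>x. - 2 *\<^sub>R x)" by simp
  then have C1: "C1 k0 K0" unfolding k0_def K0_def
    by (rule C1_compose_real) (auto intro!: has_real_derivative_pos_part_sq continuous_intros)
  have z: "k0 x = 0" if "norm x > \<epsilon>" for x
  proof -
    have "\<epsilon>\<^sup>2 \<le> (norm x)\<^sup>2" using that assms by (intro power_mono) auto
    then show ?thesis unfolding k0_def by (simp add: power2_norm_eq_inner)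
  qed
  have "bounded {x. k0 x \<noteq> 0}" unfolding bounded_iff using z by (meson mem_Collect_eq not_le)
  with C1 have c: "C1c k0 K0" by (simp add: C1c_def)
  define I where "I = (LBINT x. k0 x)"
  have "I > 0"
  proof -
    \<comment> \<open>The value of \<open>k0\<close> on the sphere of radius
      \<open>\<epsilon>/2\<close>, hence a lower bound on the ball inside it.\<close>
    define m where "m = (\<epsilon>\<^sup>2 - (\<epsilon>/2)\<^sup>2)\<^sup>2"
    have "(\<epsilon>/2)\<^sup>2 < \<epsilon>\<^sup>2" using assms by (intro power_strict_mono) auto
    then have m: "m > 0" by (simp add: m_def)
    have "m * indicator (ball 0 (\<epsilon>/2)) x \<le> k0 x" for x
    proof (cases "norm x < \<epsilon>/2")
      case True
      then have "(norm x)\<^sup>2 \<le> (\<epsilon>/2)\<^sup>2" by (intro power_mono) auto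
      then have "\<epsilon>\<^sup>2 - (\<epsilon>/2)\<^sup>2 \<le> max 0 (\<epsilon>\<^sup>2 + (-1) * (x \<bullet> x))" by (simp add: power2_norm_eq_inner)
      then have "m \<le> k0 x" unfolding m_def k0_def
        using \<open>(\<epsilon>/2)\<^sup>2 < \<epsilon>\<^sup>2\<close> by (intro power_mono) auto
      then show ?thesis using True by simp
    qed (simp add: k0_def)
    then have "(\<integral>x. m * indicator (ball 0 (\<epsilon>/2)) x \<partial>(lborel::'a measure)) \<le> I"
      unfolding I_def using C1c_integrable[OF c] emeasure_lborel_ball_finite[of "0::'a" "\<epsilon>/2"]
      by (intro integral_mono) (auto simp: less_top integrable_real_indicator)
    then have "m * measure lborel (ball (0::'a) (\<epsilon>/2)) \<le> I" by simp
    moreover have "0 < m * measure lborel (ball (0::'a) (\<epsilon>/2))" using assms m by (intro mult_pos_pos) auto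
    ultimately show ?thesis by linarith
  qed
  have "C1c (\<lambda>x. (1 / I) * k0 x) (\<lambda>x. (1 / I) *\<^sub>R K0 x + k0 x *\<^sub>R 0)"
    by (intro C1c_mult C1_const c)
  then have "C1c (\<lambda>x. (1 / I) * k0 x) (\<lambda>x. (1 / I) *\<^sub>R K0 x)" by simp
  then have "mollifier \<epsilon> (\<lambda>x. (1 / I) * k0 x) (\<lambda>x. (1 / I) *\<^sub>R K0 x)"
    unfolding mollifier_def using \<open>I > 0\<close> z by (auto simp: k0_def K0_def I_def)
  then show ?thesis using that by blast
qed

section \<open>Convergence of mollifications in L1\<close>

lemma compact_inner_approx:
  fixes A :: "'a::euclidean_space set"
  assumes A: "A \<in> sets borel" "emeasure lborel A < \<infinity>" and e: "e > 0"
  obtains K where "compact K" "K \<subseteq> A" "measure lborel (A - K) < e"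
proof -
  \<comment> \<open>The inner regularity theorem is about finite measures, so it is applied to
    Lebesgue measure restricted to \<open>A\<close>.\<close>
  define M where "M = density lborel (indicator A :: 'a \<Rightarrow> ennreal)"
  have sM: "sets M = sets borel" by (simp add: M_def)
  have eM: "emeasure M B = emeasure lborel (A \<inter> B)" if "B \<in> sets borel" for B
    using that A by (simp add: M_def emeasure_density flip: indicator_inter_arith)
  have "emeasure M (space M) \<noteq> \<infinity>" using A eM[of UNIV] by (simp add: M_def space_density)
  from inner_regular[OF sM this A(1)]
  have "emeasure lborel A = (SUP K\<in>{K. K \<subseteq> A \<and> compact K}. emeasure M K)" using eM[OF A(1)] by simp
  also have "\<dots> = (SUP K\<in>{K. K \<subseteq> A \<and> compact K}. emeasure lborel K)"
    by (intro SUP_cong) (auto simp: eM compact_imp_closed Int_absorb1)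
  finally have S: "emeasure lborel A = (SUP K\<in>{K. K \<subseteq> A \<and> compact K}. emeasure lborel K)" .
  show ?thesis
  proof (cases "emeasure lborel A = 0")
    case True
    then show ?thesis using that[of "{}"] e by (simp add: measure_def)
  next
    case False
    define m where "m = measure lborel A"
    have mA: "emeasure lborel A = ennreal m" using A(2) by (simp add: m_def emeasure_eq_ennreal_measure less_top)
    then have m: "m > 0" using False by (metis ennreal_0 ennreal_neg not_less order_le_less)
    have "ennreal (m - min e m / 2) < (SUP K\<in>{K. K \<subseteq> A \<and> compact K}. emeasure lborel K)"
      unfolding S[symmetric] mA using m e by (intro ennreal_lessI) (auto simp: min_def)
    then obtain K where K: "K \<subseteq> A" "compact K" "ennreal (m - min e m / 2) < emeasure lborel K"
      by (auto simp: less_SUP_iff)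
    have Kb: "K \<in> sets borel" using K by (simp add: compact_imp_closed)
    have Kf: "emeasure lborel K < \<infinity>" using emeasure_mono[OF K(1), of lborel] A by (auto intro: le_less_trans)
    have "m - min e m / 2 < measure lborel K"
      using K(3) Kf m by (simp add: emeasure_eq_ennreal_measure less_top ennreal_less_iff min_def field_simps split: if_splits)
    moreover have "measure lborel (A - K) = m - measure lborel K"
      unfolding m_def using A K Kb by (intro measure_Diff) auto
    ultimately show ?thesis using that[OF K(2,1)] e m by (simp add: min_def split: if_splits)
  qed
qed

text \<open>Induction over integrable functions. The indicator of \<open>A\<close> is treated with a
  compact \<open>K\<close> inside and an open \<open>U\<close> around \<open>A\<close>: a short
  translation does not move \<open>K\<close> out of \<open>U\<close>.\<close>

lemma L1_translation_continuous:
  fixes f :: "'a::euclidean_space \<Rightarrow> real"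
  assumes "integrable lborel f" "e > 0"
  shows "\<exists>d>0. \<forall>h. norm h < d \<longrightarrow> (LBINT x. \<bar>f (x + h) - f x\<bar>) \<le> e"
  using assms
proof (induction arbitrary: e)
  case (base A c)
  have A: "A \<in> sets borel" using base by simp
  \<comment> \<open>The 6 is twice the sum of the bounds \<open>e'\<close> for \<open>A - K\<close>
    and \<open>2 * e'\<close> for \<open>U - K\<close>.\<close>
  define e' where "e' = e / (6 * (\<bar>c\<bar> + 1))"
  have e': "e' > 0" using base by (simp add: e'_def)
  obtain K where K: "compact K" "K \<subseteq> A" "measure lborel (A - K) < e'"
    using compact_inner_approx[OF A base(2) e'] by blast
  obtain U where U: "open U" "A \<subseteq> U" "emeasure lborel (U - A) < e'"
    using outer_regular_lborel[OF A e'] by blast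
  have [measurable]: "A \<in> sets borel" "U \<in> sets borel" "K \<in> sets borel"
    using A U K by (auto simp: compact_imp_closed)
  have fU: "emeasure lborel U < \<infinity>"
  proof -
    have "emeasure lborel U = emeasure lborel (U - A) + emeasure lborel A"
      using U by (subst plus_emeasure) (auto simp: Un_absorb2)
    also have "\<dots> < \<infinity>" using U base by (auto simp: less_top[symmetric] top_unique)
    finally show ?thesis .
  qed
  have UA: "measure lborel (U - A) \<le> e'"
    using U(3) e' by (simp add: measure_def enn2real_leI less_imp_le)
  have UK: "measure lborel (U - K) \<le> 2 * e'"
  proof -
    have "measure lborel (U - K) \<le> measure lborel ((U - A) \<union> (A - K))"
    proof (rule measure_mono_fmeasurable)
      have "emeasure lborel ((U - A) \<union> (A - K)) \<le> emeasure lborel U"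
        using U(2) by (intro emeasure_mono) auto
      then show "(U - A) \<union> (A - K) \<in> fmeasurable lborel"
        using fU by (intro fmeasurableI) (auto simp: le_less_trans)
    qed auto
    also have "\<dots> \<le> measure lborel (U - A) + measure lborel (A - K)" by (intro measure_Un_le) auto
    finally show ?thesis using UA K by simp
  qed
  have "\<exists>d>0. \<forall>x\<in>K. ball x d \<subseteq> U"
  proof -
    have "K \<subseteq> U" using K(2) U(2) by blast
    from compact_subset_open_imp_ball_epsilon_subset[OF K(1) U(1) this]
    obtain d where "d > 0" "(\<Union>x\<in>K. ball x d) \<subseteq> U" by blast
    then show ?thesis by (intro exI[of _ d] conjI ballI) blast+
  qed
  then obtain d where d: "d > 0" "\<And>x. x \<in> K \<Longrightarrow> ball x d \<subseteq> U" by blast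
  show ?case
  proof (intro exI[of _ d] conjI d(1) allI impI)
    fix h :: 'a assume h: "norm h < d"
    let ?a = "indicator A :: 'a \<Rightarrow> real"
    have fin: "integrable lborel (indicator B :: 'a \<Rightarrow> real)" if "B \<in> sets borel" "B \<subseteq> U" for B
    proof (rule integrable_real_indicator)
      have "emeasure lborel B \<le> emeasure lborel U" using that by (intro emeasure_mono) auto
      then show "emeasure lborel B < \<infinity>" using fU by (rule le_less_trans)
    qed (use that in simp)
    have tr: "integrable lborel (\<lambda>x. indicator B (x + h) :: real)" "(LBINT x. indicator B (x + h)) = measure lborel B"
      if "B \<in> sets borel" "B \<subseteq> U" for B
    proof -
      have m: "(indicator B :: 'a \<Rightarrow> real) \<in> borel_measurable borel" using that by simp
      show "integrable lborel (\<lambda>x. indicator B (x + h) :: real)" using lborel_translation(2)[OF m] fin[OF that] by blast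
      show "(LBINT x. indicator B (x + h)) = measure lborel B"
        using lborel_translation(1)[OF m, of h] that by simp
    qed
    have i1: "integrable lborel ?a" and i2: "integrable lborel (indicat_real (A - K))"
      using U(2) by (auto intro!: fin)
    have i3: "integrable lborel (\<lambda>x. ?a (x + h))" and i4: "integrable lborel (\<lambda>x. indicat_real (U - K) (x + h))"
      using U(2) by (auto intro!: tr)
    \<comment> \<open>An absolute value is the signed quantity plus twice its negative part. The
      signed part integrates to zero by translation invariance; the negative part lives where the
      translation leaves \<open>A\<close>, that is for \<open>x\<close> in \<open>A - K\<close> or
      \<open>x + h\<close> in \<open>U - K\<close>.\<close>
    have pt: "\<bar>?a (x + h) - ?a x\<bar> \<le> (?a (x + h) - ?a x) + 2 * (indicator (A - K) x + indicator (U - K) (x + h))" for x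
    proof (cases "x \<in> K")
      case True
      then have "x + h \<in> U" using d(2)[OF True] h by (auto simp: subset_iff dist_norm)
      then show ?thesis using True K(2) by (auto simp: indicator_def)
    qed (auto simp: indicator_def)
    have "(LBINT x. \<bar>?a (x + h) - ?a x\<bar>) \<le> (LBINT x. (?a (x + h) - ?a x) + 2 * (indicator (A - K) x + indicator (U - K) (x + h)))"
      using i1 i2 i3 i4 by (intro integral_mono pt) auto
    also have "\<dots> = 2 * (measure lborel (A - K) + measure lborel (U - K))"
      using i1 i2 i3 i4 tr(2)[of A] tr(2)[of "U - K"] U(2) by simp
    also have "\<dots> \<le> 6 * e'" using UK K by simp
    finally have "(LBINT x. \<bar>?a (x + h) - ?a x\<bar>) \<le> 6 * e'" .
    then have "\<bar>c\<bar> * (LBINT x. \<bar>?a (x + h) - ?a x\<bar>) \<le> \<bar>c\<bar> * (6 * e')" by (intro mult_left_mono) auto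
    also have "\<dots> \<le> e" using base by (simp add: e'_def field_simps)
    finally show "(LBINT x. \<bar>indicat_real A (x + h) *\<^sub>R c - indicat_real A x *\<^sub>R c\<bar>) \<le> e"
      by (simp add: abs_mult mult.commute flip: left_diff_distrib right_diff_distrib)
  qed
next
  case (add f g)
  then have "e / 2 > 0" by simp
  obtain d1 where d1: "d1 > 0" "\<forall>h. norm h < d1 \<longrightarrow> (LBINT x. \<bar>f (x + h) - f x\<bar>) \<le> e / 2"
    using add.IH(1)[OF \<open>e / 2 > 0\<close>] by (elim exE conjE)
  obtain d2 where d2: "d2 > 0" "\<forall>h. norm h < d2 \<longrightarrow> (LBINT x. \<bar>g (x + h) - g x\<bar>) \<le> e / 2"
    using add.IH(2)[OF \<open>e / 2 > 0\<close>] by (elim exE conjE)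
  have m: "f \<in> borel_measurable borel" "g \<in> borel_measurable borel" using add by auto
  show ?case
  proof (intro exI[of _ "min d1 d2"] conjI allI impI)
    fix h :: 'a assume h: "norm h < min d1 d2"
    have i: "integrable lborel (\<lambda>x. \<bar>f (x + h) - f x\<bar>)" "integrable lborel (\<lambda>x. \<bar>g (x + h) - g x\<bar>)"
      "integrable lborel (\<lambda>x. \<bar>f (x + h) + g (x + h) - (f x + g x)\<bar>)"
      using add.hyps lborel_translation(2)[OF m(1), of h] lborel_translation(2)[OF m(2), of h] by auto
    have "(LBINT x. \<bar>f (x + h) + g (x + h) - (f x + g x)\<bar>) \<le> (LBINT x. \<bar>f (x + h) - f x\<bar> + \<bar>g (x + h) - g x\<bar>)"
      using i by (intro integral_mono) auto
    also have "\<dots> \<le> e" using i d1(2)[rule_format, of h] d2(2)[rule_format, of h] h by simp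
    finally show "(LBINT x. \<bar>f (x + h) + g (x + h) - (f x + g x)\<bar>) \<le> e" .
  qed (use d1 d2 in auto)
next
  case (lim f s)
  have m: "f \<in> borel_measurable borel" "s i \<in> borel_measurable borel" for i
    using lim.hyps(1)[of i] lim.hyps by auto
  have "(\<lambda>i. LBINT x. \<bar>s i x - f x\<bar>) \<longlonglongrightarrow> (\<integral>x. (0::real) \<partial>(lborel::'a measure))"
  proof (rule integral_dominated_convergence[where w="\<lambda>x. 3 * \<bar>f x\<bar>"])
    show "AE x in lborel. (\<lambda>i. \<bar>s i x - f x\<bar>) \<longlonglongrightarrow> 0"
      using lim.hyps(2) by (intro AE_I2 tendsto_rabs_zero LIM_zero) auto
    show "AE x in lborel. norm \<bar>s i x - f x\<bar> \<le> 3 * \<bar>f x\<bar>" for i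
    proof (intro AE_I2)
      fix x
      have "\<bar>s i x\<bar> \<le> 2 * \<bar>f x\<bar>" using lim.hyps(3)[of x i] by simp
      then show "norm \<bar>s i x - f x\<bar> \<le> 3 * \<bar>f x\<bar>" by simp
    qed
  qed (use m lim.hyps in auto)
  then have "eventually (\<lambda>i. (LBINT x. \<bar>s i x - f x\<bar>) < e / 3) sequentially"
    using lim.prems by (intro order_tendstoD(2)) auto
  then obtain i where i: "(LBINT x. \<bar>s i x - f x\<bar>) < e / 3" by (auto simp: eventually_sequentially)
  have "e / 3 > 0" using lim.prems by simp
  from lim.IH[OF this, of i] obtain d where d: "d > 0" "\<And>h. norm h < d \<Longrightarrow> (LBINT x. \<bar>s i (x + h) - s i x\<bar>) \<le> e / 3"
    by blast
  show ?case
  proof (intro exI[of _ d] conjI d(1) allI impI)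
    fix h :: 'a assume h: "norm h < d"
    have i1: "integrable lborel (\<lambda>x. f (x + h))" "integrable lborel (\<lambda>x. s i (x + h))" "integrable lborel (s i)" "integrable lborel f"
      using lim.hyps lborel_translation(2)[OF m(1), of h] lborel_translation(2)[OF m(2), of i h] by auto
    have "(LBINT x. \<bar>f (x + h) - f x\<bar>)
       \<le> (LBINT x. \<bar>s i (x + h) - f (x + h)\<bar> + \<bar>s i (x + h) - s i x\<bar> + \<bar>s i x - f x\<bar>)"
      using i1 by (intro integral_mono) auto
    also have "\<dots> = (LBINT x. \<bar>s i (x + h) - f (x + h)\<bar>) + (LBINT x. \<bar>s i (x + h) - s i x\<bar>) + (LBINT x. \<bar>s i x - f x\<bar>)"
      using i1 by simp
    also have "(LBINT x. \<bar>s i (x + h) - f (x + h)\<bar>) = (LBINT x. \<bar>s i x - f x\<bar>)"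
      using lborel_translation(1)[of "\<lambda>x. \<bar>s i x - f x\<bar>" h] m by simp
    finally show "(LBINT x. \<bar>f (x + h) - f x\<bar>) \<le> e" using i d(2)[OF h] by simp
  qed
qed

lemma mollifierD:
  assumes "mollifier \<epsilon> k K"
  shows "C1c k K" "k x \<ge> 0" "norm x > \<epsilon> \<Longrightarrow> k x = 0" "k (- x) = k x" "K (- x) = - K x"
    "(LBINT x. k x) = 1" "integrable lborel k" "k \<in> borel_measurable borel" "K \<in> borel_measurable borel"
  using assms C1c_integrable[of k K] C1_measurable[of k K] unfolding mollifier_def C1c_def by auto

lemma mollifier_bounded:
  assumes "mollifier \<epsilon> k K"
  obtains B where "B > 0" "\<And>x. \<bar>k x\<bar> \<le> B" "\<And>x. norm (K x) \<le> B"
proof -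
  note k = mollifierD(1)[OF assms]
  obtain R where R: "R > 0" "\<And>x. norm x > R \<Longrightarrow> k x = 0" "\<And>x. norm x > R \<Longrightarrow> K x = 0"
    using C1c_support[OF k] by metis
  have c: "continuous_on UNIV k" "continuous_on UNIV K" 
    using C1_continuous[OF C1c_C1[OF k]] k by (auto simp: C1c_def C1_def)
  obtain B1 where B1: "B1 > 0" "\<And>x. norm (k x) \<le> B1" using compact_support_bounded[OF c(1) R(2)] by metis
  obtain B2 where B2: "B2 > 0" "\<And>x. norm (K x) \<le> B2" using compact_support_bounded[OF c(2) R(3)] by metis
  show ?thesis
    by (rule that[of "max B1 B2"]) (use B1 B2 in \<open>auto simp: le_max_iff_disj\<close>)
qed

text \<open>\<open>conv g k x - g x\<close> is the average of \<open>g (x - y) - g x\<close> with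
  weight \<open>k y\<close>. After exchanging the integrals the inner one is the L1 distance of
  \<open>g\<close> from a short translate. The threshold \<open>d\<close> serves all mollifiers of
  smaller radius at once, so several functions can share one kernel.\<close>

lemma conv_L1:
  fixes g :: "'a::euclidean_space \<Rightarrow> real"
  assumes g: "integrable lborel g" and "e > 0"
  shows "\<exists>d>0. \<forall>\<epsilon> k K. mollifier \<epsilon> k K \<longrightarrow> \<epsilon> < d \<longrightarrow>
     integrable lborel (conv g k) \<and> (LBINT x. \<bar>conv g k x - g x\<bar>) \<le> e"
proof -
  obtain d where d: "d > 0" "\<And>h. norm h < d \<Longrightarrow> (LBINT x. \<bar>g (x + h) - g x\<bar>) \<le> e"
    using L1_translation_continuous[OF assms] by blast
  have gm[measurable]: "g \<in> borel_measurable borel" using g by auto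
  show ?thesis
  proof (intro exI[of _ d] conjI d(1) allI impI)
    fix \<epsilon> and k :: "'a \<Rightarrow> real" and K assume M: "mollifier \<epsilon> k K" and eps: "\<epsilon> < d"
    note k = mollifierD[OF M]
    note [measurable] = k(8)
    obtain B where B: "\<And>x. \<bar>k x\<bar> \<le> B" using mollifier_bounded[OF M] by metis
    have C: "C1 (conv g k) (conv g K)" by (rule C1_conv[OF g k(1)])
    have [measurable]: "conv g k \<in> borel_measurable borel" using C1_measurable(1)[OF C] .
    have ig: "integrable lborel (\<lambda>y. g y * k (x - y))" for x
      using conv_integrable[OF g k(8), of B x] B by simp
    have ig2: "integrable lborel (\<lambda>y. g (x - y) * k y)" for x
      using lborel_reflection(2)[of "\<lambda>y. g y * k (x - y)" x] ig by simp
    have c: "conv g k x - g x = (LBINT y. (g (x - y) - g x) * k y)" for x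
    proof -
      have "conv g k x = (LBINT y. g (x - y) * k y)"
        unfolding conv_def using lborel_reflection(1)[of "\<lambda>y. g y * k (x - y)" x] by simp
      then show ?thesis using ig2[of x] k(6,7) by (simp add: left_diff_distrib)
    qed
    have nn: "(\<integral>\<^sup>+x. ennreal \<bar>conv g k x - g x\<bar> \<partial>lborel) \<le> ennreal e"
    proof -
      have "(\<integral>\<^sup>+x. ennreal \<bar>conv g k x - g x\<bar> \<partial>lborel) \<le> (\<integral>\<^sup>+x. (\<integral>\<^sup>+y. ennreal (\<bar>g (x - y) - g x\<bar> * k y) \<partial>lborel) \<partial>lborel)"
      proof (intro nn_integral_mono)
        fix x
        have i: "integrable lborel (\<lambda>y. (g (x - y) - g x) * k y)"
          using ig2[of x] k(7) by (simp add: left_diff_distrib)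
        have "norm (LBINT y. (g (x - y) - g x) * k y) \<le> (\<integral>\<^sup>+y. norm ((g (x - y) - g x) * k y) \<partial>lborel)"
          by (rule integral_norm_bound_ennreal[OF i])
        then show "ennreal \<bar>conv g k x - g x\<bar> \<le> (\<integral>\<^sup>+y. ennreal (\<bar>g (x - y) - g x\<bar> * k y) \<partial>lborel)"
          using k(2) by (simp add: c abs_mult)
      qed
      also have "\<dots> = (\<integral>\<^sup>+y. (\<integral>\<^sup>+x. ennreal (\<bar>g (x - y) - g x\<bar> * k y) \<partial>lborel) \<partial>lborel)"
        by (rule lborel_pair.Fubini') measurable
      also have "\<dots> \<le> (\<integral>\<^sup>+y. ennreal (e * k y) \<partial>lborel)"
      proof (intro nn_integral_mono)
        fix y
        show "(\<integral>\<^sup>+x. ennreal (\<bar>g (x - y) - g x\<bar> * k y) \<partial>lborel) \<le> ennreal (e * k y)"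
        proof (cases "norm y \<le> \<epsilon>")
          case True
          have i: "integrable lborel (\<lambda>x. \<bar>g (x - y) - g x\<bar>)"
            using g lborel_translation(2)[OF gm, of "- y"] by auto
          have "(\<integral>\<^sup>+x. ennreal (\<bar>g (x - y) - g x\<bar> * k y) \<partial>lborel) = ennreal (LBINT x. \<bar>g (x - y) - g x\<bar> * k y)"
            using i k(2) by (intro nn_integral_eq_integral) auto
          also have "(LBINT x. \<bar>g (x - y) - g x\<bar> * k y) = (LBINT x. \<bar>g (x + - y) - g x\<bar>) * k y" by simp
          also have "ennreal \<dots> \<le> ennreal (e * k y)"
            using d(2)[of "- y"] True eps k(2) by (intro ennreal_leI mult_right_mono) auto
          finally show ?thesis .
        qed (use k in simp)
      qed
      also have "\<dots> = ennreal (LBINT y. e * k y)"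
        using k \<open>e > 0\<close> by (intro nn_integral_eq_integral) auto
      also have "\<dots> = ennreal e" using k by simp
      finally show ?thesis .
    qed
    have i: "integrable lborel (\<lambda>x. conv g k x - g x)"
    proof (rule integrableI_bounded)
      show "(\<integral>\<^sup>+x. ennreal (norm (conv g k x - g x)) \<partial>lborel) < \<infinity>"
        using nn by (simp add: le_less_trans)
    qed simp
    then have "integrable lborel (\<lambda>x. (conv g k x - g x) + g x)" using g by (intro Bochner_Integration.integrable_add)
    then show "integrable lborel (conv g k)" by simp
    have "ennreal (LBINT x. \<bar>conv g k x - g x\<bar>) \<le> ennreal e"
      using nn i by (subst nn_integral_eq_integral[symmetric]) auto
    then show "(LBINT x. \<bar>conv g k x - g x\<bar>) \<le> e" using \<open>e > 0\<close> by simp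
  qed
qed

section \<open>Perimeter and admissible constants\<close>

lemma C1_compact_support_iff:
  fixes \<phi> :: "'a::euclidean_space \<Rightarrow> real ^ 'i::finite"
  shows "\<phi> \<in> C1_compact_support \<longleftrightarrow> (\<exists>G. \<forall>i. C1c (\<lambda>p. \<phi> p $ i) (G i))"
proof
  assume "\<phi> \<in> C1_compact_support"
  then obtain D where D: "\<And>p. (\<phi> has_derivative blinfun_apply (D p)) (at p)" "continuous_on UNIV D"
    and cpt: "compact (closure {p. \<phi> p \<noteq> 0})"
    unfolding C1_compact_support_def by blast
  define G where "G i p = (\<Sum>b\<in>Basis. (blinfun_apply (D p) b $ i) *\<^sub>R b)" for i p
  have GD: "blinfun_apply (D p) h $ i = G i p \<bullet> h" for i p h
  proof -
    have "blinfun_apply (D p) h $ i = blinfun_apply (D p) (\<Sum>b\<in>Basis. (h \<bullet> b) *\<^sub>R b) $ i"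
      by (simp add: euclidean_representation)
    also have "\<dots> = (\<Sum>b\<in>Basis. (h \<bullet> b) * (blinfun_apply (D p) b $ i))"
      by (simp add: blinfun.sum_right blinfun.scaleR_right)
    also have "\<dots> = G i p \<bullet> h"
      unfolding G_def inner_sum_left by (simp add: mult.commute inner_commute)
    finally show ?thesis .
  qed
  have "C1c (\<lambda>p. \<phi> p $ i) (G i)" for i
    unfolding C1c_def C1_def
  proof (intro conjI allI)
    fix p
    have "((\<lambda>p. \<phi> p $ i) has_derivative (\<lambda>h. blinfun_apply (D p) h $ i)) (at p)"
      using has_derivative_compose[OF D(1) bounded_linear_imp_has_derivative[OF bounded_linear_vec_nth]] by simp
    then show "((\<lambda>p. \<phi> p $ i) has_derivative (\<bullet>) (G i p)) (at p)" by (simp add: GD)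
    show "continuous_on UNIV (G i)"
      unfolding G_def by (intro continuous_intros D(2))
    have "bounded {p. \<phi> p \<noteq> 0}" using cpt by (metis bounded_closure_image bounded_subset closure_subset compact_imp_bounded)
    then show "bounded {p. \<phi> p $ i \<noteq> 0}" by (rule bounded_subset) auto
  qed
  then show "\<exists>G. \<forall>i. C1c (\<lambda>p. \<phi> p $ i) (G i)" by blast
next
  assume "\<exists>G. \<forall>i. C1c (\<lambda>p. \<phi> p $ i) (G i)"
  then obtain G where G: "\<And>i. C1c (\<lambda>p. \<phi> p $ i) (G i)" by blast
  define L where "L p h = (\<chi> i. G i p \<bullet> h)" for p h
  have bl: "bounded_linear (L p)" for p
    by (simp add: linear_conv_bounded_linear[symmetric] L_def linear_iff vec_eq_iff inner_add_right)
  have ap: "blinfun_apply (Blinfun (L p)) = L p" for p by (simp add: bl bounded_linear_Blinfun_apply)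
  have "(\<phi> has_derivative L p) (at p)" for p
    unfolding has_derivative_componentwise_within[of \<phi>]
  proof
    fix b :: "real ^ 'i" assume "b \<in> Basis"
    then obtain i where b: "b = axis i 1" by (auto simp: Basis_vec_def)
    have "((\<lambda>p. \<phi> p $ i) has_derivative (\<bullet>) (G i p)) (at p)" using G[of i] by (simp add: C1c_def C1_def)
    then show "((\<lambda>x. \<phi> x \<bullet> b) has_derivative (\<lambda>x. L p x \<bullet> b)) (at p)"
      by (simp add: b inner_axis L_def)
  qed
  moreover have "continuous_on UNIV (\<lambda>p. Blinfun (L p))"
  proof (rule continuous_on_blinfun_componentwise)
    fix h :: 'a assume "h \<in> Basis"
    have "continuous_on UNIV (G i)" for i using G[of i] by (simp add: C1c_def C1_def)
    then show "continuous_on UNIV (\<lambda>p. blinfun_apply (Blinfun (L p)) h)"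
      unfolding ap L_def by (intro continuous_intros)
  qed
  moreover have "compact (closure {p. \<phi> p \<noteq> 0})"
  proof -
    have "{p. \<phi> p \<noteq> 0} = (\<Union>i. {p. \<phi> p $ i \<noteq> 0})" by (auto simp: vec_eq_iff)
    also have "bounded \<dots>" using G by (intro bounded_UN) (auto simp: C1c_def)
    finally show ?thesis by (simp add: compact_closure)
  qed
  ultimately show "\<phi> \<in> C1_compact_support"
    unfolding C1_compact_support_def by (auto simp: ap intro!: exI[of _ "\<lambda>p. Blinfun (L p)"])
qed

text \<open>A test field is kept as the family of its components together with their gradients;
  divergences are then plain inner products, without Frechet derivatives.\<close>

definition tests :: "(('i::finite \<Rightarrow> 'a::euclidean_space \<Rightarrow> real) \<times> ('i \<Rightarrow> 'a \<Rightarrow> 'a)) set" where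
  "tests = {(f, G). (\<forall>i. C1c (f i) (G i)) \<and> (\<forall>p. (\<Sum>i\<in>UNIV. (f i p)\<^sup>2) \<le> 1)}"

definition diverg :: "('i::finite \<Rightarrow> 'a::euclidean_space \<Rightarrow> 'a) \<Rightarrow> ('i \<Rightarrow> 'a \<Rightarrow> 'a) \<Rightarrow> 'a \<Rightarrow> real" where
  "diverg V G p = (\<Sum>i\<in>UNIV. G i p \<bullet> V i p)"

lemma continuous_diverg:
  assumes "(f, G) \<in> tests" "\<And>i. continuous_on UNIV (V i)"
  shows "continuous_on UNIV (diverg V G)"
  using assms unfolding diverg_def tests_def by (intro continuous_intros) (auto simp: C1c_def C1_def)

lemma diverg_support:
  assumes "(f, G) \<in> tests"
  obtains R where "R > 0" "\<And>p i. norm p > R \<Longrightarrow> G i p = 0" "\<And>p i. norm p > R \<Longrightarrow> f i p = 0"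
    "\<And>p V. norm p > R \<Longrightarrow> diverg V G p = 0"
proof -
  have "\<forall>i. \<exists>R>0. \<forall>x. norm x > R \<longrightarrow> f i x = 0 \<and> G i x = 0"
    using assms C1c_support unfolding tests_def by (metis (mono_tags, lifting) case_prodD mem_Collect_eq)
  then obtain R where R: "\<And>i. R i > 0" "\<And>i x. norm x > R i \<Longrightarrow> f i x = 0 \<and> G i x = 0" by metis
  define R0 where "R0 = (\<Sum>i\<in>UNIV. R i)"
  have le: "R i \<le> R0" for i unfolding R0_def using R(1) by (intro member_le_sum) (auto intro: less_imp_le)
  have "R0 > 0" using le R(1) by (meson less_le_trans)
  moreover have "G i p = 0" "f i p = 0" if "norm p > R0" for i p using R(2)[of i p] le[of i] that by auto
  ultimately show ?thesis using that by (simp add: diverg_def)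
qed

lemma diverg_bounds:
  assumes fG: "(f, G) \<in> tests" and V: "\<And>i. continuous_on UNIV (V i)"
  obtains R B where "R > 0" "\<And>p. norm p > R \<Longrightarrow> diverg V G p = 0" "B > 0" "\<And>p. \<bar>diverg V G p\<bar> \<le> B"
    "integrable lborel (diverg V G)" "diverg V G \<in> borel_measurable borel"
proof -
  note c = continuous_diverg[OF fG V]
  obtain R where R: "R > 0" "\<And>p. norm p > R \<Longrightarrow> diverg V G p = 0"
    by (rule diverg_support[OF fG]) blast
  obtain B where B: "B > 0" "\<And>p. norm (diverg V G p) \<le> B"
    by (rule compact_support_bounded[OF c R(2)]) blast+
  show ?thesis
    by (rule that[OF R B[unfolded real_norm_def] compact_support_integrable[OF c R(2)] borel_measurable_continuous_onI[OF c]])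
qed

text \<open>A Borel set that agrees with \<open>E\<close> up to a null set takes its place, so that
  later integrals are over \<open>lborel\<close>, where Fubini applies without completions.\<close>

lemma perimeter_SUP:
  fixes V :: "'i::finite \<Rightarrow> 'a::euclidean_space \<Rightarrow> 'a"
  assumes E: "E \<in> sets lebesgue" and E': "E' \<in> sets borel" and eq: "AE p in lebesgue. p \<in> E \<longleftrightarrow> p \<in> E'"
    and V: "\<And>i. continuous_on UNIV (V i)"
  shows "perimeter V E = (SUP (f, G)\<in>tests. ereal (LBINT p. indicator E' p * diverg V G p))"
proof -
  have int: "(LINT p:E|lebesgue. (\<Sum>i\<in>UNIV. field_deriv (V i) (\<lambda>q. f i q) p)) = (LBINT p. indicator E' p * diverg V G p)"
    if fG: "(f, G) \<in> tests" for f G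
  proof -
    have "field_deriv (V i) (f i) p = G i p \<bullet> V i p" for i p
      unfolding field_deriv_def using fG frechet_derivative_at[of "f i" "(\<bullet>) (G i p)" p]
      by (simp add: tests_def C1c_def C1_def)
    then have "(LINT p:E|lebesgue. (\<Sum>i\<in>UNIV. field_deriv (V i) (\<lambda>q. f i q) p)) = (\<integral>p. indicator E p * diverg V G p \<partial>lebesgue)"
      by (simp add: set_lebesgue_integral_def diverg_def)
    also have [measurable]: "diverg V G \<in> borel_measurable borel"
      by (intro borel_measurable_continuous_onI continuous_diverg[OF fG V])
    have m: "(\<lambda>p. indicator E' p * diverg V G p) \<in> borel_measurable lborel" using E' by measurable
    have "diverg V G \<in> borel_measurable lebesgue" by (intro measurable_completion) simp
    then have "(\<integral>p. indicator E p * diverg V G p \<partial>lebesgue) = (\<integral>p. indicator E' p * diverg V G p \<partial>lebesgue)"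
      using E measurable_completion[OF m] eq sets_completionI_sets[of E' lborel] E'
      by (intro integral_cong_AE borel_measurable_times borel_measurable_indicator) (auto simp: indicator_def elim!: eventually_mono)
    also have "\<dots> = (LBINT p. indicator E' p * diverg V G p)" by (rule integral_completion[OF m])
    finally show ?thesis .
  qed
  have nrm: "norm (v :: real ^ 'i) \<le> 1 \<longleftrightarrow> (\<Sum>i\<in>UNIV. (v $ i)\<^sup>2) \<le> 1" for v
    by (simp add: norm_vec_def L2_set_def)
  show ?thesis
    unfolding perimeter_def
  proof (rule antisym; rule SUP_least)
    fix \<phi> :: "'a \<Rightarrow> real ^ 'i" assume "\<phi> \<in> {\<phi>. \<phi> \<in> C1_compact_support \<and> (\<forall>p. norm (\<phi> p) \<le> 1)}"
    then obtain G where "(\<lambda>i p. \<phi> p $ i, G) \<in> tests"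
      unfolding tests_def C1_compact_support_iff nrm by auto
    then show "ereal (LINT p:E|lebesgue. \<Sum>i\<in>UNIV. field_deriv (V i) (\<lambda>q. \<phi> q $ i) p)
        \<le> (SUP (f, G)\<in>tests. ereal (LBINT p. indicator E' p * diverg V G p))"
      by (subst int) (auto intro: SUP_upper2)
  next
    fix fG :: "('i \<Rightarrow> 'a \<Rightarrow> real) \<times> ('i \<Rightarrow> 'a \<Rightarrow> 'a)" assume "fG \<in> tests"
    then obtain f G where fG: "fG = (f, G)" "(f, G) \<in> tests" by (cases fG) auto
    define \<phi> where "\<phi> p = (\<chi> i. f i p)" for p
    have "\<phi> \<in> {\<phi>. \<phi> \<in> C1_compact_support \<and> (\<forall>p. norm (\<phi> p) \<le> 1)}"
      using fG(2) unfolding tests_def C1_compact_support_iff nrm by (auto simp: \<phi>_def)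
    then have "ereal (LINT p:E|lebesgue. \<Sum>i\<in>UNIV. field_deriv (V i) (\<lambda>q. \<phi> q $ i) p)
        \<le> (SUP \<phi> \<in> {\<phi> :: 'a \<Rightarrow> real ^ 'i. \<phi> \<in> C1_compact_support \<and> (\<forall>p. norm (\<phi> p) \<le> 1)}.
             ereal (LINT p:E|lebesgue. (\<Sum>i\<in>UNIV. field_deriv (V i) (\<lambda>q. \<phi> q $ i) p)))"
      by (rule SUP_upper)
    then show "(case fG of (f, G) \<Rightarrow> ereal (LBINT p. indicator E' p * diverg V G p))
        \<le> (SUP \<phi> \<in> {\<phi> :: 'a \<Rightarrow> real ^ 'i. \<phi> \<in> C1_compact_support \<and> (\<forall>p. norm (\<phi> p) \<le> 1)}.
             ereal (LINT p:E|lebesgue. (\<Sum>i\<in>UNIV. field_deriv (V i) (\<lambda>q. \<phi> q $ i) p)))"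
      using int[OF fG(2)] by (simp add: fG \<phi>_def)
  qed
qed

lemma perimeter_borel:
  assumes "E \<in> sets borel" "\<And>i. continuous_on UNIV (V i)"
  shows "perimeter V E = (SUP (f, G)\<in>tests. ereal (LBINT p. indicator E p * diverg V G p))"
  using assms by (intro perimeter_SUP) auto

lemma lmeasurable_borel_rep:
  assumes "E \<in> lmeasurable"
  obtains E' where "E' \<in> sets borel" "emeasure lborel E' < \<infinity>" "measure lborel E' = measure lebesgue E"
    "AE p in lebesgue. p \<in> E \<longleftrightarrow> p \<in> E'"
proof -
  have E: "E \<in> sets lebesgue" "emeasure lebesgue E < \<infinity>" using assms by (auto simp: fmeasurable_def)
  obtain E' where E': "E \<subseteq> E'" "E' \<in> sets lborel" "E' - E \<in> null_sets lebesgue" "emeasure lebesgue E = emeasure lborel E'"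
    using completion_upper[OF E(1)] by blast
  show ?thesis
  proof (rule that[of E'])
    show "AE p in lebesgue. p \<in> E \<longleftrightarrow> p \<in> E'"
      using AE_not_in[OF E'(3)] by eventually_elim (use E' in auto)
  qed (use E' E in \<open>auto simp: measure_def\<close>)
qed

section \<open>Divergence-free fields and the perimeter of the unit ball\<close>

text \<open>The common form of the fields \<open>X\<close>, \<open>Y\<close>, \<open>W\<close> and
  of the coordinate fields: a constant plus a linear coefficient \<open>x \<bullet> b\<close> along
  a direction \<open>e\<close> on which that coefficient does not depend. Hence the divergence is
  zero.\<close>

definition shear :: "('a::euclidean_space \<Rightarrow> 'a) \<Rightarrow> bool" where
  "shear V \<longleftrightarrow> (\<exists>v b e. b \<bullet> e = 0 \<and> (\<forall>x. V x = v + (x \<bullet> b) *\<^sub>R e))"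

lemma shear_continuous: "shear V \<Longrightarrow> continuous_on UNIV V"
  unfolding shear_def by (auto intro!: continuous_intros simp: fun_eq_iff[symmetric] cong: continuous_on_cong)

text \<open>The coefficient is absorbed into the function: the gradient of
  \<open>(x \<bullet> b) * g x\<close> is
  \<open>(x \<bullet> b) *\<^sub>R K x + g x *\<^sub>R b\<close>, and its last term is orthogonal to
  \<open>e\<close>. Two integrals of gradients in constant directions remain.\<close>

lemma shear_divergence_free:
  assumes "shear V" "C1c g K"
  shows "(LBINT x. K x \<bullet> V x) = 0" "integrable lborel (\<lambda>x. K x \<bullet> V x)"
proof -
  obtain v b e where V: "b \<bullet> e = 0" "\<And>x. V x = v + (x \<bullet> b) *\<^sub>R e" using assms(1) unfolding shear_def by blast
  have c: "C1c (\<lambda>x. (x \<bullet> b) * g x) (\<lambda>x. (x \<bullet> b) *\<^sub>R K x + g x *\<^sub>R b)"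
    by (rule C1c_mult[OF C1_inner assms(2)])
  have eq: "K x \<bullet> V x = K x \<bullet> v + ((x \<bullet> b) *\<^sub>R K x + g x *\<^sub>R b) \<bullet> e" for x
    by (simp add: V inner_add_right inner_add_left)
  have i: "integrable lborel (\<lambda>x. K x \<bullet> v)" "integrable lborel (\<lambda>x. ((x \<bullet> b) *\<^sub>R K x + g x *\<^sub>R b) \<bullet> e)"
    using C1c_integrable(2)[OF c] C1c_integrable(2)[OF assms(2)] by (auto simp del: inner_add_left)
  show "integrable lborel (\<lambda>x. K x \<bullet> V x)" unfolding eq by (rule Bochner_Integration.integrable_add[OF i])
  show "(LBINT x. K x \<bullet> V x) = 0"
    unfolding eq Bochner_Integration.integral_add[OF i] integral_C1c_gradient[OF assms(2)] integral_C1c_gradient[OF c] by simp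
qed

text \<open>The bound on the slope loses only a factor that tends to \<open>1\<close> as \<open>u\<close> tends to \<open>1\<close>, so the
  perimeter of the ball below comes out with the sharp constant.\<close>

lemma radial_cutoff_exists:
  assumes u: "u > (1::real)"
  obtains \<eta> :: "'a::euclidean_space \<Rightarrow> real" and s where
    "C1c \<eta> (\<lambda>x. - (s x *\<^sub>R x))" "\<And>x. 0 \<le> \<eta> x \<and> \<eta> x \<le> 1" "\<And>x. norm x \<le> 1 \<Longrightarrow> \<eta> x = 1" "\<And>x. norm x \<ge> u \<Longrightarrow> \<eta> x = 0"
    "\<And>x. 0 \<le> s x \<and> s x \<le> 2 * u / (u\<^sup>2 - 1)" "\<And>x. norm x < 1 \<or> norm x > u \<Longrightarrow> s x = 0"
proof -
  define \<tau> where "\<tau> = u - 1"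
  \<comment> \<open>Chosen so that \<open>(x \<bullet> x - 1) / \<delta>\<close> runs from 0 on the
    unit sphere to \<open>1 + \<tau> = u\<close> on the sphere of radius \<open>u\<close>.\<close>
  define \<delta> where "\<delta> = (u\<^sup>2 - 1) / u"
  have \<tau>: "\<tau> > 0" using u by (simp add: \<tau>_def)
  have u2: "u\<^sup>2 > 1" using u by (simp add: one_less_power)
  have \<delta>: "\<delta> > 0" using u u2 by (simp add: \<delta>_def)
  have \<delta>u: "\<delta> * (1 + \<tau>) = u\<^sup>2 - 1" using u by (simp add: \<delta>_def \<tau>_def)
  define q where "q t = (max 0 t)\<^sup>2" for t :: real
  define m where "m t = max 0 t" for t :: real
  \<comment> \<open>\<open>\<sigma>'\<close> is a trapezoid of area 1 and height at most 1 over
    \<open>[0, 1 + \<tau>]\<close>; \<open>\<sigma>\<close> is its primitive, written with squared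
    positive parts.\<close>
  define \<sigma> where "\<sigma> t = (q t - q (t - \<tau>) - q (t - 1) + q (t - (1 + \<tau>))) / (2 * \<tau>)" for t
  define \<sigma>' where "\<sigma>' t = (m t - m (t - \<tau>) - m (t - 1) + m (t - (1 + \<tau>))) / \<tau>" for t
  have dq: "((\<lambda>t. q (t - a)) has_real_derivative 2 * m (t - a)) (at t)" for t a
  proof -
    have "((\<lambda>t. t - a) has_real_derivative 1) (at t)" by (auto intro!: derivative_eq_intros)
    moreover have "(q has_real_derivative 2 * m (t - a)) (at (t - a))"
      unfolding q_def m_def by (rule has_real_derivative_pos_part_sq)
    ultimately show ?thesis using DERIV_chain2[of q "2 * m (t - a)" "\<lambda>t. t - a" t 1 UNIV] by simp
  qed
  have d\<sigma>: "(\<sigma> has_real_derivative \<sigma>' t) (at t)" for t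
  proof -
    have "(\<sigma> has_real_derivative (2 * m (t - 0) - 2 * m (t - \<tau>) - 2 * m (t - 1) + 2 * m (t - (1 + \<tau>))) / (2 * \<tau>)) (at t)"
      unfolding \<sigma>_def using dq[of 0 t]
      by (intro DERIV_cdivide DERIV_add DERIV_diff dq) simp
    moreover have "(2 * m (t - 0) - 2 * m (t - \<tau>) - 2 * m (t - 1) + 2 * m (t - (1 + \<tau>))) / (2 * \<tau>) = \<sigma>' t"
      using \<tau> by (simp add: \<sigma>'_def field_simps)
    ultimately show ?thesis by simp
  qed
  have c\<sigma>': "continuous_on UNIV \<sigma>'" unfolding \<sigma>'_def m_def by (intro continuous_intros) (use \<tau> in auto)
  have \<sigma>'b: "0 \<le> \<sigma>' t" "\<sigma>' t \<le> 1" for t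
    using \<tau> by (auto simp: \<sigma>'_def m_def max_def field_simps)
  have \<sigma>'0: "\<sigma>' t = 0" if "t \<le> 0 \<or> t \<ge> 1 + \<tau>" for t
    using that \<tau> by (auto simp: \<sigma>'_def m_def max_def)
  have \<sigma>0: "\<sigma> t = 0" if "t \<le> 0" for t
    using that \<tau> by (auto simp: \<sigma>_def q_def max_def)
  have \<sigma>1: "\<sigma> t = 1" if "t \<ge> 1 + \<tau>" for t
    using that \<tau> by (simp add: \<sigma>_def q_def max_def power2_eq_square field_simps)
  have mono: "\<sigma> s \<le> \<sigma> t" if "s \<le> t" for s t
    using DERIV_nonneg_imp_nondecreasing[OF that] d\<sigma> \<sigma>'b by blast
  have \<sigma>b: "0 \<le> \<sigma> t" "\<sigma> t \<le> 1" for t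
    using mono[of "min t 0" t] \<sigma>0[of "min t 0"] mono[of t "max t (1 + \<tau>)"] \<sigma>1[of "max t (1 + \<tau>)"] by auto
  define r where "r x = (1 / \<delta>) * (x \<bullet> x + (-1))" for x :: 'a
  define \<eta> where "\<eta> x = 1 + (-1) * \<sigma> (r x)" for x :: 'a
  define s where "s x = 2 / \<delta> * \<sigma>' (r x)" for x :: 'a
  have "C1 r (\<lambda>x. (1 / \<delta>) *\<^sub>R (2 *\<^sub>R x + 0) + (x \<bullet> x + (-1)) *\<^sub>R 0)"
    unfolding r_def by (intro C1_mult C1_const C1_add C1_norm_sq)
  then have Cr: "C1 r (\<lambda>x. (2 / \<delta>) *\<^sub>R x)" by simp
  have "C1 \<eta> (\<lambda>x. 0 + ((-1) *\<^sub>R (\<sigma>' (r x) *\<^sub>R ((2 / \<delta>) *\<^sub>R x)) + \<sigma> (r x) *\<^sub>R 0))"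
    unfolding \<eta>_def by (intro C1_add C1_mult C1_const C1_compose_real[OF Cr d\<sigma> c\<sigma>'])
  then have C\<eta>: "C1 \<eta> (\<lambda>x. - (s x *\<^sub>R x))" by (simp add: s_def mult.commute)
  have r0: "r x \<le> 0" if "norm x \<le> 1" for x
  proof -
    have "(norm x)\<^sup>2 \<le> 1\<^sup>2" using that by (intro power_mono) auto
    then show ?thesis using \<delta> by (simp add: r_def power2_norm_eq_inner divide_le_0_iff)
  qed
  have r1: "r x \<ge> 1 + \<tau>" if "norm x \<ge> u" for x
  proof -
    have "u\<^sup>2 \<le> (norm x)\<^sup>2" using that u by (intro power_mono) auto
    then have "\<delta> * (1 + \<tau>) \<le> x \<bullet> x - 1" by (simp add: \<delta>u power2_norm_eq_inner)
    then show ?thesis using \<delta> by (simp add: r_def field_simps)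
  qed
  have \<eta>0: "\<eta> x = 0" if "norm x \<ge> u" for x using r1[OF that] \<sigma>1 by (simp add: \<eta>_def)
  have "norm x \<le> u" if "\<eta> x \<noteq> 0" for x using \<eta>0[of x] that by linarith
  then have "bounded {x. \<eta> x \<noteq> 0}" unfolding bounded_iff by blast
  then have "C1c \<eta> (\<lambda>x. - (s x *\<^sub>R x))" using C\<eta> by (simp add: C1c_def)
  moreover have "0 \<le> s x \<and> s x \<le> 2 * u / (u\<^sup>2 - 1)" for x
  proof -
    have "2 / \<delta> * \<sigma>' (r x) \<le> 2 / \<delta> * 1" using \<sigma>'b \<delta> by (intro mult_left_mono) auto
    also have "\<dots> = 2 * u / (u\<^sup>2 - 1)" by (simp add: \<delta>_def)
    finally show ?thesis using \<sigma>'b \<delta> by (simp add: s_def)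
  qed
  moreover have "s x = 0" if "norm x < 1 \<or> norm x > u" for x
    using that r0[of x] r1[of x] \<sigma>'0[of "r x"] by (auto simp: s_def)
  moreover have "\<eta> x = 1" if "norm x \<le> 1" for x using r0[OF that] \<sigma>0 by (simp add: \<eta>_def)
  moreover have "0 \<le> \<eta> x \<and> \<eta> x \<le> 1" for x using \<sigma>b by (simp add: \<eta>_def)
  ultimately show ?thesis using \<eta>0 by (intro that[of \<eta> s]) blast+
qed

text \<open>With the indicator replaced by a radial cutoff \<open>\<eta>\<close>, integration by
  parts puts the derivative on \<open>\<eta>\<close>, whose gradient is radial; Cauchy-Schwarz
  leaves the radial components \<open>x \<bullet> V i x\<close>, which \<open>M\<close> controls.
  The volume of the shell between the radii 1 and \<open>u\<close>, times the slope of
  \<open>\<eta>\<close>, tends to the area of the unit sphere as \<open>u\<close> tends to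
  1.\<close>

lemma perimeter_unit_ball_le:
  fixes V :: "'i::finite \<Rightarrow> 'a::euclidean_space \<Rightarrow> 'a"
  assumes V: "\<And>i. shear (V i)" and M: "M \<ge> 0" "\<And>x. norm x \<le> 2 \<Longrightarrow> (\<Sum>i\<in>UNIV. (x \<bullet> V i x)\<^sup>2) \<le> (M * norm x)\<^sup>2"
  shows "perimeter V (ball 0 1) \<le> ereal (M * (DIM('a) * unit_ball_vol DIM('a)))"
proof -
  define d where "d = DIM('a)"
  define \<omega> where "\<omega> = unit_ball_vol (real d)"
  note Vc = shear_continuous[OF V]
  have b: "ball (0::'a) 1 \<in> sets borel" by simp
  have "(LBINT p. indicator (ball 0 1) p * diverg V G p) \<le> M * (d * \<omega>)" if fG: "(f, G) \<in> tests" for f G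
  proof -
    let ?D = "diverg V G"
    obtain B where B: "B > 0" "\<And>p. \<bar>?D p\<bar> \<le> B" and ID: "integrable lborel ?D"
      and [measurable]: "?D \<in> borel_measurable borel"
      by (rule diverg_bounds[where V=V, OF fG Vc]) blast+
    have C: "C1c (f i) (G i)" for i using fG by (simp add: tests_def)
    have key: "(LBINT p. indicator (ball 0 1) p * ?D p) \<le> M * \<omega> * (2 * u\<^sup>2 / (u + 1) * (\<Sum>j<d. u ^ j)) + B * \<omega> * (u ^ d - 1)"
      if u: "1 < u" "u \<le> 2" for u
    proof -
      obtain \<eta> :: "'a \<Rightarrow> real" and s where e: "C1c \<eta> (\<lambda>x. - (s x *\<^sub>R x))" "\<And>x. 0 \<le> \<eta> x \<and> \<eta> x \<le> 1"
        "\<And>x. norm x \<le> 1 \<Longrightarrow> \<eta> x = 1" "\<And>x. norm x \<ge> u \<Longrightarrow> \<eta> x = 0"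
        "\<And>x. 0 \<le> s x \<and> s x \<le> 2 * u / (u\<^sup>2 - 1)" "\<And>x. norm x < 1 \<or> norm x > u \<Longrightarrow> s x = 0"
        by (rule radial_cutoff_exists[OF u(1), where 'a='a]) blast+
      have [measurable]: "\<eta> \<in> borel_measurable borel" using C1_measurable(1)[OF C1c_C1[OF e(1)]] .
      define Sh where "Sh = cball (0::'a) u - ball 0 1"
      have Shm: "Sh \<in> sets borel" "emeasure lborel Sh < \<infinity>"
      proof -
        show "Sh \<in> sets borel" by (simp add: Sh_def)
        show "emeasure lborel Sh < \<infinity>" unfolding Sh_def by (intro emeasure_bounded_finite bounded_diff) simp
      qed
      have mSh: "measure lborel Sh = \<omega> * (u ^ d - 1)"
      proof -
        have "measure lborel Sh = measure lborel (cball (0::'a) u) - measure lborel (ball (0::'a) 1)"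
          unfolding Sh_def using u emeasure_lborel_cball_finite[of "0::'a" u] by (intro measure_Diff) auto
        then show ?thesis using u by (simp add: content_cball content_ball \<omega>_def d_def algebra_simps)
      qed
      have iSh: "integrable lborel (\<lambda>p. c * indicator Sh p :: real)" for c
        using Shm by (intro integrable_mult_right integrable_real_indicator) auto
      have iD: "integrable lborel (\<lambda>p. indicator (ball 0 1) p * ?D p)" 
        using integrable_mult_indicator[OF _ ID, of "ball 0 1"] by simp
      have i\<eta>D: "integrable lborel (\<lambda>p. \<eta> p * ?D p)"
      proof (rule Bochner_Integration.integrable_bound[OF ID])
        show "AE x in lborel. norm (\<eta> x * ?D x) \<le> norm (?D x)"
          using e(2) by (intro AE_I2) (simp add: abs_mult mult_left_le_one_le)
      qed measurable
      \<comment> \<open>Trading the indicator for the cutoff changes the integral only on the shell,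
        whose volume tends to 0.\<close>
      have 1: "(LBINT p. indicator (ball 0 1) p * ?D p) - (LBINT p. \<eta> p * ?D p) \<le> B * \<omega> * (u ^ d - 1)"
      proof -
        have "(LBINT p. indicator (ball 0 1) p * ?D p) - (LBINT p. \<eta> p * ?D p)
            = (LBINT p. indicator (ball 0 1) p * ?D p - \<eta> p * ?D p)" using iD i\<eta>D by simp
        also have "\<dots> \<le> (LBINT p. B * indicator Sh p)"
        proof (rule integral_mono[OF _ iSh])
          fix p
          show "indicator (ball 0 1) p * ?D p - \<eta> p * ?D p \<le> B * indicator Sh p"
          proof (cases "norm p < 1 \<or> norm p > u")
            case True
            then show ?thesis using e(3,4)[of p] u by (auto simp: Sh_def)
          next
            case False
            then have "p \<in> Sh" "p \<notin> ball 0 1" by (auto simp: Sh_def)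
            moreover have "- (\<eta> p * ?D p) \<le> 1 * B"
              using mult_mono[of "\<eta> p" 1 "\<bar>?D p\<bar>" B] e(2)[of p] B(2)[of p] abs_ge_minus_self[of "\<eta> p * ?D p"] by (simp add: abs_mult)
            ultimately show ?thesis by simp
          qed
        qed (use iD i\<eta>D in auto)
        also have "\<dots> = B * \<omega> * (u ^ d - 1)" using mSh by simp
        finally show ?thesis .
      qed
      have 2: "(LBINT p. \<eta> p * ?D p) \<le> M * \<omega> * (2 * u\<^sup>2 / (u + 1) * (\<Sum>j<d. u ^ j))"
      proof -
        have c: "C1c (\<lambda>x. f i x * \<eta> x) (\<lambda>x. f i x *\<^sub>R - (s x *\<^sub>R x) + \<eta> x *\<^sub>R G i x)" for i
          by (rule C1c_mult[OF C1c_C1[OF C] e(1)])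
        note df = shear_divergence_free[OF V c]
        have eq: "\<eta> p * ?D p = (\<Sum>i\<in>UNIV. (f i p *\<^sub>R - (s p *\<^sub>R p) + \<eta> p *\<^sub>R G i p) \<bullet> V i p) + (\<Sum>i\<in>UNIV. f i p * (s p * (p \<bullet> V i p)))" for p
          by (simp add: diverg_def sum_distrib_left inner_add_left inner_diff_left algebra_simps flip: sum.distrib)
        have i2: "integrable lborel (\<lambda>p. \<Sum>i\<in>UNIV. (f i p *\<^sub>R - (s p *\<^sub>R p) + \<eta> p *\<^sub>R G i p) \<bullet> V i p)"
          by (intro Bochner_Integration.integrable_sum df(2))
        have i3: "integrable lborel (\<lambda>p. \<Sum>i\<in>UNIV. f i p * (s p * (p \<bullet> V i p)))"
          using Bochner_Integration.integrable_diff[OF i\<eta>D i2] unfolding eq by simp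
        have "(LBINT p. \<eta> p * ?D p) = (\<Sum>i\<in>UNIV. LBINT p. (f i p *\<^sub>R - (s p *\<^sub>R p) + \<eta> p *\<^sub>R G i p) \<bullet> V i p)
             + (LBINT p. (\<Sum>i\<in>UNIV. f i p * (s p * (p \<bullet> V i p))))"
          unfolding eq Bochner_Integration.integral_add[OF i2 i3] Bochner_Integration.integral_sum[OF df(2)] ..
        also have "\<dots> = (LBINT p. (\<Sum>i\<in>UNIV. f i p * (s p * (p \<bullet> V i p))))" using df(1) by simp
        also have "\<dots> \<le> (LBINT p. (2 * u / (u\<^sup>2 - 1) * (M * u)) * indicator Sh p)"
        proof (rule integral_mono[OF i3 iSh])
          fix p :: 'a
          show "(\<Sum>i\<in>UNIV. f i p * (s p * (p \<bullet> V i p))) \<le> (2 * u / (u\<^sup>2 - 1) * (M * u)) * indicator Sh p"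
          proof (cases "norm p < 1 \<or> norm p > u")
            case True
            then show ?thesis using e(6)[of p] by (auto simp: Sh_def)
          next
            case False
            then have p: "p \<in> Sh" "norm p \<le> u" by (auto simp: Sh_def)
            have "(\<Sum>i\<in>UNIV. f i p * (s p * (p \<bullet> V i p))) = s p * (\<Sum>i\<in>UNIV. f i p * (p \<bullet> V i p))"
              by (simp add: sum_distrib_left mult_ac)
            also have "(\<Sum>i\<in>UNIV. f i p * (p \<bullet> V i p)) \<le> L2_set (\<lambda>i. f i p) UNIV * L2_set (\<lambda>i. p \<bullet> V i p) UNIV"
              using L2_set_mult_ineq[of "\<lambda>i. f i p" "\<lambda>i. p \<bullet> V i p" UNIV]
              by (rule order_trans[rotated]) (auto intro!: sum_mono simp flip: abs_mult)
            also have "\<dots> \<le> 1 * (M * norm p)"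
            proof (rule mult_mono)
              show "L2_set (\<lambda>i. f i p) UNIV \<le> 1" using fG by (simp add: L2_set_def tests_def)
              show "L2_set (\<lambda>i. p \<bullet> V i p) UNIV \<le> M * norm p"
                unfolding L2_set_def using M p u by (intro real_le_lsqrt) (auto intro!: sum_nonneg)
            qed (auto simp: L2_set_nonneg)
            also have "\<dots> \<le> M * u" using p M by (simp add: mult_left_mono)
            finally have "(\<Sum>i\<in>UNIV. f i p * (s p * (p \<bullet> V i p))) \<le> s p * (M * u)"
              using e(5)[of p] by (simp add: mult_left_mono)
            also have "\<dots> \<le> (2 * u / (u\<^sup>2 - 1)) * (M * u)" using e(5)[of p] M u by (intro mult_right_mono) auto
            finally show ?thesis using p by simp
          qed
        qed
        also have "\<dots> = (2 * u / (u\<^sup>2 - 1) * (M * u)) * (\<omega> * (u ^ d - 1))" using mSh by simp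
        \<comment> \<open>The factor \<open>u - 1\<close> of the shell volume cancels against the
          one in the slope, so the limit at \<open>u = 1\<close> exists.\<close>
        also have "\<dots> = M * \<omega> * (2 * u\<^sup>2 / (u + 1) * (\<Sum>j<d. u ^ j))"
        proof -
          have "u ^ d - 1 = (u - 1) * (\<Sum>j<d. u ^ j)" by (rule power_diff_1_eq)
          moreover have "u\<^sup>2 - 1 = (u - 1) * (u + 1)" by (simp add: power2_eq_square algebra_simps)
          moreover have "(2 * u / (a * b) * (M * u)) * (\<omega> * (a * S)) = M * \<omega> * (2 * u\<^sup>2 / b * S)"
            if "a \<noteq> 0" "b \<noteq> 0" for a b S using that by (simp add: field_simps power2_eq_square)
          ultimately show ?thesis using u by (simp add: power2_eq_square)
        qed
        finally show ?thesis .
      qed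
      show ?thesis using 1 2 by linarith
    qed
    have "((\<lambda>u. M * \<omega> * (2 * u\<^sup>2 / (u + 1) * (\<Sum>j<d. u ^ j)) + B * \<omega> * (u ^ d - 1)) \<longlongrightarrow>
       M * \<omega> * (2 * 1\<^sup>2 / (1 + 1) * (\<Sum>j<d. 1 ^ j)) + B * \<omega> * (1 ^ d - 1)) (at_right 1)"
      by (intro tendsto_intros) auto
    moreover have "eventually (\<lambda>u. (LBINT p. indicator (ball 0 1) p * ?D p) \<le> M * \<omega> * (2 * u\<^sup>2 / (u + 1) * (\<Sum>j<d. u ^ j)) + B * \<omega> * (u ^ d - 1)) (at_right 1)"
      using key by (auto simp: eventually_at_right_field intro!: exI[of _ "2::real"])
    ultimately have "(LBINT p. indicator (ball 0 1) p * ?D p) \<le> M * \<omega> * (2 * 1\<^sup>2 / (1 + 1) * (\<Sum>j<d. 1 ^ j)) + B * \<omega> * (1 ^ d - 1)"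
      by (intro tendsto_lowerbound) auto
    then show ?thesis by (simp add: mult_ac)
  qed
  then show ?thesis
    unfolding perimeter_borel[where V=V, OF b Vc] by (intro SUP_least) (auto simp: d_def \<omega>_def)
qed

section \<open>Admissible constants and their supremum\<close>

definition admissible :: "('i::finite \<Rightarrow> 'a::euclidean_space \<Rightarrow> 'a) \<Rightarrow> nat \<Rightarrow> real \<Rightarrow> bool" where
  "admissible V Q c \<longleftrightarrow> (\<forall>E \<in> lmeasurable.
     perimeter V E \<ge> ereal (c * measure lebesgue E powr ((real Q - 1) / real Q)))"

lemma isoperimetric_constant_eq: "isoperimetric_constant V Q = Sup {c. admissible V Q c}"
  by (simp add: isoperimetric_constant_def admissible_def)

lemma admissible_unit_ball:
  fixes V :: "'i::finite \<Rightarrow> 'a::euclidean_space \<Rightarrow> 'a"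
  assumes "admissible V Q c" and per: "perimeter V (ball 0 1) \<le> ereal (M * (DIM('a) * unit_ball_vol DIM('a)))"
  shows "c \<le> M * (DIM('a) * unit_ball_vol DIM('a)) / unit_ball_vol DIM('a) powr ((real Q - 1) / real Q)"
proof -
  have "ball (0::'a) 1 \<in> lmeasurable" by simp
  then have "ereal (c * unit_ball_vol DIM('a) powr ((real Q - 1) / real Q)) \<le> perimeter V (ball 0 1)"
    using assms(1) unfolding admissible_def by (metis content_ball mult.right_neutral power_one zero_le_one measure_completion borel_open open_ball sets_lborel)
  also note per
  finally have "c * unit_ball_vol DIM('a) powr ((real Q - 1) / real Q) \<le> M * (DIM('a) * unit_ball_vol DIM('a))" by simp
  moreover have "unit_ball_vol (real DIM('a)) > 0" by simp
  then have "unit_ball_vol DIM('a) powr ((real Q - 1) / real Q) > 0" unfolding powr_gt_zero by (metis less_irrefl)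
  ultimately show ?thesis by (simp add: pos_le_divide_eq)
qed

text \<open>A real \<open>Sup\<close> is informative only for a bounded set. Continuous fields are
  bounded on a ball, so the unit ball has finite perimeter and thereby bounds every admissible
  constant.\<close>

lemma bdd_above_admissible:
  fixes V :: "'i::finite \<Rightarrow> 'a::euclidean_space \<Rightarrow> 'a"
  assumes V: "\<And>i. shear (V i)"
  shows "bdd_above {c. admissible V Q c}"
proof -
  have "\<exists>B. B \<ge> 0 \<and> (\<forall>x\<in>cball 0 2. norm (V i x) \<le> B)" for i
  proof -
    have "bounded (V i ` cball 0 2)"
      by (intro compact_imp_bounded compact_continuous_image continuous_on_subset[OF shear_continuous[OF V]]) auto
    then show ?thesis unfolding bounded_pos by (auto intro: less_imp_le)
  qed
  then obtain B where B: "\<And>i. B i \<ge> 0" "\<And>i x. norm x \<le> 2 \<Longrightarrow> norm (V i x) \<le> B i" by (metis mem_cball_0)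
  define M where "M = sqrt (\<Sum>i\<in>UNIV. (B i)\<^sup>2)"
  have M: "M \<ge> 0" "M\<^sup>2 = (\<Sum>i\<in>UNIV. (B i)\<^sup>2)" by (simp_all add: M_def sum_nonneg)
  have "(\<Sum>i\<in>UNIV. (x \<bullet> V i x)\<^sup>2) \<le> (M * norm x)\<^sup>2" if x: "norm x \<le> 2" for x
  proof -
    have "(x \<bullet> V i x)\<^sup>2 \<le> (norm x)\<^sup>2 * (B i)\<^sup>2" for i
    proof -
      have "\<bar>x \<bullet> V i x\<bar> \<le> norm x * B i"
        using Cauchy_Schwarz_ineq2[of x "V i x"] B(2)[OF x, of i] by (meson mult_left_mono norm_ge_zero order_trans)
      then have "\<bar>x \<bullet> V i x\<bar>\<^sup>2 \<le> (norm x * B i)\<^sup>2" by (intro power_mono) auto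
      then show ?thesis by (simp add: power_mult_distrib)
    qed
    then have "(\<Sum>i\<in>UNIV. (x \<bullet> V i x)\<^sup>2) \<le> (\<Sum>i\<in>UNIV. (norm x)\<^sup>2 * (B i)\<^sup>2)" by (rule sum_mono)
    then show ?thesis by (simp only: power_mult_distrib M(2) sum_distrib_left mult.commute)
  qed
  from perimeter_unit_ball_le[OF V M(1) this] admissible_unit_ball
  show ?thesis unfolding bdd_above_def by blast
qed

lemma perimeter_nonneg: "perimeter V E \<ge> 0"
proof -
  have "(\<lambda>_. 0) \<in> (C1_compact_support :: ('b \<Rightarrow> real ^ 'a) set)"
    unfolding C1_compact_support_iff using C1c_zero by auto
  then have "ereal (LINT p:E|lebesgue. (\<Sum>i\<in>UNIV. field_deriv (V i) (\<lambda>q. (0 :: real ^ 'a) $ i) p)) \<le> perimeter V E"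
    unfolding perimeter_def by (intro SUP_upper) auto
  moreover have "field_deriv (V i) (\<lambda>q. (0::real)) p = 0" for i p
    unfolding field_deriv_def by simp
  ultimately show ?thesis by (simp add: set_lebesgue_integral_def zero_ereal_def)
qed

lemma admissible_0: "admissible V Q 0"
  by (simp add: admissible_def perimeter_nonneg flip: zero_ereal_def)

lemma isoperimetric_constant_nonneg:
  assumes "\<And>i. shear (V i)"
  shows "isoperimetric_constant V Q \<ge> 0"
proof -
  have "admissible V Q 0" by (rule admissible_0)
  then show ?thesis unfolding isoperimetric_constant_eq
    by (intro cSup_upper bdd_above_admissible assms) simp
qed

lemma isoperimetric_constant_ge:
  assumes "\<And>i. shear (V i)" "admissible V Q c"
  shows "c \<le> isoperimetric_constant V Q"
  unfolding isoperimetric_constant_eq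
  by (intro cSup_upper bdd_above_admissible assms) (simp add: assms)

lemma isoperimetric_constant_le:
  assumes "\<And>c. admissible V Q c \<Longrightarrow> c \<le> B"
  shows "isoperimetric_constant V Q \<le> B"
proof -
  have "admissible V Q 0" by (rule admissible_0)
  then show ?thesis unfolding isoperimetric_constant_eq using assms by (intro cSup_least) auto
qed

text \<open>Each \<open>E\<close> of positive volume and finite perimeter bounds all admissible
  constants by \<open>P / m\<close>, hence also their supremum. The supremum is thus attained and
  can be applied to the slices.\<close>

lemma admissible_isoperimetric_constant:
  fixes V :: "'i::finite \<Rightarrow> 'a::euclidean_space \<Rightarrow> 'a"
  assumes "\<And>i. shear (V i)"
  shows "admissible V Q (isoperimetric_constant V Q)"
  unfolding admissible_def
proof
  fix E :: "'a set" assume E: "E \<in> lmeasurable"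
  define m where "m = measure lebesgue E powr ((real Q - 1) / real Q)"
  have m: "m \<ge> 0" by (simp add: m_def)
  have a0: "admissible V Q 0" by (rule admissible_0)
  show "ereal (isoperimetric_constant V Q * measure lebesgue E powr ((real Q - 1) / real Q)) \<le> perimeter V E"
  proof (cases "m = 0 \<or> perimeter V E = \<infinity>")
    case True
    then show ?thesis using perimeter_nonneg[of V E] by (auto simp: m_def zero_ereal_def)
  next
    case False
    then obtain P where P: "perimeter V E = ereal P" using perimeter_nonneg[of V E] by (cases "perimeter V E") auto
    have "c \<le> P / m" if "admissible V Q c" for c
    proof -
      have "ereal (c * m) \<le> ereal P" using that E P unfolding admissible_def m_def by auto
      then show ?thesis using False m by (simp add: pos_le_divide_eq)
    qed
    then have "isoperimetric_constant V Q \<le> P / m" by (rule isoperimetric_constant_le)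
    then show ?thesis using False m P by (simp add: m_def pos_le_divide_eq)
  qed
qed

text \<open>The coefficient of the vertical direction depends on horizontal coordinates alone:
  \<open>b\<close> is horizontal, \<open>e\<close> vertical.\<close>

lemma shear_heis_fields: "shear (heis_fields i)"
proof (cases i)
  case (Inl j)
  have "heis_fields i p = (axis j 1, 0, 0) + (p \<bullet> (0, 2 *\<^sub>R axis j 1, 0)) *\<^sub>R (0, 0, 1)" for p
    by (cases p) (simp add: Inl inner_axis)
  then show ?thesis unfolding shear_def by (intro exI[of _ "(0, 2 *\<^sub>R axis j 1, 0)"] exI[of _ "(axis j 1, 0, 0)"] exI[of _ "(0, 0, 1)"]) simp
next
  case (Inr j)
  have "heis_fields i p = (0, axis j 1, 0) + (p \<bullet> ((- 2) *\<^sub>R axis j 1, 0, 0)) *\<^sub>R (0, 0, 1)" for p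
    by (cases p) (simp add: Inr inner_axis)
  then show ?thesis unfolding shear_def by (intro exI[of _ "((- 2) *\<^sub>R axis j 1, 0, 0)"] exI[of _ "(0, axis j 1, 0)"] exI[of _ "(0, 0, 1)"]) simp
qed

lemma shear_heis_prod_fields: "shear (heis_prod_fields i)"
proof (cases i)
  case (Inl j)
  obtain v b e where V: "b \<bullet> e = 0" "\<And>x. heis_fields j x = v + (x \<bullet> b) *\<^sub>R e"
    using shear_heis_fields[of j] unfolding shear_def by blast
  have "heis_prod_fields i p = (v, 0) + (p \<bullet> (b, 0)) *\<^sub>R (e, 0)" for p
    by (cases p) (simp add: Inl V)
  then show ?thesis unfolding shear_def by (intro exI[of _ "(v, 0)"] exI[of _ "(b, 0)"] exI[of _ "(e, 0)"]) (simp add: V)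
next
  case (Inr j)
  have "heis_prod_fields i p = (0, axis j 1) + (p \<bullet> 0) *\<^sub>R 0" for p
    by (cases p) (simp add: Inr)
  then show ?thesis unfolding shear_def by (metis inner_zero_left)
qed

lemma shear_euclid_fields: "shear (euclid_fields i)"
  unfolding shear_def euclid_fields_def by (intro exI[of _ "axis i 1"] exI[of _ 0]) simp

text \<open>The squared radial components of the coordinate fields sum to
  \<open>(norm x)\<^sup>2\<close>, so the ball estimate holds with \<open>M = 1\<close>, and the two
  volume factors combine to \<open>\<omega> powr (1 / n)\<close>.\<close>

lemma I_euclid_le:
  "I_euclid TYPE('d::finite) \<le> CARD('d) * unit_ball_vol CARD('d) powr (1 / CARD('d))"
  unfolding I_euclid_def
proof (rule isoperimetric_constant_le)
  fix c :: real assume c: "admissible (euclid_fields :: _ \<Rightarrow> real ^ 'd \<Rightarrow> _) CARD('d) c"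
  define n where "n = real CARD('d)"
  define \<omega> where "\<omega> = unit_ball_vol n"
  have \<omega>: "\<omega> > 0" by (simp add: \<omega>_def n_def)
  have n: "n > 0" by (simp add: n_def)
  have "(\<Sum>i\<in>UNIV. (x \<bullet> euclid_fields i x)\<^sup>2) \<le> (1 * norm x)\<^sup>2" for x :: "real ^ 'd"
    by (simp add: euclid_fields_def inner_axis norm_vec_def L2_set_def sum_nonneg)
  from admissible_unit_ball[OF c perimeter_unit_ball_le[OF shear_euclid_fields _ this]]
  have "c \<le> n * \<omega> / \<omega> powr ((n - 1) / n)" by (simp add: n_def \<omega>_def)
  also have "n * \<omega> / \<omega> powr ((n - 1) / n) = n * \<omega> powr (1 / n)"
  proof -
    have "\<omega> / \<omega> powr ((n - 1) / n) = \<omega> powr (1 - (n - 1) / n)" using \<omega> by (simp add: powr_diff)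
    also have "1 - (n - 1) / n = 1 / n" using n by (simp add: field_simps)
    finally show ?thesis by (metis times_divide_eq_right)
  qed
  finally show "c \<le> CARD('d) * unit_ball_vol CARD('d) powr (1 / CARD('d))" by (simp add: n_def \<omega>_def)
qed

section \<open>Functional isoperimetric inequalities\<close>

text \<open>Both bounds replace the summands of \<open>(s + t) ^ m - s ^ m = t * (\<Sum>i<m. (s + t)
  ^ i * s ^ (m - 1 - i))\<close> by an extreme one. For \<open>m = 0\<close> the truncated exponent
  \<open>m - 1\<close> is harmless, being multiplied by \<open>real m\<close>.\<close>

lemma power_add_bounds:
  fixes s t :: real
  assumes "0 \<le> s" "0 \<le> t"
  shows "s ^ m + real m * t * s ^ (m - 1) \<le> (s + t) ^ m"
    and "(s + t) ^ m \<le> s ^ m + real m * t * (s + t) ^ (m - 1)"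
proof -
  have eq: "(s + t) ^ m - s ^ m = t * (\<Sum>i<m. (s + t) ^ i * s ^ (m - 1 - i))"
  proof (cases m)
    case (Suc n)
    then show ?thesis using diff_power_eq_sum[of "s + t" n s] by simp
  qed simp
  have "(\<Sum>i<m. s ^ (m - 1)) \<le> (\<Sum>i<m. (s + t) ^ i * s ^ (m - 1 - i))"
  proof (rule sum_mono)
    fix i assume "i \<in> {..<m}"
    then have "s ^ (m - 1) = s ^ i * s ^ (m - 1 - i)" by (simp flip: power_add)
    also have "\<dots> \<le> (s + t) ^ i * s ^ (m - 1 - i)"
      using assms by (intro mult_right_mono power_mono) auto
    finally show "s ^ (m - 1) \<le> (s + t) ^ i * s ^ (m - 1 - i)" .
  qed
  then have "t * (real m * s ^ (m - 1)) \<le> (s + t) ^ m - s ^ m"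
    unfolding eq using assms by (intro mult_left_mono) auto
  then show "s ^ m + real m * t * s ^ (m - 1) \<le> (s + t) ^ m" by (simp add: mult_ac)
  have "(\<Sum>i<m. (s + t) ^ i * s ^ (m - 1 - i)) \<le> (\<Sum>i<m. (s + t) ^ (m - 1))"
  proof (rule sum_mono)
    fix i assume "i \<in> {..<m}"
    then have "(s + t) ^ (m - 1) = (s + t) ^ i * (s + t) ^ (m - 1 - i)" by (simp flip: power_add)
    moreover have "(s + t) ^ i * s ^ (m - 1 - i) \<le> (s + t) ^ i * (s + t) ^ (m - 1 - i)"
      using assms by (intro mult_left_mono power_mono) auto
    ultimately show "(s + t) ^ i * s ^ (m - 1 - i) \<le> (s + t) ^ (m - 1)" by simp
  qed
  then have "(s + t) ^ m - s ^ m \<le> t * (real m * (s + t) ^ (m - 1))"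
    unfolding eq using assms by (intro mult_left_mono) auto
  then show "(s + t) ^ m \<le> s ^ m + real m * t * (s + t) ^ (m - 1)" by (simp add: mult_ac)
qed

text \<open>Brunn-Minkowski with a ball as second set, then the linear part of the binomial
  expansion. The rate of growth is stated with a lower bound \<open>a\<close> for the volume of
  \<open>A\<close>, so that one rate fits a whole family of superlevel sets.\<close>

lemma measure_sumset_ball:
  fixes A :: "'a::euclidean_space set"
  assumes A: "open A" "bounded A" "A \<noteq> {}" and \<epsilon>: "\<epsilon> > 0" and a: "0 < a" "a \<le> measure lborel A"
  shows "measure lborel A + \<epsilon> * (DIM('a) * unit_ball_vol DIM('a) powr (1 / DIM('a)) * a powr ((real DIM('a) - 1) / DIM('a)))
     \<le> measure lborel (sumset A (ball 0 \<epsilon>))"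
proof -
  define n where "n = DIM('a)"
  define \<omega> where "\<omega> = unit_ball_vol (real n)"
  have n: "n > 0" by (simp add: n_def)
  have \<omega>: "\<omega> > 0" by (simp add: \<omega>_def)
  define m where "m = measure lborel A"
  have m: "m > 0" using a by (simp add: m_def)
  define \<alpha> where "\<alpha> = m powr (1 / n)"
  define \<beta> where "\<beta> = \<omega> powr (1 / n)"
  have pos: "\<alpha> > 0" "\<beta> > 0" using m \<omega> by (simp_all add: \<alpha>_def \<beta>_def)
  have pw: "(x powr (1 / n)) ^ n = x" if "x \<ge> 0" for x :: real
  proof (cases "x = 0")
    case False
    then show ?thesis using n that by (simp add: powr_realpow[symmetric] powr_powr)
  qed (use n in simp)
  have pw1: "(x powr (1 / n)) ^ (n - 1) = x powr ((real n - 1) / n)" if "x > 0" for x :: real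
    using n that by (simp add: powr_realpow[symmetric] powr_powr of_nat_diff)
  have "measure lborel (ball (0::'a) \<epsilon>) powr (1 / n) = \<epsilon> * \<beta>"
    using \<epsilon> n \<omega> by (simp add: content_ball n_def[symmetric] \<omega>_def[symmetric] \<beta>_def powr_mult powr_powr powr_realpow[symmetric])
  moreover have "measure lborel A powr (1 / n) + measure lborel (ball (0::'a) \<epsilon>) powr (1 / n) \<le> measure lborel (sumset A (ball 0 \<epsilon>)) powr (1 / n)"
    unfolding n_def using A \<epsilon> by (intro brunn_minkowski) auto
  ultimately have "\<alpha> + \<epsilon> * \<beta> \<le> measure lborel (sumset A (ball 0 \<epsilon>)) powr (1 / n)" by (simp add: \<alpha>_def m_def)
  then have "(\<alpha> + \<epsilon> * \<beta>) ^ n \<le> (measure lborel (sumset A (ball 0 \<epsilon>)) powr (1 / n)) ^ n"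
    using pos \<epsilon> by (intro power_mono) auto
  then have le: "(\<alpha> + \<epsilon> * \<beta>) ^ n \<le> measure lborel (sumset A (ball 0 \<epsilon>))" by (simp add: pw)
  have "a powr ((real n - 1) / n) \<le> m powr ((real n - 1) / n)"
    using a n by (intro powr_mono2) (auto simp: m_def)
  then have "m + \<epsilon> * (n * \<beta> * a powr ((real n - 1) / n)) \<le> m + \<epsilon> * (n * \<beta> * m powr ((real n - 1) / n))"
    using \<epsilon> pos by (intro add_left_mono mult_left_mono) auto
  also have "\<dots> = \<alpha> ^ n + real n * (\<epsilon> * \<beta>) * \<alpha> ^ (n - 1)"
    unfolding \<alpha>_def pw1[OF m, symmetric] using m by (simp add: pw)
  also have "\<dots> \<le> (\<alpha> + \<epsilon> * \<beta>) ^ n" using pos \<epsilon> by (intro power_add_bounds) auto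
  finally show ?thesis using le by (simp add: m_def n_def \<beta>_def \<omega>_def)
qed

text \<open>Layer-cake formula cut off at height \<open>\<tau>\<close>; negative values of
  \<open>h\<close> are consistent with it because \<open>ennreal\<close> sends them to 0.\<close>

lemma nn_integral_layers:
  fixes h :: "'a::euclidean_space \<Rightarrow> real"
  assumes [measurable]: "h \<in> borel_measurable borel" and "\<tau> > 0"
  shows "(\<integral>\<^sup>+x. ennreal (min (h x) \<tau>) \<partial>lborel) = (\<integral>\<^sup>+t. indicator {0<..<\<tau>} t * emeasure lborel {x. h x > t} \<partial>lborel)"
proof -
  have "(\<integral>\<^sup>+x. ennreal (min (h x) \<tau>) \<partial>lborel) = (\<integral>\<^sup>+x. (\<integral>\<^sup>+t. indicator {0<..<min (h x) \<tau>} t \<partial>lborel) \<partial>(lborel::'a measure))"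
  proof (intro nn_integral_cong)
    fix x
    show "ennreal (min (h x) \<tau>) = (\<integral>\<^sup>+t. indicator {0<..<min (h x) \<tau>} t \<partial>lborel)"
      by (cases "min (h x) \<tau> \<ge> 0") (auto simp: ennreal_neg)
  qed
  also have "\<dots> = (\<integral>\<^sup>+x. (\<integral>\<^sup>+t. indicator {0<..<\<tau>} t * (if h x > t then 1 else 0) \<partial>lborel) \<partial>(lborel::'a measure))"
    by (intro nn_integral_cong) (auto simp: indicator_def)
  also have "\<dots> = (\<integral>\<^sup>+t. (\<integral>\<^sup>+x. indicator {0<..<\<tau>} t * (if h x > t then 1 else 0) \<partial>(lborel::'a measure)) \<partial>lborel)"
    by (rule lborel_pair.Fubini'[symmetric]) measurable
  also have "\<dots> = (\<integral>\<^sup>+t. indicator {0<..<\<tau>} t * emeasure lborel {x. h x > t} \<partial>lborel)"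
  proof (intro nn_integral_cong)
    fix t
    have "(\<integral>\<^sup>+x. indicator {0<..<\<tau>} t * (if h x > t then 1 else 0) \<partial>(lborel::'a measure))
        = indicator {0<..<\<tau>} t * (\<integral>\<^sup>+x. indicator {x. h x > t} x \<partial>(lborel::'a measure))"
      by (subst nn_integral_cmult[symmetric]) (auto intro!: nn_integral_cong simp: indicator_def)
    then show "(\<integral>\<^sup>+x. indicator {0<..<\<tau>} t * (if h x > t then 1 else 0) \<partial>(lborel::'a measure)) = indicator {0<..<\<tau>} t * emeasure lborel {x. h x > t}"
      by simp
  qed
  finally show ?thesis .
qed

text \<open>Substitute for the coarea formula. On a ball \<open>B\<close>, the function
  \<open>g = f + \<epsilon> * (norm G + \<eta>)\<close> dominates the values of \<open>f\<close> at
  all points within \<open>\<epsilon>\<close>, so \<open>{g > t}\<close> contains the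
  \<open>\<epsilon>\<close>-neighbourhood of \<open>{f > t}\<close> and is larger by at least
  \<open>\<epsilon> * \<kappa>\<close>. Integration over \<open>0 < t < \<tau>\<close> bounds the
  integral of \<open>g - f\<close> from below.\<close>

lemma C1c_isoperimetric:
  fixes f :: "'a::euclidean_space \<Rightarrow> real"
  assumes f: "C1c f G" "\<And>x. 0 \<le> f x" and \<tau>: "\<tau> > 0" and a: "a > 0" "a \<le> measure lborel {x. f x > \<tau>}"
  shows "\<tau> * (DIM('a) * unit_ball_vol DIM('a) powr (1 / DIM('a)) * a powr ((real DIM('a) - 1) / DIM('a))) \<le> (LBINT x. norm (G x))"
proof -
  define \<kappa> where "\<kappa> = DIM('a) * unit_ball_vol DIM('a) powr (1 / DIM('a)) * a powr ((real DIM('a) - 1) / DIM('a))"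
  have \<kappa>: "\<kappa> \<ge> 0" by (simp add: \<kappa>_def)
  obtain R where R: "R > 0" "\<And>x. norm x > R \<Longrightarrow> f x = 0" "\<And>x. norm x > R \<Longrightarrow> G x = 0"
    using C1c_support[OF f(1)] by metis
  have [measurable]: "f \<in> borel_measurable borel" "G \<in> borel_measurable borel"
    using C1_measurable[OF C1c_C1[OF f(1)]] by auto
  have fc: "continuous_on UNIV f" using C1_continuous[OF C1c_C1[OF f(1)]] .
  note int = C1c_integrable[OF f(1)]
  define B where "B = cball (0::'a) (R + 1)"
  have B: "B \<in> sets borel" "emeasure lborel B < \<infinity>" 
    using emeasure_lborel_cball_finite[of "0::'a" "R + 1"] by (auto simp: B_def)
  have iiB: "integrable lborel (indicat_real B)" by (rule integrable_real_indicator) (use B in auto)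
  have "\<tau> * \<kappa> \<le> (LBINT x. norm (G x)) + \<eta> * measure lborel B" if \<eta>: "\<eta> > 0" for \<eta>
  proof -
    obtain d where d: "d > 0" "\<And>x h. norm h < d \<Longrightarrow> \<bar>f (x + h) - f x - G x \<bullet> h\<bar> \<le> \<eta> * norm h"
      using C1c_uniform[OF f(1) \<eta>] by metis
    define \<epsilon> where "\<epsilon> = min 1 d"
    have \<epsilon>: "\<epsilon> > 0" "\<epsilon> \<le> 1" "\<epsilon> \<le> d" using d by (auto simp: \<epsilon>_def)
    \<comment> \<open>The indicator keeps \<open>g\<close> integrable in spite of the constant
      \<open>\<eta>\<close>; since \<open>\<epsilon> \<le> 1\<close>, the neighbourhoods of the
      superlevel sets of \<open>f\<close> stay in \<open>B\<close>.\<close>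
    define g where "g x = indicator B x * (f x + \<epsilon> * (norm (G x) + \<eta>))" for x
    have [measurable]: "g \<in> borel_measurable borel" using B unfolding g_def by measurable
    have g0: "g x \<ge> 0" for x using f(2)[of x] \<epsilon> \<eta> by (simp add: g_def)
    have igG: "integrable lborel (\<lambda>x. indicator B x * (norm (G x) + \<eta>))"
      using B integrable_mult_indicator[OF _ integrable_norm[OF int(2)], of B]
      by (simp add: distrib_left integrable_real_indicator less_top)
    have fB: "f x = indicator B x * f x" for x using R(2)[of x] by (auto simp: B_def indicator_def)
    have geq: "g x = f x + \<epsilon> * (indicator B x * (norm (G x) + \<eta>))" for x
      using fB[of x] by (simp add: g_def algebra_simps)
    have fin: "open {x. f x > t}" "bounded {x. f x > t}" if "t > 0" for t
    proof -
      show "open {x. f x > t}" using fc by (intro open_Collect_less) auto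
      show "bounded {x. f x > t}" by (rule bounded_subset[of "{x. f x \<noteq> 0}"]) (use f(1) that in \<open>auto simp: C1c_def\<close>)
    qed
    have key: "emeasure lborel {x. f x > t} + ennreal (\<epsilon> * \<kappa>) \<le> emeasure lborel {x. g x > t}" if t: "0 < t" "t < \<tau>" for t
    proof -
      note o = fin[OF t(1)]
      have ma: "a \<le> measure lborel {x. f x > t}"
      proof -
        have "measure lborel {x. f x > \<tau>} \<le> measure lborel {x. f x > t}"
          using t fmeasurable_bounded_open[OF o(2,1)] fin[OF \<tau>] by (intro measure_mono_fmeasurable) auto
        then show ?thesis using a by linarith
      qed
      then have ne: "{x. f x > t} \<noteq> {}" using a by (metis less_le_not_le measure_empty)
      have "measure lborel {x. f x > t} + \<epsilon> * \<kappa> \<le> measure lborel (sumset {x. f x > t} (ball 0 \<epsilon>))"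
        unfolding \<kappa>_def by (rule measure_sumset_ball[OF o ne \<epsilon>(1) a(1) ma])
      also have "\<dots> \<le> measure lborel {x. g x > t}"
      proof (rule measure_mono_fmeasurable)
        show "sumset {x. f x > t} (ball 0 \<epsilon>) \<subseteq> {x. g x > t}"
        proof
          fix y assume "y \<in> sumset {x. f x > t} (ball 0 \<epsilon>)"
          then obtain x u where xu: "f x > t" "norm u < \<epsilon>" "y = x + u" unfolding sumset_def by auto
          have "norm x \<le> R" using R(2)[of x] xu(1) t by force
          then have "y \<in> B" using xu \<epsilon> norm_triangle_ineq[of x u] by (simp add: B_def)
          have "\<bar>f (y + - u) - f y - G y \<bullet> (- u)\<bar> \<le> \<eta> * norm (- u)" using xu \<epsilon> by (intro d(2)) simp
          then have "f x \<le> f y + \<bar>G y \<bullet> u\<bar> + \<eta> * norm u" using xu by simp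
          also have "\<dots> \<le> f y + norm (G y) * norm u + \<eta> * norm u" using Cauchy_Schwarz_ineq2[of "G y" u] by simp
          also have "\<dots> = f y + norm u * (norm (G y) + \<eta>)" by (simp add: algebra_simps)
          also have "\<dots> \<le> f y + \<epsilon> * (norm (G y) + \<eta>)" using xu \<eta> by (intro add_left_mono mult_right_mono) auto
          finally show "y \<in> {x. g x > t}" using \<open>y \<in> B\<close> xu(1) by (simp add: g_def)
        qed
        show "sumset {x. f x > t} (ball 0 \<epsilon>) \<in> sets lborel" using open_sumset[OF o(1) open_ball] by simp
        have sub: "{x. g x > t} \<subseteq> B" using t by (auto simp: g_def indicator_def split: if_splits)
        show "{x. g x > t} \<in> fmeasurable lborel"
          by (rule fmeasurableI) (use le_less_trans[OF emeasure_mono[OF sub] B(2)] B in auto)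
      qed
      finally have le: "measure lborel {x. f x > t} + \<epsilon> * \<kappa> \<le> measure lborel {x. g x > t}" .
      have "emeasure lborel {x. f x > t} = ennreal (measure lborel {x. f x > t})"
        using fmeasurable_bounded_open[OF o(2,1)] by (intro emeasure_eq_measure2)
      moreover have "ennreal (measure lborel {x. g x > t}) \<le> emeasure lborel {x. g x > t}"
        by (cases "emeasure lborel {x. g x > t} = top") (auto simp: emeasure_eq_ennreal_measure)
      ultimately show ?thesis
        using ennreal_leI[OF le] \<epsilon> \<kappa> by (auto simp: ennreal_plus)
    qed
    have "(\<integral>\<^sup>+x. ennreal (min (f x) \<tau>) \<partial>lborel) + ennreal (\<tau> * (\<epsilon> * \<kappa>))
        = (\<integral>\<^sup>+t. indicator {0<..<\<tau>} t * emeasure lborel {x. f x > t} \<partial>lborel) + (\<integral>\<^sup>+t. ennreal (\<epsilon> * \<kappa>) * indicator {0<..<\<tau>} t \<partial>lborel)"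
      using nn_integral_layers[of f \<tau>] \<tau> \<epsilon> \<kappa> by (simp add: nn_integral_cmult_indicator ennreal_mult mult.commute)
    also have "\<dots> = (\<integral>\<^sup>+t. indicator {0<..<\<tau>} t * emeasure lborel {x. f x > t} + ennreal (\<epsilon> * \<kappa>) * indicator {0<..<\<tau>} t \<partial>lborel)"
      by (subst nn_integral_add) auto
    also have "\<dots> \<le> (\<integral>\<^sup>+t. indicator {0<..<\<tau>} t * emeasure lborel {x. g x > t} \<partial>lborel)"
      using key by (intro nn_integral_mono) (auto simp: indicator_def)
    also have "\<dots> = (\<integral>\<^sup>+x. ennreal (min (g x) \<tau>) \<partial>lborel)" using nn_integral_layers[of g \<tau>] \<tau> by simp
    finally have L: "(\<integral>\<^sup>+x. ennreal (min (f x) \<tau>) \<partial>lborel) + ennreal (\<tau> * (\<epsilon> * \<kappa>)) \<le> (\<integral>\<^sup>+x. ennreal (min (g x) \<tau>) \<partial>lborel)" .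
    have ig: "integrable lborel g" unfolding geq using int igG by auto
    have imf: "integrable lborel (\<lambda>x. min (f x) \<tau>)" "integrable lborel (\<lambda>x. min (g x) \<tau>)"
      using Bochner_Integration.integrable_bound[OF int(1), of "\<lambda>x. min (f x) \<tau>"]
        Bochner_Integration.integrable_bound[OF ig, of "\<lambda>x. min (g x) \<tau>"] f(2) g0 \<tau> by (auto simp: min_def)
    have "ennreal ((LBINT x. min (f x) \<tau>) + \<tau> * (\<epsilon> * \<kappa>)) \<le> ennreal (LBINT x. min (g x) \<tau>)"
      using L imf f(2) g0 \<tau> \<epsilon> \<kappa> by (simp add: nn_integral_eq_integral ennreal_plus)
    then have "(LBINT x. min (f x) \<tau>) + \<tau> * (\<epsilon> * \<kappa>) \<le> (LBINT x. min (g x) \<tau>)"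
      using g0 \<tau> by (subst (asm) ennreal_le_iff) (auto intro!: integral_nonneg)
    then have "\<tau> * (\<epsilon> * \<kappa>) \<le> (LBINT x. min (g x) \<tau> - min (f x) \<tau>)" using imf by simp
    also have "\<dots> \<le> (LBINT x. \<epsilon> * (indicator B x * (norm (G x) + \<eta>)))"
    proof (rule integral_mono)
      fix x
      have "0 \<le> \<epsilon> * (indicator B x * (norm (G x) + \<eta>))" using \<epsilon> \<eta> by simp
      then show "min (g x) \<tau> - min (f x) \<tau> \<le> \<epsilon> * (indicator B x * (norm (G x) + \<eta>))"
        using geq[of x] by (auto simp: min_def)
    qed (use imf igG in auto)
    also have "\<dots> = \<epsilon> * (LBINT x. indicator B x * (norm (G x) + \<eta>))" by simp
    finally have "\<tau> * \<kappa> \<le> (LBINT x. indicator B x * (norm (G x) + \<eta>))" using \<epsilon> by (simp add: mult.left_commute)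
    also have "\<dots> \<le> (LBINT x. norm (G x) + \<eta> * indicator B x)"
    proof (rule integral_mono)
      show "integrable lborel (\<lambda>x. norm (G x) + \<eta> * indicator B x)" using int iiB by auto
    qed (use igG in \<open>auto simp: indicator_def\<close>)
    also have "\<dots> = (LBINT x. norm (G x)) + \<eta> * measure lborel B"
      using int B by (simp add: integrable_real_indicator)
    finally show ?thesis .
  qed
  note key = this
  have "\<tau> * \<kappa> \<le> (LBINT x. norm (G x))"
    by (rule le_if_le_add_mult[OF key]) auto
  then show ?thesis by (simp add: \<kappa>_def)
qed

text \<open>Each value \<open>W w\<close> is modelled by a ball of \<open>'q\<close> of volume proportional to it; Brunn-Minkowski is
  applied to the resulting body of revolution in \<open>'q \<times> 'b\<close>.\<close>

lemma C1c_profile_inequality: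
  fixes W :: "'b::euclidean_space \<Rightarrow> real" and q :: "'q::euclidean_space itself"
  defines "Q \<equiv> DIM('q)" and "d \<equiv> DIM('q) + DIM('b)"
  assumes W: "C1c W G" "\<And>w. 0 \<le> W w" and c: "c > 0" and Q2: "DIM('q) \<ge> 2" and I: "(LBINT w. W w) > 0"
  shows "d * unit_ball_vol d powr (1 / d) * (unit_ball_vol Q * (Q / c) ^ Q * (LBINT w. W w)) powr ((real d - 1) / d)
     \<le> unit_ball_vol Q * (Q / c) ^ Q * (LBINT w. sqrt ((c * root Q (W w) ^ (Q - 1))\<^sup>2 + (norm (G w))\<^sup>2))"
proof -
  \<comment> \<open>With this scale the ball of radius \<open>la * r w\<close> has volume
    \<open>A * W w\<close> and surface \<open>A * (c * r w ^ (Q - 1))\<close>: the same factor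
    \<open>A\<close> in both.\<close>
  define la where "la = real Q / c"
  have Q: "Q \<ge> 2" "Q > 0" using Q2 by (auto simp: Q_def)
  have la: "la > 0" using c Q by (simp add: la_def)
  define \<omega> where "\<omega> = unit_ball_vol (real Q)"
  have \<omega>: "\<omega> > 0" by (simp add: \<omega>_def)
  define A where "A = \<omega> * la ^ Q"
  have A: "A > 0" using \<omega> la by (simp add: A_def)
  define r where "r w = root Q (W w)" for w
  have rQ: "r w ^ Q = W w" and r0: "r w \<ge> 0" for w using W(2) Q by (auto simp: r_def)
  define S where "S w = sqrt ((c * r w ^ (Q - 1))\<^sup>2 + (norm (G w))\<^sup>2)" for w
  define II where "II = (LBINT w. W w)"
  obtain R where R: "R > 0" "\<And>x. norm x > R \<Longrightarrow> W x = 0" "\<And>x. norm x > R \<Longrightarrow> G x = 0"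
    using C1c_support[OF W(1)] by metis
  have Wc: "continuous_on UNIV W" and Gc: "continuous_on UNIV G"
    using C1_continuous[OF C1c_C1[OF W(1)]] W(1) by (auto simp: C1c_def C1_def)
  have rc: "continuous_on UNIV r" unfolding r_def by (intro continuous_on_real_root Wc)
  have rz: "r x = 0" if "norm x > R" for x using R(2)[OF that] by (simp add: r_def)
  have Sc: "continuous_on UNIV S" unfolding S_def by (intro continuous_intros rc Gc)
  have Sz: "S x = 0" if "norm x > R" for x using R(3)[OF that] rz[OF that] Q by (simp add: S_def)
  have S0: "S w \<ge> 0" for w by (simp add: S_def)
  note int = C1c_integrable(1)[OF W(1)] compact_support_integrable[OF Sc Sz]
  note [measurable] = borel_measurable_continuous_onI[OF Wc] borel_measurable_continuous_onI[OF Sc] borel_measurable_continuous_onI[OF rc]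
  obtain Bd where Bd: "Bd > 0" "\<And>x. norm (r x) \<le> Bd" using compact_support_bounded[OF rc rz] by metis
  define B where "B = cball (0::'b) (R + 1)"
  have B: "B \<in> sets borel" "emeasure lborel B < \<infinity>"
    using emeasure_lborel_cball_finite[of "0::'b" "R + 1"] by (auto simp: B_def)
  have iiB: "integrable lborel (indicat_real B)" by (rule integrable_real_indicator) (use B in auto)
  define E where "E = {z :: 'q \<times> 'b. norm (fst z) < la * r (snd z)}"
  have Eo: "open E" unfolding E_def
    by (intro open_Collect_less continuous_intros continuous_on_compose2[OF rc]) auto
  have Eb: "bounded E"
  proof -
    have "E \<subseteq> cball 0 (la * Bd) \<times> cball 0 R"
    proof
      fix z assume "z \<in> E"
      then have z: "norm (fst z) < la * r (snd z)" by (simp add: E_def)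
      moreover have "la * r (snd z) \<le> la * Bd" using Bd(2)[of "snd z"] la by (intro mult_left_mono) auto
      moreover have "norm (snd z) \<le> R" using rz[of "snd z"] z by (metis linorder_not_le mult_zero_right norm_not_less_zero)
      ultimately show "z \<in> cball 0 (la * Bd) \<times> cball 0 R" by (cases z) auto
    qed
    then show ?thesis by (rule bounded_subset[rotated]) (intro bounded_Times bounded_cball)
  qed
  \<comment> \<open>Slices are measured through \<open>norm x ^ Q\<close>, so that for the enlarged
    body only this power has to be estimated.\<close>
  have slice: "emeasure lborel ((\<lambda>x. (x, w)) -` T) \<le> ennreal (A * v)" if "v \<ge> 0" "\<And>x. (x, w) \<in> T \<Longrightarrow> norm x ^ Q \<le> la ^ Q * v"
    for T :: "('q \<times> 'b) set" and w v
  proof -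
    have "(\<lambda>x. (x, w)) -` T \<subseteq> cball 0 (root Q (la ^ Q * v))"
    proof
      fix x assume "x \<in> (\<lambda>x. (x, w)) -` T"
      then have "norm x ^ Q \<le> la ^ Q * v" using that(2) by auto
      then have "root Q (norm x ^ Q) \<le> root Q (la ^ Q * v)" using Q by (intro real_root_le_mono)
      then show "x \<in> cball 0 (root Q (la ^ Q * v))" using Q by (simp add: real_root_power_cancel)
    qed
    then have "emeasure lborel ((\<lambda>x. (x, w)) -` T) \<le> emeasure lborel (cball (0::'q) (root Q (la ^ Q * v)))"
      by (intro emeasure_mono) auto
    also have "\<dots> = ennreal (A * v)"
      using that(1) la Q by (simp add: emeasure_cball Q_def[symmetric] A_def \<omega>_def mult.assoc)
    finally show ?thesis .
  qed
  have mE: "emeasure lborel E = ennreal (A * II)"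
  proof -
    have "emeasure lborel E = (\<integral>\<^sup>+w. emeasure lborel ((\<lambda>x. (x, w)) -` E) \<partial>lborel)"
      unfolding lborel_prod[symmetric] using Eo by (intro lborel_pair.emeasure_pair_measure_alt2) (simp only: lborel_prod sets_lborel borel_open)
    also have "\<dots> = (\<integral>\<^sup>+w. ennreal (A * W w) \<partial>lborel)"
    proof (intro nn_integral_cong)
      fix w
      have "(\<lambda>x. (x, w)) -` E = ball 0 (la * r w)" by (auto simp: E_def)
      then show "emeasure lborel ((\<lambda>x. (x, w)) -` E) = ennreal (A * W w)"
        using la r0[of w] by (simp add: emeasure_ball Q_def[symmetric] A_def \<omega>_def power_mult_distrib mult.assoc flip: rQ)
    qed
    also have "\<dots> = ennreal (A * II)"
      using int A W(2) by (subst nn_integral_eq_integral) (auto simp: II_def)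
    finally show ?thesis .
  qed
  have AI: "A * II > 0" using A I by (simp add: II_def)
  have mE': "measure lborel E = A * II" using mE AI by (simp add: measure_def)
  then have Ene: "E \<noteq> {}" using AI by (metis less_irrefl measure_empty)
  define \<kappa> where "\<kappa> = d * unit_ball_vol d powr (1 / d) * (A * II) powr ((real d - 1) / d)"
  have main: "\<kappa> \<le> A * (LBINT w. S w) + \<eta> * (A * measure lborel B)" if \<eta>: "\<eta> > 0" for \<eta>
  proof -
    \<comment> \<open>Splits \<open>\<eta>\<close> into the error \<open>\<eta>1\<close> of the
      expansion of \<open>W\<close> and the error \<open>c * \<eta>1\<close> of the power of
      \<open>r\<close>.\<close>
    define \<eta>1 where "\<eta>1 = \<eta> / (1 + c)"
    have "\<eta>1 > 0" using \<eta> c by (simp add: \<eta>1_def)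
    moreover have "\<eta>1 * (1 + c) = \<eta>" using c by (simp add: \<eta>1_def)
    ultimately have \<eta>1: "\<eta>1 > 0" "\<eta>1 + c * \<eta>1 = \<eta>" by (auto simp: algebra_simps)
    obtain d1 where d1: "d1 > 0" "\<And>x h. norm h < d1 \<Longrightarrow> \<bar>W (x + h) - W x - G x \<bullet> h\<bar> \<le> \<eta>1 * norm h"
      using C1c_uniform[OF W(1) \<eta>1(1)] by metis
    define m where "m = Q - 1"
    \<comment> \<open>Exceeds the Lipschitz constant of \<open>t ^ m\<close> on
      \<open>[0, Bd + 1]\<close>, so that raising \<open>r w\<close> by \<open>\<delta>\<close>
      costs at most \<open>\<eta>1\<close>.\<close>
    define D where "D = real m * (Bd + 1) ^ (m - 1) + 1"
    have D: "D > 0" using Bd by (simp add: D_def add_nonneg_pos)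
    define \<delta> where "\<delta> = min 1 (\<eta>1 / D)"
    have \<delta>: "\<delta> > 0" "\<delta> \<le> 1" "\<delta> * D \<le> \<eta>1" using \<eta>1 D by (auto simp: \<delta>_def min_def field_simps)
    have pw: "(t + \<delta>) ^ m \<le> t ^ m + \<eta>1" if "0 \<le> t" "t \<le> Bd" for t
    proof -
      have "(t + \<delta>) ^ m \<le> t ^ m + real m * \<delta> * (t + \<delta>) ^ (m - 1)" using that \<delta> by (intro power_add_bounds) auto
      also have "real m * \<delta> * (t + \<delta>) ^ (m - 1) \<le> real m * \<delta> * (Bd + 1) ^ (m - 1)"
        using that \<delta> by (intro mult_left_mono power_mono) auto
      also have "\<dots> \<le> \<delta> * D" using \<delta> by (simp add: D_def algebra_simps)
      finally show ?thesis using \<delta> by simp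
    qed
    \<comment> \<open>The root \<open>r\<close> may fail to be differentiable where \<open>W\<close>
      vanishes, so only its uniform continuity enters; first-order terms come from
      \<open>W = r ^ Q\<close>.\<close>
    obtain d2 where d2: "d2 > 0" "\<And>x y. norm (x - y) < d2 \<Longrightarrow> norm (r x - r y) < \<delta> / 2"
    proof -
      have "\<delta> / 2 > 0" using \<delta> by simp
      from compact_support_uniform[OF rc rz this] that show thesis by metis
    qed
    define \<epsilon> where "\<epsilon> = min (min 1 d1) (min d2 (\<delta> * la / 2))"
    have \<epsilon>: "\<epsilon> > 0" "\<epsilon> \<le> 1" "\<epsilon> \<le> d1" "\<epsilon> \<le> d2" "\<epsilon> \<le> \<delta> * la / 2" using d1 d2 \<delta> la by (auto simp: \<epsilon>_def)
    \<comment> \<open>A point of the \<open>\<epsilon>\<close>-neighbourhood over \<open>w\<close>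
      comes from a point of the body over \<open>w1 = w - u\<close> by a displacement
      \<open>(y, u)\<close>. Up to the scale \<open>la\<close>, the \<open>Q\<close>-th power of its
      radius exceeds \<open>W w\<close> by at most
      \<open>\<epsilon> * (S w + \<eta>)\<close>.\<close>
    have pt: "norm x ^ Q \<le> la ^ Q * (W w + \<epsilon> * (S w + \<eta>)) \<and> w \<in> B" if "(x, w) \<in> sumset E (ball 0 \<epsilon>)" for x w
    proof -
      obtain x1 w1 y u where xw: "norm x1 < la * r w1" "norm (y, u) < \<epsilon>" "x = x1 + y" "w = w1 + u"
      proof -
        obtain z1 z2 where z: "z1 \<in> E" "z2 \<in> ball 0 \<epsilon>" "(x, w) = z1 + z2"
          using \<open>(x, w) \<in> sumset E (ball 0 \<epsilon>)\<close> unfolding sumset_def by auto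
        show thesis
          by (rule that[of "fst z1" "snd z1" "fst z2" "snd z2"])
             (use z in \<open>auto simp: E_def prod_eq_iff\<close>)
      qed
      have yu: "(norm y)\<^sup>2 + (norm u)\<^sup>2 \<le> \<epsilon>\<^sup>2"
      proof -
        have "(norm (y, u))\<^sup>2 \<le> \<epsilon>\<^sup>2" using xw(2) by (intro power_mono) auto
        then show ?thesis by (simp add: norm_Pair)
      qed
      have u: "norm u < \<epsilon>" "norm y < \<epsilon>" using xw(2) norm_snd_le[of u y] norm_fst_le[of y u] by linarith+
      have "norm w1 \<le> R" using rz[of w1] xw(1) by (metis linorder_not_le mult_zero_right norm_not_less_zero)
      then have wB: "w \<in> B" using u \<epsilon> norm_triangle_ineq[of w1 u] by (simp add: B_def xw)
      have w1: "w1 = w + - u" by (simp add: xw)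
      have W1: "W w1 \<le> W w + norm (G w) * norm u + \<eta>1 * \<epsilon>"
      proof -
        have "\<bar>W (w + - u) - W w - G w \<bullet> (- u)\<bar> \<le> \<eta>1 * norm (- u)" using u \<epsilon> by (intro d1(2)) simp
        then have "W w1 \<le> W w + \<bar>G w \<bullet> u\<bar> + \<eta>1 * norm u" unfolding w1 by simp
        moreover have "\<eta>1 * norm u \<le> \<eta>1 * \<epsilon>" using u \<eta>1 by (intro mult_left_mono) auto
        ultimately show ?thesis using Cauchy_Schwarz_ineq2[of "G w" u] by linarith
      qed
      define z where "z = norm y / la"
      have z: "z \<ge> 0" "z \<le> \<delta> / 2"
      proof -
        show "z \<ge> 0" using la by (simp add: z_def)
        have "norm y \<le> \<delta> / 2 * la" using u \<epsilon> by simp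
        then show "z \<le> \<delta> / 2" using la by (simp add: z_def pos_divide_le_eq)
      qed
      have r1: "r w1 + z \<le> r w + \<delta>"
      proof -
        have "norm (r w1 - r w) < \<delta> / 2" using u \<epsilon> by (intro d2(2)) (simp add: xw)
        then show ?thesis using z(2) unfolding real_norm_def by linarith
      qed
      have "(r w1 + z) ^ Q \<le> r w1 ^ Q + real Q * z * (r w1 + z) ^ m"
        unfolding m_def using r0 z by (intro power_add_bounds) auto
      also have "\<dots> = W w1 + c * norm y * (r w1 + z) ^ m"
        using c Q by (simp add: rQ z_def la_def)
      also have "\<dots> \<le> W w1 + c * norm y * (r w ^ m + \<eta>1)"
      proof -
        have "(r w1 + z) ^ m \<le> (r w + \<delta>) ^ m" using r1 r0[of w1] z by (intro power_mono) auto
        also have "\<dots> \<le> r w ^ m + \<eta>1" using r0[of w] Bd(2)[of w] by (intro pw) auto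
        finally show ?thesis using c by (intro add_left_mono mult_left_mono) auto
      qed
      also have "\<dots> \<le> W w + (norm (G w) * norm u + (c * r w ^ m) * norm y) + (\<eta>1 + c * \<eta>1) * \<epsilon>"
      proof -
        have "c * \<eta>1 * norm y \<le> c * \<eta>1 * \<epsilon>" using u \<eta>1 c by (intro mult_left_mono) auto
        then show ?thesis using W1 by (simp add: algebra_simps)
      qed
      \<comment> \<open>Cauchy-Schwarz in the plane for \<open>(norm (G w), c * r w ^ m)\<close> and
        \<open>(norm u, norm y)\<close>: the first norm is the square root \<open>S w\<close>, the
        second is at most \<open>\<epsilon>\<close>.\<close>
      also have "norm (G w) * norm u + (c * r w ^ m) * norm y \<le> \<epsilon> * S w"
      proof -
        have "((norm (G w), c * r w ^ m) \<bullet> (norm u, norm y)) \<le> norm (norm (G w), c * r w ^ m) * norm (norm u, norm y)"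
          by (rule norm_cauchy_schwarz)
        also have "norm (norm (G w), c * r w ^ m) = S w" by (simp add: norm_Pair S_def m_def add.commute)
        also have "S w * norm (norm u, norm y) \<le> S w * \<epsilon>"
          using yu \<epsilon> S0 by (intro mult_left_mono) (auto simp: norm_Pair add.commute intro!: real_le_lsqrt)
        finally show ?thesis by (simp add: mult.commute)
      qed
      finally have fin: "(r w1 + z) ^ Q \<le> W w + \<epsilon> * (S w + \<eta>)" unfolding \<eta>1(2) by (simp add: algebra_simps)
      have "norm x \<le> la * (r w1 + z)"
      proof -
        have "la * z = norm y" using la by (simp add: z_def)
        then have "la * (r w1 + z) = la * r w1 + norm y" by (simp add: distrib_left)
        then show ?thesis using xw(1) norm_triangle_ineq[of x1 y] unfolding xw(3) by linarith
      qed
      then have "norm x ^ Q \<le> (la * (r w1 + z)) ^ Q" by (intro power_mono) auto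
      also have "\<dots> \<le> la ^ Q * (W w + \<epsilon> * (S w + \<eta>))"
        unfolding power_mult_distrib using fin la by (intro mult_left_mono) auto
      finally show ?thesis using wB by simp
    qed
    define T where "T = sumset E (ball 0 \<epsilon>)"
    have To: "open T" "bounded T" using Eo Eb by (auto simp: T_def intro!: open_sumset bounded_sumset)
    have iB: "integrable lborel (\<lambda>w. A * (W w + \<epsilon> * S w) + A * \<epsilon> * \<eta> * indicator B w)"
      using int B by (auto simp: integrable_real_indicator)
    have nnB: "0 \<le> A * (W w + \<epsilon> * S w) + A * \<epsilon> * \<eta> * indicator B w" for w
      using A W(2)[of w] S0[of w] \<epsilon> \<eta> by simp
    have "emeasure lborel T = (\<integral>\<^sup>+w. emeasure lborel ((\<lambda>x. (x, w)) -` T) \<partial>lborel)"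
      unfolding lborel_prod[symmetric] using To by (intro lborel_pair.emeasure_pair_measure_alt2) (simp only: lborel_prod sets_lborel borel_open)
    also have "\<dots> \<le> (\<integral>\<^sup>+w. ennreal (A * (W w + \<epsilon> * S w) + A * \<epsilon> * \<eta> * indicator B w) \<partial>lborel)"
    proof (intro nn_integral_mono)
      fix w
      show "emeasure lborel ((\<lambda>x. (x, w)) -` T) \<le> ennreal (A * (W w + \<epsilon> * S w) + A * \<epsilon> * \<eta> * indicator B w)"
      proof (cases "w \<in> B")
        case True
        have "emeasure lborel ((\<lambda>x. (x, w)) -` T) \<le> ennreal (A * (W w + \<epsilon> * (S w + \<eta>)))"
          using pt W(2)[of w] S0[of w] \<epsilon> \<eta> unfolding T_def by (intro slice) auto
        then show ?thesis using True by (simp add: algebra_simps)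
      next
        case False
        then have "(\<lambda>x. (x, w)) -` T = {}" using pt unfolding T_def by blast
        then show ?thesis by simp
      qed
    qed
    also have "\<dots> = ennreal (LBINT w. A * (W w + \<epsilon> * S w) + A * \<epsilon> * \<eta> * indicator B w)"
      using iB nnB by (intro nn_integral_eq_integral) auto
    also have "(LBINT w. A * (W w + \<epsilon> * S w) + A * \<epsilon> * \<eta> * indicator B w)
        = A * II + \<epsilon> * (A * (LBINT w. S w) + \<eta> * (A * measure lborel B))"
      using int B by (simp add: integrable_real_indicator II_def algebra_simps)
    finally have le1: "emeasure lborel T \<le> ennreal (A * II + \<epsilon> * (A * (LBINT w. S w) + \<eta> * (A * measure lborel B)))" .
    have nn: "0 \<le> A * II + \<epsilon> * (A * (LBINT w. S w) + \<eta> * (A * measure lborel B))"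
      using AI \<epsilon> A S0 \<eta> I by (intro add_nonneg_nonneg mult_nonneg_nonneg integral_nonneg) (auto simp: II_def)
    have "measure lborel T \<le> A * II + \<epsilon> * (A * (LBINT w. S w) + \<eta> * (A * measure lborel B))"
      using le1 nn unfolding measure_def by (intro enn2real_leI) auto
    \<comment> \<open>The upper and the lower bound for the volume of the neighbourhood share the
      term \<open>A * II\<close>; it cancels, and division by \<open>\<epsilon>\<close> leaves the
      claim.\<close>
    moreover have "A * II + \<epsilon> * \<kappa> \<le> measure lborel T"
      using measure_sumset_ball[OF Eo Eb Ene \<epsilon>(1) AI] mE' unfolding T_def \<kappa>_def d_def by simp
    ultimately have "\<epsilon> * \<kappa> \<le> \<epsilon> * (A * (LBINT w. S w) + \<eta> * (A * measure lborel B))" by linarith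
    then show ?thesis using \<epsilon> by simp
  qed
  have "\<kappa> \<le> A * (LBINT w. S w)"
    by (rule le_if_le_add_mult[OF main]) (use A in auto)
  then show ?thesis by (simp add: \<kappa>_def A_def \<omega>_def la_def S_def r_def II_def)
qed

section \<open>The sharp Euclidean isoperimetric inequality\<close>

text \<open>Fubini for \<open>V w * (g y * \<kappa> (w - y))\<close>: integrating out
  \<open>y\<close> or \<open>w\<close> leaves a convolution on one factor or the other. The second
  case meets the reflected kernel, whence the parity sign \<open>s\<close>.\<close>

lemma conv_duality:
  fixes V g \<kappa> :: "'b::euclidean_space \<Rightarrow> real"
  assumes V: "integrable lborel V" and g: "integrable lborel g" and \<kappa>: "\<kappa> \<in> borel_measurable borel"
    and B: "\<And>x. \<bar>\<kappa> x\<bar> \<le> B" and s: "\<And>x. \<kappa> (- x) = s * \<kappa> x"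
  shows "(LBINT w. V w * conv g \<kappa> w) = s * (LBINT y. g y * conv V \<kappa> y)"
    and "integrable lborel (\<lambda>w. V w * conv g \<kappa> w)"
proof -
  define F where "F = (\<lambda>(w, y). V w * (g y * \<kappa> (w - y)))"
  have [measurable]: "V \<in> borel_measurable borel" "g \<in> borel_measurable borel" "\<kappa> \<in> borel_measurable borel"
    using V g \<kappa> by auto
  have B0: "B \<ge> 0" using B[of 0] by (meson abs_ge_zero order_trans)
  have Fm: "F \<in> borel_measurable (lborel \<Otimes>\<^sub>M lborel)" unfolding F_def by measurable
  have ig: "integrable lborel (\<lambda>y. g y * \<kappa> (w - y))" for w
    using conv_integrable[OF g \<kappa>, of B w] B by simp
  have F: "integrable (lborel \<Otimes>\<^sub>M lborel) F"
  proof (rule lborel_pair.Fubini_integrable[OF Fm])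
    show "AE x in lborel. integrable lborel (\<lambda>y. F (x, y))"
      unfolding F_def using ig by (intro AE_I2) simp
    show "integrable lborel (\<lambda>x. LBINT y. norm (F (x, y)))"
    proof (rule Bochner_Integration.integrable_bound)
      show "integrable lborel (\<lambda>w. \<bar>V w\<bar> * (B * (LBINT y. \<bar>g y\<bar>)))" using V by auto
      show "(\<lambda>x. LBINT y. norm (F (x, y))) \<in> borel_measurable lborel"
        using Fm by measurable
      show "AE x in lborel. norm (LBINT y. norm (F (x, y))) \<le> norm (\<bar>V x\<bar> * (B * (LBINT y. \<bar>g y\<bar>)))"
      proof (intro AE_I2)
        fix x
        have "(LBINT y. norm (F (x, y))) \<le> (LBINT y. \<bar>V x\<bar> * (B * \<bar>g y\<bar>))"
        proof (rule integral_mono)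
          show "integrable lborel (\<lambda>y. norm (F (x, y)))" unfolding F_def using ig[of x] by simp
          show "norm (F (x, y)) \<le> \<bar>V x\<bar> * (B * \<bar>g y\<bar>)" for y
            unfolding F_def by (simp add: abs_mult mult.commute[of B] mult_left_mono B)
        qed (use g in auto)
        then show "norm (LBINT y. norm (F (x, y))) \<le> norm (\<bar>V x\<bar> * (B * (LBINT y. \<bar>g y\<bar>)))"
          using B0 by (simp add: abs_mult)
      qed
    qed
  qed
  have w: "(LBINT y. F (w, y)) = V w * conv g \<kappa> w" for w
    by (simp add: F_def conv_def)
  have y: "(LBINT w. F (w, y)) = s * (g y * conv V \<kappa> y)" for y
  proof -
    have "F (w, y) = s * (g y * (V w * \<kappa> (y - w)))" for w using s[of "y - w"] by (simp add: F_def)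
    then show ?thesis by (simp add: conv_def)
  qed
  show "integrable lborel (\<lambda>w. V w * conv g \<kappa> w)"
    using lborel_pair.integrable_fst'[OF F] by (simp add: w)
  show "(LBINT w. V w * conv g \<kappa> w) = s * (LBINT y. g y * conv V \<kappa> y)"
    using lborel_pair.integral_fst'[OF F] lborel_pair.integral_snd[of "\<lambda>w y. F (w, y)"] F by (simp add: w y)
qed

lemma conv_inner:
  fixes g :: "'b::euclidean_space \<Rightarrow> real" and K :: "'b \<Rightarrow> 'b"
  assumes "integrable lborel g" "K \<in> borel_measurable borel" "\<And>x. norm (K x) \<le> B"
  shows "conv g K w \<bullet> v = conv g (\<lambda>x. K x \<bullet> v) w"
  unfolding conv_def using integral_inner_left[of v, OF conv_integrable[OF assms, of w]] by simp

text \<open>Integration by parts without a derivative of \<open>V\<close>: the gradient of the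
  mollifier is odd, so it passes from \<open>g\<close> to \<open>V\<close> with a minus
  sign.\<close>

lemma conv_gradient_duality:
  fixes V g :: "'b::euclidean_space \<Rightarrow> real"
  assumes V: "integrable lborel V" and g: "integrable lborel g" and k: "mollifier \<epsilon> k K"
  shows "(LBINT w. V w * (conv g K w \<bullet> v)) = - (LBINT y. g y * (conv V K y \<bullet> v))"
    and "integrable lborel (\<lambda>w. V w * (conv g K w \<bullet> v))"
proof -
  obtain B where B: "B > 0" "\<And>x. norm (K x) \<le> B" using mollifier_bounded[OF k] by metis
  have m[measurable]: "K \<in> borel_measurable borel" using mollifierD[OF k] by simp
  have b: "\<bar>K x \<bullet> v\<bar> \<le> B * norm v" for x
    using Cauchy_Schwarz_ineq2[of "K x" v] B(2)[of x] by (meson mult_right_mono norm_ge_zero order_trans)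
  have o: "K (- x) \<bullet> v = -1 * (K x \<bullet> v)" for x using mollifierD(5)[OF k, of x] by simp
  have m2: "(\<lambda>x. K x \<bullet> v) \<in> borel_measurable borel" by measurable
  note d = conv_duality[where \<kappa>="\<lambda>x. K x \<bullet> v", OF V g m2 b o]
  show "(LBINT w. V w * (conv g K w \<bullet> v)) = - (LBINT y. g y * (conv V K y \<bullet> v))"
    using d(1) by (simp add: conv_inner[OF V m B(2)] conv_inner[OF g m B(2)])
  show "integrable lborel (\<lambda>w. V w * (conv g K w \<bullet> v))"
    using d(2) by (simp add: conv_inner[OF g m B(2)])
qed

text \<open>Averages of vectors of the unit ball stay in it. The average \<open>v\<close> is tested
  against itself: \<open>N\<^sup>2\<close> is an average of inner products of \<open>v\<close> with
  such vectors, hence at most \<open>N\<close>.\<close>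

lemma conv_unit_ball:
  fixes b :: "'i \<Rightarrow> 'b::euclidean_space \<Rightarrow> real"
  assumes fin: "finite I" and b: "\<And>i. i \<in> I \<Longrightarrow> integrable lborel (b i)" and le: "\<And>y. (\<Sum>i\<in>I. (b i y)\<^sup>2) \<le> 1"
    and k: "mollifier \<epsilon> k K"
  shows "(\<Sum>i\<in>I. (conv (b i) k x)\<^sup>2) \<le> 1"
proof -
  note km = mollifierD[OF k]
  obtain B where B: "\<And>x. \<bar>k x\<bar> \<le> B" using mollifier_bounded[OF k] by metis
  define v where "v i = conv (b i) k x" for i
  define N where "N = L2_set v I"
  have ib: "integrable lborel (\<lambda>y. b i y * k (x - y))" if "i \<in> I" for i
    using conv_integrable[OF b[OF that] km(8), of B x] B by simp
  have ik: "integrable lborel (\<lambda>y. k (x - y))" "(LBINT y. k (x - y)) = 1"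
    using lborel_reflection[OF km(8), of x] km by auto
  have "N\<^sup>2 = (\<Sum>i\<in>I. (v i)\<^sup>2)" by (simp add: N_def L2_set_def sum_nonneg)
  also have "\<dots> = (\<Sum>i\<in>I. v i * (LBINT y. b i y * k (x - y)))"
    by (simp add: v_def conv_def power2_eq_square)
  also have "\<dots> = (LBINT y. (\<Sum>i\<in>I. v i * (b i y * k (x - y))))"
    using ib by (subst Bochner_Integration.integral_sum) auto
  also have "\<dots> \<le> (LBINT y. N * k (x - y))"
  proof (rule integral_mono)
    show "integrable lborel (\<lambda>y. \<Sum>i\<in>I. v i * (b i y * k (x - y)))" using ib by auto
    show "integrable lborel (\<lambda>y. N * k (x - y))" using ik by auto
    fix y
    have "(\<Sum>i\<in>I. v i * b i y) \<le> (\<Sum>i\<in>I. \<bar>v i\<bar> * \<bar>b i y\<bar>)"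
      by (intro sum_mono) (simp flip: abs_mult)
    also have "\<dots> \<le> N * L2_set (\<lambda>i. b i y) I" unfolding N_def by (rule L2_set_mult_ineq)
    also have "\<dots> \<le> N * 1" using le[of y] by (intro mult_left_mono) (auto simp: L2_set_def N_def sum_nonneg)
    finally have "(\<Sum>i\<in>I. v i * b i y) * k (x - y) \<le> N * k (x - y)" using km(2) by (intro mult_right_mono) auto
    moreover have "(\<Sum>i\<in>I. v i * (b i y * k (x - y))) = (\<Sum>i\<in>I. v i * b i y) * k (x - y)"
      by (simp add: sum_distrib_right mult.assoc)
    ultimately show "(\<Sum>i\<in>I. v i * (b i y * k (x - y))) \<le> N * k (x - y)" by simp
  qed
  also have "\<dots> = N" using ik by simp
  finally have "N * N \<le> N * 1" by (simp add: power2_eq_square)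
  moreover have "N \<ge> 0" by (simp add: N_def L2_set_nonneg)
  ultimately have "N \<le> 1" by (cases "N = 0") (auto simp: mult_le_cancel_left)
  then have "N\<^sup>2 \<le> 1" using \<open>N \<ge> 0\<close> by (simp add: power_le_one)
  then show ?thesis by (simp add: N_def L2_set_def sum_nonneg v_def)
qed

text \<open>The radial cutoff between the radii 1 and 2, scaled by \<open>r\<close>. What counts is
  that the slope decays like \<open>1 / r\<close>; the value 8/3 is rounded up to 4.\<close>

lemma cutoff_exists:
  assumes r: "r > (0::real)"
  obtains ct :: "'a::euclidean_space \<Rightarrow> real" and X where
    "C1c ct X" "\<And>x. 0 \<le> ct x \<and> ct x \<le> 1" "\<And>x. norm x \<le> r \<Longrightarrow> ct x = 1" "\<And>x. norm x \<ge> 2 * r \<Longrightarrow> ct x = 0"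
    "\<And>x. norm (X x) \<le> 4 / r"
proof -
  have "2 > (1::real)" by simp
  from radial_cutoff_exists[OF this]
  obtain \<eta> :: "'a \<Rightarrow> real" and s where e: "C1c \<eta> (\<lambda>x. - (s x *\<^sub>R x))" "\<And>x. 0 \<le> \<eta> x \<and> \<eta> x \<le> 1"
    "\<And>x. norm x \<le> 1 \<Longrightarrow> \<eta> x = 1" "\<And>x. norm x \<ge> 2 \<Longrightarrow> \<eta> x = 0"
    "\<And>x. 0 \<le> s x \<and> s x \<le> 2 * 2 / (2\<^sup>2 - 1)" "\<And>x. norm x < 1 \<or> norm x > 2 \<Longrightarrow> s x = 0"
    by blast
  define ct where "ct x = \<eta> ((1 / r) *\<^sub>R x)" for x :: 'a
  define X where "X x = (1 / r) *\<^sub>R - (s ((1 / r) *\<^sub>R x) *\<^sub>R ((1 / r) *\<^sub>R x))" for x :: 'a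
  have z: "ct x = 0" if "norm x \<ge> 2 * r" for x
    unfolding ct_def using that r by (intro e(4)) (simp add: field_simps)
  have "C1 ct X"
    unfolding C1_def
  proof (intro conjI allI)
    fix x :: 'a
    have "(\<eta> has_derivative (\<bullet>) (- (s y *\<^sub>R y))) (at y)" for y using e(1) unfolding C1c_def C1_def by blast
    moreover have "((\<lambda>x. (1 / r) *\<^sub>R x) has_derivative (\<lambda>h. (1 / r) *\<^sub>R h)) (at x)"
      by (auto intro!: derivative_eq_intros)
    ultimately have "((\<lambda>x. \<eta> ((1 / r) *\<^sub>R x)) has_derivative (\<lambda>h. - (s ((1 / r) *\<^sub>R x) *\<^sub>R ((1 / r) *\<^sub>R x)) \<bullet> ((1 / r) *\<^sub>R h))) (at x)"
      by (rule has_derivative_compose[rotated])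
    moreover have "(\<lambda>h. - (s ((1 / r) *\<^sub>R x) *\<^sub>R ((1 / r) *\<^sub>R x)) \<bullet> ((1 / r) *\<^sub>R h)) = (\<bullet>) (X x)"
      by (auto simp: X_def)
    ultimately show "(ct has_derivative (\<bullet>) (X x)) (at x)" by (simp add: ct_def[abs_def])
  next
    have "continuous_on UNIV (\<lambda>y. - (s y *\<^sub>R y))" using e(1) by (simp add: C1c_def C1_def)
    then have "continuous_on UNIV (\<lambda>x. - (s ((1 / r) *\<^sub>R x) *\<^sub>R ((1 / r) *\<^sub>R x)))"
      by (rule continuous_on_compose2) (auto intro!: continuous_intros)
    then show "continuous_on UNIV X" unfolding X_def by (intro continuous_on_scaleR[OF continuous_on_const])
  qed
  moreover have "bounded {x. ct x \<noteq> 0}"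
    unfolding bounded_iff using z by (meson linear mem_Collect_eq)
  ultimately have "C1c ct X" by (simp add: C1c_def)
  moreover have "norm (X x) \<le> 4 / r" for x :: 'a
  proof -
    let ?y = "(1 / r) *\<^sub>R x"
    have "norm (s ?y *\<^sub>R ?y) \<le> 4"
    proof (cases "norm ?y > 2")
      case False
      have "norm (s ?y *\<^sub>R ?y) = s ?y * norm ?y" using e(5)[of ?y] by simp
      also have "\<dots> \<le> (4 / 3) * 2" using e(5)[of ?y] False by (intro mult_mono) auto
      also have "\<dots> \<le> (4::real)" by simp
      finally show ?thesis .
    next
      case True
      then have "s ?y = 0" by (intro e(6)) simp
      then show ?thesis by simp
    qed
    then have "1 / r * norm (s ?y *\<^sub>R ?y) \<le> 1 / r * 4" using r by (intro mult_left_mono) auto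
    moreover have "norm (X x) = 1 / r * norm (s ?y *\<^sub>R ?y)"
      unfolding X_def norm_scaleR[of "1 / r"] norm_minus_cancel using r by simp
    ultimately show ?thesis by simp
  qed
  moreover have "ct x = 1" if "norm x \<le> r" for x
    unfolding ct_def using that r by (intro e(3)) (simp add: field_simps)
  ultimately show ?thesis using that[of ct X] z e(2) by (simp add: ct_def)
qed

text \<open>The test field is the mollification of the negative unit gradient field of the mollified
  indicator, cut off to a ball. By duality its pairing with \<open>E\<close> is the integral of the
  length of that gradient over the ball, so the perimeter bounds the total variation.\<close>

lemma euclid_perimeter_mollified:
  fixes E :: "(real ^ 'd::finite) set"
  assumes E: "E \<in> sets borel" "emeasure lborel E < \<infinity>" and k: "mollifier \<epsilon> k K"
    and P: "\<And>f G. (f, G) \<in> tests \<Longrightarrow> (LBINT p. indicator E p * diverg euclid_fields G p) \<le> P"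
  shows "(LBINT y. indicator (cball 0 r) y * norm (conv (indicator E) K y)) \<le> P"
proof -
  let ?E = "indicator E :: real ^ 'd \<Rightarrow> real"
  have iE: "integrable lborel ?E" using E by (intro integrable_real_indicator) auto
  define D where "D = conv ?E K"
  have "C1 (conv ?E k) D" unfolding D_def by (rule C1_conv[OF iE mollifierD(1)[OF k]])
  then have Dm[measurable]: "D \<in> borel_measurable borel" using C1_measurable(2) by blast
  \<comment> \<open>The minus sign compensates the one from duality; where \<open>D y = 0\<close>,
    division by zero gives \<open>b i y = 0\<close>.\<close>
  define b where "b i y = - (indicator (cball 0 r) y * (D y $ i / norm (D y)))" for i y
  have bb: "\<bar>b i y\<bar> \<le> indicator (cball 0 r) y" for i y
    using component_le_norm_cart[of "D y" i] by (simp add: b_def indicator_def divide_le_eq)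
  have ib: "integrable lborel (b i)" for i
  proof (rule Bochner_Integration.integrable_bound)
    show "integrable lborel (indicator (cball 0 r) :: real ^ 'd \<Rightarrow> real)"
      using emeasure_lborel_cball_finite[of "0 :: real ^ 'd" r] by (intro integrable_real_indicator) auto
    have [measurable]: "(\<lambda>x. D x $ i) \<in> borel_measurable borel"
      by (rule measurable_compose[OF Dm]) (intro borel_measurable_continuous_onI continuous_intros)
    have [measurable]: "cball (0 :: real ^ 'd) r \<in> sets borel" by simp
    show "b i \<in> borel_measurable lborel" unfolding b_def by measurable
  qed (use bb in auto)
  define f where "f i = conv (b i) k" for i
  define G where "G i = conv (b i) K" for i
  have "C1c (f i) (G i)" for i unfolding f_def G_def
  proof (rule C1c_conv[OF ib mollifierD(1)[OF k]])
    show "b i x = 0" if "norm x > r" for x using that by (simp add: b_def)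
  qed
  moreover have "(\<Sum>i\<in>UNIV. (f i p)\<^sup>2) \<le> 1" for p
    unfolding f_def
  proof (rule conv_unit_ball[OF _ ib _ k])
    fix y
    have "(\<Sum>i\<in>UNIV. (D y $ i)\<^sup>2) = (norm (D y))\<^sup>2" by (simp add: norm_vec_def L2_set_def sum_nonneg)
    then show "(\<Sum>i\<in>UNIV. (b i y)\<^sup>2) \<le> 1"
      by (simp add: b_def indicator_def power_divide flip: sum_divide_distrib)
  qed simp
  ultimately have "(f, G) \<in> tests" by (simp add: tests_def)
  from P[OF this] have "(LBINT p. ?E p * diverg euclid_fields G p) \<le> P" .
  moreover have "(LBINT p. ?E p * diverg euclid_fields G p) = (LBINT y. indicator (cball 0 r) y * norm (D y))"
  proof -
    note du = conv_gradient_duality[OF iE ib k]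
    have "(LBINT p. ?E p * diverg euclid_fields G p) = (LBINT p. (\<Sum>i\<in>UNIV. ?E p * (conv (b i) K p \<bullet> axis i 1)))"
      by (simp add: diverg_def euclid_fields_def G_def sum_distrib_left)
    also have "\<dots> = (\<Sum>i\<in>UNIV. LBINT p. ?E p * (conv (b i) K p \<bullet> axis i 1))"
      by (rule Bochner_Integration.integral_sum[OF du(2)])
    also have "\<dots> = (\<Sum>i\<in>UNIV. - (LBINT y. b i y * (D y \<bullet> axis i 1)))" unfolding du(1) D_def ..
    also have "\<dots> = (\<Sum>i\<in>UNIV. (LBINT y. - (b i y * (D y \<bullet> axis i 1))))" by simp
    also have "\<dots> = (LBINT y. (\<Sum>i\<in>UNIV. - (b i y * (D y \<bullet> axis i 1))))"
      using conv_gradient_duality(2)[OF ib iE k] unfolding D_def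
      by (intro Bochner_Integration.integral_sum[symmetric] Bochner_Integration.integrable_minus)
    also have "\<dots> = (LBINT y. indicator (cball 0 r) y * norm (D y))"
    proof (intro Bochner_Integration.integral_cong refl)
      fix y
      have "(\<Sum>i\<in>UNIV. D y $ i / norm (D y) * D y $ i) = norm (D y)"
      proof -
        have "(\<Sum>i\<in>UNIV. D y $ i / norm (D y) * D y $ i) = (\<Sum>i\<in>UNIV. (D y $ i)\<^sup>2) / norm (D y)"
          by (simp add: sum_divide_distrib power2_eq_square)
        also have "(\<Sum>i\<in>UNIV. (D y $ i)\<^sup>2) = (norm (D y))\<^sup>2" by (simp add: norm_vec_def L2_set_def sum_nonneg)
        finally show ?thesis by (simp add: power2_eq_square)
      qed
      moreover have "(\<Sum>i\<in>UNIV. - (b i y * (D y \<bullet> axis i 1))) = indicator (cball 0 r) y * (\<Sum>i\<in>UNIV. D y $ i / norm (D y) * D y $ i)"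
        unfolding sum_distrib_left by (intro sum.cong) (auto simp: b_def inner_axis)
      ultimately show "(\<Sum>i\<in>UNIV. - (b i y * (D y \<bullet> axis i 1))) = indicator (cball 0 r) y * norm (D y)"
        by simp
    qed
    finally show ?thesis .
  qed
  ultimately show ?thesis by (simp add: D_def)
qed

text \<open>The mollified indicator times a cutoff is put into the functional inequality at height
  \<open>\<tau>\<close>. Closeness in L1 keeps the superlevel set at least as large as
  \<open>a\<close>, and the gradient of the cutoff adds at most \<open>4 / r\<close> times the
  mass.\<close>

lemma euclid_isoperimetric_aux:
  fixes E :: "(real ^ 'd::finite) set"
  assumes E: "E \<in> sets borel" "emeasure lborel E < \<infinity>"
    and P: "\<And>f G. (f, G) \<in> tests \<Longrightarrow> (LBINT p. indicator E p * diverg euclid_fields G p) \<le> P"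
    and r: "r > 0" and a: "0 < a" "a < measure lborel (E \<inter> cball 0 r)" and \<tau>: "0 < \<tau>" "\<tau> < 1"
  shows "\<tau> * (CARD('d) * unit_ball_vol CARD('d) powr (1 / CARD('d)) * a powr ((real CARD('d) - 1) / CARD('d)))
     \<le> P + 4 / r * (measure lborel E + 1)"
proof -
  let ?E = "indicator E :: real ^ 'd \<Rightarrow> real"
  have iE: "integrable lborel ?E" using E by (intro integrable_real_indicator) auto
  \<comment> \<open>On the set \<open>T\<close> below, the indicator is 1 and the mollified function
    at most \<open>\<tau>\<close>, so \<open>1 - \<tau>\<close> times its measure is at most the L1
    error: the second entry limits what is lost from \<open>E \<inter> cball 0 r\<close>. The first
    keeps the mass below \<open>measure lborel E + 1\<close>.\<close>
  define e where "e = min 1 ((measure lborel (E \<inter> cball 0 r) - a) * (1 - \<tau>))"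
  have e: "e > 0" using a \<tau> by (simp add: e_def)
  obtain \<delta> where \<delta>: "\<delta> > 0" "\<forall>\<epsilon> k K. mollifier \<epsilon> k K \<longrightarrow> \<epsilon> < \<delta> \<longrightarrow>
     integrable lborel (conv ?E k) \<and> (LBINT x. \<bar>conv ?E k x - ?E x\<bar>) \<le> e"
    using conv_L1[OF iE e] by (elim exE conjE)
  obtain k and K :: "real ^ 'd \<Rightarrow> real ^ 'd" where k: "mollifier (\<delta> / 2) k K"
    using mollifier_exists[of "\<delta> / 2"] \<delta>(1) half_gt_zero by blast
  have "\<delta> / 2 < \<delta>" using \<delta>(1) by simp
  with \<delta>(2) k have C: "integrable lborel (conv ?E k)" "(LBINT x. \<bar>conv ?E k x - ?E x\<bar>) \<le> e" by blast+
  obtain ct :: "real ^ 'd \<Rightarrow> real" and X where ct: "C1c ct X" "\<And>x. 0 \<le> ct x \<and> ct x \<le> 1" "\<And>x. norm x \<le> r \<Longrightarrow> ct x = 1"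
    "\<And>x. norm x \<ge> 2 * r \<Longrightarrow> ct x = 0" "\<And>x. norm (X x) \<le> 4 / r"
    using cutoff_exists[OF r, where 'a="real ^ 'd"] by blast
  have C1: "C1 (conv ?E k) (conv ?E K)" by (rule C1_conv[OF iE mollifierD(1)[OF k]])
  note [measurable] = C1_measurable[OF C1] C1_measurable[OF C1c_C1[OF ct(1)]] E(1)
  have c0: "conv ?E k x \<ge> 0" for x
    unfolding conv_def by (intro Bochner_Integration.integral_nonneg) (simp add: mollifierD(2)[OF k])
  define f where "f x = conv ?E k x * ct x" for x
  define G where "G x = conv ?E k x *\<^sub>R X x + ct x *\<^sub>R conv ?E K x" for x
  have fG: "C1c f G" unfolding f_def G_def by (rule C1c_mult[OF C1 ct(1)])
  note [measurable] = C1_measurable[OF C1c_C1[OF fG]]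
  have f0: "f x \<ge> 0" for x using c0 ct(2) by (simp add: f_def)
  define T where "T = E \<inter> cball 0 r \<inter> {x. f x \<le> \<tau>}"
  have Tm[measurable]: "T \<in> sets borel" unfolding T_def by measurable
  have Tf: "emeasure lborel T < \<infinity>"
    using emeasure_mono[of T E lborel] E by (auto simp: T_def intro: le_less_trans)
  have "(1 - \<tau>) * measure lborel T = (LBINT x. (1 - \<tau>) * indicator T x)" by simp
  also have "\<dots> \<le> (LBINT x. \<bar>conv ?E k x - ?E x\<bar>)"
  proof (rule integral_mono)
    show "integrable lborel (\<lambda>x. (1 - \<tau>) * indicat_real T x)"
      using Tf by (intro integrable_mult_right integrable_real_indicator) auto
    show "(1 - \<tau>) * indicat_real T x \<le> \<bar>conv ?E k x - ?E x\<bar>" for x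
      using ct(3)[of x] by (auto simp: T_def f_def indicator_def)
  qed (use C iE in auto)
  also have "\<dots> \<le> (measure lborel (E \<inter> cball 0 r) - a) * (1 - \<tau>)" using C(2) by (simp add: e_def)
  finally have T: "measure lborel T \<le> measure lborel (E \<inter> cball 0 r) - a" using \<tau> by (simp add: mult.commute)
  have fin: "{x. f x > \<tau>} \<in> fmeasurable lborel"
  proof (rule fmeasurable_bounded_open)
    show "bounded {x. f x > \<tau>}" 
    proof (rule bounded_subset)
      show "bounded {x. f x \<noteq> 0}" using fG by (simp add: C1c_def)
      show "{x. f x > \<tau>} \<subseteq> {x. f x \<noteq> 0}" using \<tau> by auto
    qed
    show "open {x. f x > \<tau>}" using C1_continuous[OF C1c_C1[OF fG]] by (intro open_Collect_less) auto
  qed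
  have aa: "a \<le> measure lborel {x. f x > \<tau>}"
  proof -
    have "measure lborel (E \<inter> cball 0 r) \<le> measure lborel ({x. f x > \<tau>} \<union> T)"
    proof (rule measure_mono_fmeasurable)
      have "T \<in> fmeasurable lborel" using Tf by (intro fmeasurableI) auto
      then show "{x. f x > \<tau>} \<union> T \<in> fmeasurable lborel" using fin by auto
    qed (auto simp: T_def)
    also have "\<dots> \<le> measure lborel {x. f x > \<tau>} + measure lborel T" by (intro measure_Un_le) auto
    finally have "measure lborel (E \<inter> cball 0 r) \<le> measure lborel {x. f x > \<tau>} + measure lborel T" .
    then show ?thesis using T by linarith
  qed
  have "continuous_on UNIV (conv ?E K)" using C1 unfolding C1_def by (rule conjunct2)
  then have "continuous_on (cball 0 (2 * r)) (\<lambda>x. norm (conv ?E K x))"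
    by (intro continuous_on_norm) (rule continuous_on_subset[OF _ subset_UNIV])
  then have "integrable lborel (\<lambda>x. indicator (cball 0 (2 * r)) x *\<^sub>R norm (conv ?E K x))"
    by (rule borel_integrable_compact[OF compact_cball])
  then have iN: "integrable lborel (\<lambda>x. indicator (cball 0 (2 * r)) x * norm (conv ?E K x))" by simp
  from C1c_isoperimetric[OF fG f0 \<tau>(1) a(1) aa]
  have "\<tau> * (CARD('d) * unit_ball_vol CARD('d) powr (1 / CARD('d)) * a powr ((real CARD('d) - 1) / CARD('d))) \<le> (LBINT x. norm (G x))"
    by simp
  also have "\<dots> \<le> (LBINT x. 4 / r * conv ?E k x + indicator (cball 0 (2 * r)) x * norm (conv ?E K x))"
  proof (rule integral_mono)
    show "integrable lborel (\<lambda>x. 4 / r * conv ?E k x + indicator (cball 0 (2 * r)) x * norm (conv ?E K x))"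
      using C(1) iN by simp
    show "norm (G x) \<le> 4 / r * conv ?E k x + indicator (cball 0 (2 * r)) x * norm (conv ?E K x)" for x
    proof -
      have "norm (G x) \<le> conv ?E k x * norm (X x) + ct x * norm (conv ?E K x)"
        unfolding G_def using c0[of x] ct(2)[of x] by (intro norm_triangle_le) simp
      also have "conv ?E k x * norm (X x) \<le> conv ?E k x * (4 / r)" using c0 ct(5) by (intro mult_left_mono)
      also have "ct x * norm (conv ?E K x) \<le> indicator (cball 0 (2 * r)) x * norm (conv ?E K x)"
        using ct(2,4)[of x] by (intro mult_right_mono) (auto simp: indicator_def)
      finally show ?thesis by (simp add: mult.commute)
    qed
  qed (use C1c_integrable[OF fG] in auto)
  also have "\<dots> = 4 / r * (LBINT x. conv ?E k x) + (LBINT x. indicator (cball 0 (2 * r)) x * norm (conv ?E K x))"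
    using C(1) iN by simp
  also have "\<dots> \<le> 4 / r * (measure lborel E + 1) + P"
  proof (intro add_mono mult_left_mono)
    show "(LBINT x. indicator (cball 0 (2 * r)) x * norm (conv ?E K x)) \<le> P"
      by (rule euclid_perimeter_mollified[OF E k P])
    have "(LBINT x. conv ?E k x) = (LBINT x. ?E x) + (LBINT x. conv ?E k x - ?E x)"
      using C(1) iE by simp
    also have "(LBINT x. conv ?E k x - ?E x) \<le> (LBINT x. \<bar>conv ?E k x - ?E x\<bar>)"
      using C(1) iE by (intro integral_mono) auto
    finally show "(LBINT x. conv ?E k x) \<le> measure lborel E + 1" using C(2) by (simp add: e_def)
  qed (use r in auto)
  finally show ?thesis by simp
qed

lemma measure_Int_cball_tendsto:
  fixes E :: "'a::euclidean_space set"
  assumes "E \<in> sets borel" "emeasure lborel E < \<infinity>"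
  shows "(\<lambda>n. measure lborel (E \<inter> cball 0 (real n))) \<longlonglongrightarrow> measure lborel E"
proof -
  have "(\<lambda>n. measure lborel (E \<inter> cball 0 (real n))) \<longlonglongrightarrow> measure lborel (\<Union>n. E \<inter> cball 0 (real n))"
  proof (rule Lim_measure_incseq)
    have "emeasure lborel (\<Union>n. E \<inter> cball 0 (real n)) \<le> emeasure lborel E"
      using assms by (intro emeasure_mono) auto
    then show "emeasure lborel (\<Union>n. E \<inter> cball 0 (real n)) \<noteq> \<infinity>" using assms by (auto simp: top_unique)
  qed (use assms in \<open>auto simp: incseq_def\<close>)
  moreover have "(\<Union>n. E \<inter> cball 0 (real n)) = E" using real_arch_simple by auto
  ultimately show ?thesis by simp
qed

lemma admissible_euclid:
  "admissible (euclid_fields :: 'd::finite \<Rightarrow> _) CARD('d) (CARD('d) * unit_ball_vol CARD('d) powr (1 / CARD('d)))"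
  unfolding admissible_def
proof
  fix E :: "(real ^ 'd) set" assume E: "E \<in> lmeasurable"
  define \<kappa> where "\<kappa> = CARD('d) * unit_ball_vol CARD('d) powr (1 / CARD('d))"
  define p where "p = (real CARD('d) - 1) / real CARD('d)"
  obtain F where F: "F \<in> sets borel" "emeasure lborel F < \<infinity>" "measure lborel F = measure lebesgue E"
    "AE x in lebesgue. x \<in> E \<longleftrightarrow> x \<in> F" by (rule lmeasurable_borel_rep[OF E])
  have eq: "perimeter euclid_fields E = (SUP (f, G)\<in>tests. ereal (LBINT p. indicator F p * diverg euclid_fields G p))"
    by (rule perimeter_SUP[OF _ F(1,4) shear_continuous[OF shear_euclid_fields]]) (use E in auto)
  have "ereal (\<kappa> * measure lborel F powr p) \<le> perimeter euclid_fields E"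
  proof (cases "measure lborel F = 0 \<or> perimeter euclid_fields E = \<infinity>")
    case True
    then show ?thesis using perimeter_nonneg[of euclid_fields E] by (auto simp: zero_ereal_def)
  next
    case False
    then obtain P where P: "perimeter euclid_fields E = ereal P"
      using perimeter_nonneg[of euclid_fields E] by (cases "perimeter euclid_fields E") auto
    define M where "M = measure lborel F"
    have M: "M > 0" using False by (simp add: M_def zero_less_measure_iff)
    have le: "(LBINT p. indicator F p * diverg euclid_fields G p) \<le> P" if "(f, G) \<in> tests" for f and G :: "'d \<Rightarrow> real ^ 'd \<Rightarrow> real ^ 'd"
    proof -
      have "ereal (LBINT p. indicator F p * diverg euclid_fields G p) \<le> perimeter euclid_fields E"
        unfolding eq using that by (auto intro: SUP_upper2)
      then show ?thesis by (simp add: P)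
    qed
    \<comment> \<open>One factor \<open>s\<close> is the height \<open>\<tau>\<close>, the other the
      fraction of the volume found in a large ball; both disappear as \<open>s\<close> tends to
      1.\<close>
    have s: "s * (\<kappa> * (s * M) powr p) \<le> P" if s: "0 < s" "s < 1" for s
    proof (rule tendsto_lowerbound)
      show "(\<lambda>n. P + 4 / real n * (measure lborel F + 1)) \<longlonglongrightarrow> P"
      proof -
        have "(\<lambda>n. P + 4 * inverse (real n) * (measure lborel F + 1)) \<longlonglongrightarrow> P + 4 * 0 * (measure lborel F + 1)"
          by (intro tendsto_intros lim_inverse_n)
        then show ?thesis by (simp add: divide_inverse)
      qed
      have "eventually (\<lambda>n. s * M < measure lborel (F \<inter> cball 0 (real n))) sequentially"
        using measure_Int_cball_tendsto[OF F(1,2)] s M by (intro order_tendstoD(1)) (auto simp: M_def)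
      then show "eventually (\<lambda>n. s * (\<kappa> * (s * M) powr p) \<le> P + 4 / real n * (measure lborel F + 1)) sequentially"
        using eventually_gt_at_top[of 0]
      proof eventually_elim
        case (elim n)
        then show ?case
          unfolding \<kappa>_def p_def
          by (intro euclid_isoperimetric_aux[OF F(1,2) le]) (use s M in auto)
      qed
    qed auto
    have "((\<lambda>s. s * (\<kappa> * (s * M) powr p)) \<longlongrightarrow> 1 * (\<kappa> * (1 * M) powr p)) (at_left 1)"
      using M by (intro tendsto_intros) auto
    moreover have "eventually (\<lambda>s. s * (\<kappa> * (s * M) powr p) \<le> P) (at_left 1)"
      using s eventually_at_left_real[of 0 "1::real"] by (auto elim!: eventually_mono)
    ultimately have "1 * (\<kappa> * (1 * M) powr p) \<le> P" by (intro tendsto_upperbound) auto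
    then show ?thesis by (simp add: P M_def)
  qed
  then show "ereal (CARD('d) * unit_ball_vol CARD('d) powr (1 / CARD('d)) * measure lebesgue E powr ((real CARD('d) - 1) / CARD('d))) \<le> perimeter euclid_fields E"
    by (simp add: F(3) \<kappa>_def p_def)
qed

section \<open>Slicing and product test fields\<close>

text \<open>Separability in the uniform distance, with the countable set taken inside
  \<open>S\<close>: for each code satisfied by some member, one such member is kept. Two members
  satisfying the same code differ by at most twice its precision.\<close>

lemma compact_support_separable:
  fixes D :: "'s \<Rightarrow> 'a::euclidean_space \<Rightarrow> real"
  assumes D: "\<And>s. s \<in> S \<Longrightarrow> continuous_on UNIV (D s)" "\<And>s. s \<in> S \<Longrightarrow> \<exists>R. \<forall>p. norm p > R \<longrightarrow> D s p = 0"
  obtains T where "countable T" "T \<subseteq> S" "\<And>s e. s \<in> S \<Longrightarrow> e > 0 \<Longrightarrow> \<exists>t\<in>T. \<forall>p. \<bar>D s p - D t p\<bar> \<le> e"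
proof -
  obtain \<B> :: "'a set set" where \<B>: "countable \<B>" "topological_basis \<B>" using ex_countable_basis by blast
  \<comment> \<open>A code prescribes rational values, up to \<open>1/(n+1)\<close>, on finitely many basic open sets that
    cover the support.\<close>
  define codes where "codes = (UNIV :: nat set) \<times> {C. finite C \<and> C \<subseteq> \<B> \<times> (\<rat> :: real set)}"
  define sat where "sat = (\<lambda>(n :: nat, C) s. (\<forall>p. p \<notin> \<Union>(fst ` C) \<longrightarrow> D s p = 0) \<and>
    (\<forall>(U, q)\<in>C. \<forall>p\<in>U. \<bar>D s p - q\<bar> < inverse (real (Suc n))))"
  define pick where "pick c = (SOME s. s \<in> S \<and> sat c s)" for c
  define T where "T = pick ` {c \<in> codes. \<exists>s\<in>S. sat c s}"
  have pick: "pick c \<in> S \<and> sat c (pick c)" if "\<exists>s\<in>S. sat c s" for c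
    unfolding pick_def using that by (intro someI_ex[of "\<lambda>s. s \<in> S \<and> sat c s"]) blast
  have "countable (\<B> \<times> (\<rat> :: real set))" by (rule countable_SIGMA[OF \<B>(1) countable_rat])
  from countable_Collect_finite_subset[OF this]
  have "countable codes" unfolding codes_def by (rule countable_SIGMA[OF countableI_type])
  then have "countable {c \<in> codes. \<exists>s\<in>S. sat c s}" by (rule countable_subset[rotated]) blast
  then have "countable T" unfolding T_def by (rule countable_image)
  moreover have "T \<subseteq> S" unfolding T_def using pick by blast
  moreover have "\<exists>t\<in>T. \<forall>p. \<bar>D s p - D t p\<bar> \<le> e" if s: "s \<in> S" and e: "e > 0" for s e
  proof -
    obtain n where n: "inverse (real (Suc n)) < e / 2" using reals_Archimedean[of "e / 2"] e by auto
    define \<delta> where "\<delta> = inverse (real (Suc n))"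
    have \<delta>: "\<delta> > 0" by (simp add: \<delta>_def)
    obtain R where R: "\<And>p. norm p > R \<Longrightarrow> D s p = 0" using D(2)[OF s] by blast
    have "\<exists>U q. x \<in> U \<and> U \<in> \<B> \<and> q \<in> \<rat> \<and> (\<forall>p\<in>U. \<bar>D s p - q\<bar> < \<delta>)" for x
    proof -
      obtain q where q: "q \<in> \<rat>" "D s x - \<delta> < q" "q < D s x" using Rats_dense_in_real[of "D s x - \<delta>" "D s x"] \<delta> by auto
      have op: "open {p. \<bar>D s p - q\<bar> < \<delta>}" using D(1)[OF s] by (intro open_Collect_less continuous_intros)
      have "x \<in> {p. \<bar>D s p - q\<bar> < \<delta>}" using q by auto
      then obtain U where "U \<in> \<B>" "x \<in> U" "U \<subseteq> {p. \<bar>D s p - q\<bar> < \<delta>}"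
        using topological_basisE[OF \<B>(2) op] by metis
      then show ?thesis using q(1) by blast
    qed
    then obtain U q where Uq: "\<And>x. x \<in> U x" "\<And>x. U x \<in> \<B>" "\<And>x. q x \<in> \<rat>" "\<And>x p. p \<in> U x \<Longrightarrow> \<bar>D s p - q x\<bar> < \<delta>"
      by metis
    have Uo: "open (U x)" for x using Uq(2) \<B>(2) by (rule topological_basis_open[rotated])
    obtain F where F: "finite F" "cball 0 R \<subseteq> (\<Union>x\<in>F. U x)"
    proof (rule compactE_image[OF compact_cball, of "cball 0 R" U 0 R])
      show "cball 0 R \<subseteq> (\<Union>c\<in>cball 0 R. U c)" using Uq(1) by blast
    qed (use Uo in auto)
    define c where "c = (n, (\<lambda>x. (U x, q x)) ` F)"
    have "c \<in> codes" unfolding c_def codes_def using F(1) Uq(2,3) by auto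
    moreover have sc: "sat c s"
      unfolding sat_def c_def using F(2) Uq(4) R by (force simp: \<delta>_def not_le subset_iff)
    ultimately have "pick c \<in> T" unfolding T_def using s by blast
    moreover have "\<bar>D s p - D (pick c) p\<bar> \<le> e" for p
    proof -
      have sp: "sat c (pick c)" using pick sc s by blast
      show ?thesis
      proof (cases "\<exists>x\<in>F. p \<in> U x")
        case True
        then obtain x where x: "x \<in> F" "p \<in> U x" by blast
        have "\<bar>D s p - q x\<bar> < \<delta>" using Uq(4) x by blast
        moreover have "\<bar>D (pick c) p - q x\<bar> < \<delta>" using sp x unfolding sat_def c_def \<delta>_def by force
        ultimately show ?thesis using n unfolding \<delta>_def by linarith
      next
        case False
        then have "D s p = 0" "D (pick c) p = 0" using sc sp unfolding sat_def c_def by force+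
        then show ?thesis using e by simp
      qed
    qed
    ultimately show ?thesis by blast
  qed
  ultimately show ?thesis using that by blast
qed

lemma zero_tests: "((\<lambda>_ _. 0), (\<lambda>_ _. 0)) \<in> tests"
  unfolding tests_def using C1c_zero by simp

text \<open>A slice sees a test field only through the integral of its divergence, so uniform
  approximation of divergences is enough. Index 0 is reserved for the zero field: it makes maxima
  over initial segments nonnegative and serves slices of infinite volume.\<close>

lemma tests_dense_sequence:
  fixes X :: "'i::finite \<Rightarrow> 'a::euclidean_space \<Rightarrow> 'a"
  assumes X: "\<And>i. continuous_on UNIV (X i)"
  obtains \<psi> :: "nat \<Rightarrow> 'i \<Rightarrow> 'a \<Rightarrow> real" and \<Psi> where "\<And>n. (\<psi> n, \<Psi> n) \<in> tests" "\<And>p. diverg X (\<Psi> 0) p = 0"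
    "\<And>f G e. (f, G) \<in> tests \<Longrightarrow> e > 0 \<Longrightarrow> \<exists>n. \<forall>p. \<bar>diverg X G p - diverg X (\<Psi> n) p\<bar> \<le> e"
proof -
  obtain T :: "(('i \<Rightarrow> 'a \<Rightarrow> real) \<times> ('i \<Rightarrow> 'a \<Rightarrow> 'a)) set" where T: "countable T" "T \<subseteq> tests"
    "\<And>s e. s \<in> tests \<Longrightarrow> e > 0 \<Longrightarrow> \<exists>t\<in>T. \<forall>p. \<bar>diverg X (snd s) p - diverg X (snd t) p\<bar> \<le> e"
  proof (rule compact_support_separable[of tests "\<lambda>s. diverg X (snd s)"])
    fix s :: "('i \<Rightarrow> 'a \<Rightarrow> real) \<times> ('i \<Rightarrow> 'a \<Rightarrow> 'a)" assume "s \<in> tests"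
    then have s: "(fst s, snd s) \<in> tests" by simp
    show "continuous_on UNIV (diverg X (snd s))" by (rule continuous_diverg[OF s X])
    obtain R where "\<And>p. norm p > R \<Longrightarrow> diverg X (snd s) p = 0" by (rule diverg_bounds[where V=X, OF s X]) blast
    then show "\<exists>R. \<forall>p. norm p > R \<longrightarrow> diverg X (snd s) p = 0" by blast
  qed blast
  define z :: "('i \<Rightarrow> 'a \<Rightarrow> real) \<times> ('i \<Rightarrow> 'a \<Rightarrow> 'a)" where "z = ((\<lambda>_ _. 0), (\<lambda>_ _. 0))"
  define \<phi> where "\<phi> n = (case n of 0 \<Rightarrow> z | Suc n \<Rightarrow> from_nat_into (insert z T) n)" for n
  have z: "z \<in> tests" unfolding z_def by (rule zero_tests)
  have r: "range (from_nat_into (insert z T)) = insert z T" using T(1) by (intro range_from_nat_into) auto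
  show ?thesis
  proof (rule that[of "\<lambda>n. fst (\<phi> n)" "\<lambda>n. snd (\<phi> n)"])
    have "insert z T \<subseteq> tests" using T(2) z by simp
    then have "from_nat_into (insert z T) n \<in> tests" for n
      by (rule subsetD) (rule from_nat_into, simp)
    then show "(fst (\<phi> n), snd (\<phi> n)) \<in> tests" for n
      using z by (cases n) (auto simp: \<phi>_def)
    show "diverg X (snd (\<phi> 0)) p = 0" for p by (simp add: \<phi>_def z_def diverg_def)
    show "\<exists>n. \<forall>p. \<bar>diverg X G p - diverg X (snd (\<phi> n)) p\<bar> \<le> e" if fG: "(f, G) \<in> tests" and e: "e > 0" for f G e
    proof -
      obtain t where t: "t \<in> T" "\<forall>p. \<bar>diverg X G p - diverg X (snd t) p\<bar> \<le> e" using T(3)[OF fG e] by auto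
      then obtain n where "from_nat_into (insert z T) n = t" using r by (metis insertI2 rangeE)
      then have "\<phi> (Suc n) = t" by (simp add: \<phi>_def)
      then show ?thesis using t(2) by metis
    qed
  qed
qed

section \<open>Test fields on a product\<close>

text \<open>\<open>heis_prod_fields\<close> with arbitrary \<open>X\<close> on the first factor: the
  passage to the product relies on continuity and on an admissible constant of \<open>X\<close>, not
  on the Heisenberg structure.\<close>

fun prod_fields :: "('i \<Rightarrow> 'a \<Rightarrow> 'a) \<Rightarrow> 'i + 'k \<Rightarrow> 'a::real_vector \<times> (real ^ 'k) \<Rightarrow> 'a \<times> (real ^ 'k)" where
  "prod_fields X (Inl i) (p, w) = (X i p, 0)"
| "prod_fields X (Inr j) (p, w) = (0, axis j 1)"

lemma heis_prod_fields_eq: "heis_prod_fields = prod_fields heis_fields"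
proof (intro ext)
  fix i :: "('a + 'a) + 'b" and z :: "'a heis \<times> (real ^ 'b)"
  show "heis_prod_fields i z = prod_fields heis_fields i z" by (cases i; cases z) auto
qed

text \<open>For \<open>u = 1\<close> this is the volume \<open>V w\<close> of the slice; for the
  divergence of a test field it is the lower bound which that field gives for the perimeter of the
  slice.\<close>

definition slice_int :: "('a::euclidean_space \<times> 'b::euclidean_space) set \<Rightarrow> ('a \<Rightarrow> real) \<Rightarrow> 'b \<Rightarrow> real" where
  "slice_int E u w = (LBINT p. indicator E (p, w) * u p)"

lemma slice_int_integral:
  fixes E :: "('a::euclidean_space \<times> 'b::euclidean_space) set"
  assumes E: "E \<in> sets borel" "emeasure lborel E < \<infinity>"
    and u[measurable]: "u \<in> borel_measurable borel" and g[measurable]: "g \<in> borel_measurable borel"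
    and B: "\<And>p. \<bar>u p\<bar> \<le> B" and C: "\<And>w. \<bar>g w\<bar> \<le> C"
  shows "integrable lborel (\<lambda>z. indicator E z * (u (fst z) * g (snd z)))"
    and "integrable lborel (\<lambda>w. g w * slice_int E u w)"
    and "(LBINT w. g w * slice_int E u w) = (LBINT z. indicator E z * (u (fst z) * g (snd z)))"
proof -
  let ?F = "\<lambda>z. indicator E z * (u (fst z) * g (snd z))"
  have [measurable]: "E \<in> sets borel" by fact
  have [measurable]: "(fst :: 'a \<times> 'b \<Rightarrow> 'a) \<in> borel_measurable borel" "(snd :: 'a \<times> 'b \<Rightarrow> 'b) \<in> borel_measurable borel"
    by (auto intro!: borel_measurable_continuous_onI continuous_intros)
  show F: "integrable lborel ?F"
  proof (rule Bochner_Integration.integrable_bound)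
    show "integrable lborel (\<lambda>z. (B * C) * indicat_real E z)"
      using E by (intro integrable_mult_right integrable_real_indicator) auto
    show "?F \<in> borel_measurable lborel" by measurable
    show "AE z in lborel. norm (?F z) \<le> norm ((B * C) * indicat_real E z)"
    proof (intro AE_I2)
      fix z
      have "\<bar>u (fst z)\<bar> * \<bar>g (snd z)\<bar> \<le> B * C"
        using B C by (intro mult_mono) (auto intro: order_trans[OF abs_ge_zero])
      moreover have "B * C \<le> \<bar>B\<bar> * \<bar>C\<bar>" by (metis abs_ge_self abs_mult)
      ultimately show "norm (?F z) \<le> norm ((B * C) * indicat_real E z)"
        by (auto simp: abs_mult indicator_def)
    qed
  qed
  have F': "integrable (lborel \<Otimes>\<^sub>M lborel) (\<lambda>(p, w). ?F (p, w))" using F by (simp add: lborel_prod split_beta')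
  have eq: "(LBINT p. ?F (p, w)) = g w * slice_int E u w" for w
    unfolding slice_int_def by (subst Bochner_Integration.integral_mult_right_zero[symmetric]) (simp add: mult_ac)
  show "integrable lborel (\<lambda>w. g w * slice_int E u w)"
    using lborel_pair.integrable_snd[OF F'] by (simp only: eq)
  show "(LBINT w. g w * slice_int E u w) = (LBINT z. ?F z)"
    using lborel_pair.integral_snd[OF F'] by (simp only: eq) (simp add: lborel_prod split_beta')
qed

lemma integrable_slice_int:
  fixes E :: "('a::euclidean_space \<times> 'b::euclidean_space) set"
  assumes E: "E \<in> sets borel" "emeasure lborel E < \<infinity>" and u: "u \<in> borel_measurable borel" "\<And>p. \<bar>u p\<bar> \<le> B"
  shows "integrable lborel (slice_int E u)"
  using slice_int_integral(2)[OF E u(1) borel_measurable_const u(2), of 1 1] by simp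

text \<open>The test field has the blocks \<open>\<Sum>m<N. \<psi> m i p * \<alpha> m w\<close> and
  \<open>ct p * \<beta> j w\<close>. As the \<open>\<alpha> m\<close> are nonnegative and each
  \<open>\<psi> m\<close> has norm at most 1, the triangle inequality bounds the first block by
  \<open>\<Sum>m<N. \<alpha> m w\<close>. The cutoff \<open>ct\<close> supplies compact support in
  \<open>p\<close>; the second block is differentiated in \<open>w\<close> alone, so
  \<open>ct\<close> can be released by dominated convergence.\<close>

lemma product_test_inequality:
  fixes E :: "('a::euclidean_space \<times> (real ^ 'k::finite)) set" and X :: "'i::finite \<Rightarrow> 'a \<Rightarrow> 'a" and N :: nat
  assumes E: "E \<in> sets borel" "emeasure lborel E < \<infinity>" and X: "\<And>i. continuous_on UNIV (X i)"
    and P: "\<And>f G. (f, G) \<in> tests \<Longrightarrow> (LBINT z. indicator E z * diverg (prod_fields X) G z) \<le> P"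
    and \<psi>: "\<And>m. m < N \<Longrightarrow> (\<psi> m, \<Psi> m) \<in> tests"
    and \<alpha>: "\<And>m. C1c (\<alpha> m) (\<alpha>' m)" "\<And>m w. \<alpha> m w \<ge> 0" and \<beta>: "\<And>j. C1c (\<beta> j) (\<beta>' j)"
    and le: "\<And>w. (\<Sum>m<N. \<alpha> m w)\<^sup>2 + (\<Sum>j\<in>UNIV. (\<beta> j w)\<^sup>2) \<le> 1"
  shows "(\<Sum>m<N. LBINT w. \<alpha> m w * slice_int E (diverg X (\<Psi> m)) w)
     + (LBINT w. (\<Sum>j\<in>UNIV. \<beta>' j w $ j) * slice_int E (\<lambda>_. 1) w) \<le> P"
proof -
  define b where "b w = (\<Sum>j\<in>UNIV. \<beta>' j w $ j)" for w
  have bc: "continuous_on UNIV b"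
    unfolding b_def by (intro continuous_intros) (use \<beta> in \<open>auto simp: C1c_def C1_def\<close>)
  have "\<exists>R. \<forall>w. norm w > R \<longrightarrow> \<beta>' j w = 0" for j using C1c_support[OF \<beta>[of j]] by metis
  then obtain Rj where Rj: "\<And>j w. norm w > Rj j \<Longrightarrow> \<beta>' j w = 0" by metis
  have b0: "b w = 0" if "norm w > (\<Sum>j\<in>UNIV. \<bar>Rj j\<bar>)" for w
  proof -
    have "Rj j \<le> (\<Sum>j\<in>UNIV. \<bar>Rj j\<bar>)" for j
      using member_le_sum[of j UNIV "\<lambda>j. \<bar>Rj j\<bar>"] by force
    then have "\<beta>' j w = 0" for j using Rj[of j w] that by (meson le_less_trans)
    then show ?thesis by (simp add: b_def)
  qed
  obtain Bb where Bb: "Bb > 0" "\<And>w. norm (b w) \<le> Bb" using compact_support_bounded[OF bc b0] by metis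
  have bm[measurable]: "b \<in> borel_measurable borel" by (rule borel_measurable_continuous_onI[OF bc])
  have \<alpha>b: "\<exists>B. \<forall>w. \<bar>\<alpha> m w\<bar> \<le> B" for m
  proof -
    obtain R where R: "\<And>w. norm w > R \<Longrightarrow> \<alpha> m w = 0" using C1c_support[OF \<alpha>(1)] by metis
    show ?thesis using compact_support_bounded[OF C1_continuous[OF C1c_C1[OF \<alpha>(1)]] R] by (metis real_norm_def)
  qed
  have \<alpha>m: "\<alpha> m \<in> borel_measurable borel" for m using C1_measurable(1)[OF C1c_C1[OF \<alpha>(1)]] .
  have dm: "diverg X (\<Psi> m) \<in> borel_measurable borel" "\<exists>B. \<forall>p. \<bar>diverg X (\<Psi> m) p\<bar> \<le> B" if m: "m < N" for m
  proof -
    obtain B where "diverg X (\<Psi> m) \<in> borel_measurable borel" "\<And>p. \<bar>diverg X (\<Psi> m) p\<bar> \<le> B"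
      by (rule diverg_bounds[where V=X, OF \<psi>[OF m] X]) blast
    then show "diverg X (\<Psi> m) \<in> borel_measurable borel" "\<exists>B. \<forall>p. \<bar>diverg X (\<Psi> m) p\<bar> \<le> B" by blast+
  qed
  define S1 where "S1 = (\<Sum>m<N. LBINT w. \<alpha> m w * slice_int E (diverg X (\<Psi> m)) w)"
  have s1: "integrable lborel (\<lambda>z. indicator E z * (diverg X (\<Psi> m) (fst z) * \<alpha> m (snd z)))"
    "(LBINT w. \<alpha> m w * slice_int E (diverg X (\<Psi> m)) w) = (LBINT z. indicator E z * (diverg X (\<Psi> m) (fst z) * \<alpha> m (snd z)))"
    if m: "m < N" for m
  proof -
    obtain B where B: "\<And>p. \<bar>diverg X (\<Psi> m) p\<bar> \<le> B" using dm(2)[OF m] by blast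
    obtain C where C: "\<And>w. \<bar>\<alpha> m w\<bar> \<le> C" using \<alpha>b by blast
    note s = slice_int_integral[OF E dm(1)[OF m] \<alpha>m B C]
    show "integrable lborel (\<lambda>z. indicator E z * (diverg X (\<Psi> m) (fst z) * \<alpha> m (snd z)))" by (rule s(1))
    show "(LBINT w. \<alpha> m w * slice_int E (diverg X (\<Psi> m)) w) = (LBINT z. indicator E z * (diverg X (\<Psi> m) (fst z) * \<alpha> m (snd z)))"
      by (rule s(3))
  qed
  have key: "S1 + (LBINT z. indicator E z * (ct (fst z) * b (snd z))) \<le> P"
    if ct: "C1c ct ct'" "\<And>p. 0 \<le> ct p \<and> ct p \<le> 1" for ct :: "'a \<Rightarrow> real" and ct'
  proof -
    define f :: "'i + 'k \<Rightarrow> 'a \<times> (real ^ 'k) \<Rightarrow> real" where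
      "f = (\<lambda>s. case s of Inl i \<Rightarrow> (\<lambda>z. \<Sum>m<N. (\<lambda>(p, w). \<psi> m i p * \<alpha> m w) z) | Inr j \<Rightarrow> (\<lambda>(p, w). ct p * \<beta> j w))"
    define G :: "'i + 'k \<Rightarrow> 'a \<times> (real ^ 'k) \<Rightarrow> 'a \<times> (real ^ 'k)" where
      "G = (\<lambda>s. case s of Inl i \<Rightarrow> (\<lambda>z. \<Sum>m<N. (\<lambda>(p, w). (\<alpha> m w *\<^sub>R \<Psi> m i p, \<psi> m i p *\<^sub>R \<alpha>' m w)) z)
         | Inr j \<Rightarrow> (\<lambda>(p, w). (\<beta> j w *\<^sub>R ct' p, ct p *\<^sub>R \<beta>' j w)))"
    have \<psi>C: "C1c (\<psi> m i) (\<Psi> m i)" if "m < N" for m i using \<psi>[OF that] by (simp add: tests_def)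
    have "C1c (f s) (G s)" for s
    proof (cases s)
      case (Inl i)
      show ?thesis unfolding f_def G_def Inl sum.case
        by (intro C1c_sum C1c_tensor \<psi>C \<alpha>) auto
    next
      case (Inr j)
      show ?thesis unfolding f_def G_def Inr sum.case by (intro C1c_tensor ct \<beta>)
    qed
    moreover have "(\<Sum>s\<in>UNIV. (f s z)\<^sup>2) \<le> 1" for z
    proof -
      obtain p w where z: "z = (p, w)" by (cases z)
      have "L2_set (\<lambda>i. \<Sum>m\<in>M. \<psi> m i p * \<alpha> m w) UNIV \<le> (\<Sum>m\<in>M. \<alpha> m w)" if "M \<subseteq> {..<N}" for M
      proof -
        have "finite M" by (rule finite_subset[OF that]) simp
        then show ?thesis using that
        proof (induction M)
          case (insert m M)
          have "L2_set (\<lambda>i. \<psi> m i p) UNIV \<le> 1" using \<psi>[of m] insert by (simp add: tests_def L2_set_def)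
          then have "\<alpha> m w * L2_set (\<lambda>i. \<psi> m i p) UNIV \<le> \<alpha> m w * 1" using \<alpha>(2) by (intro mult_left_mono)
          moreover have "\<alpha> m w * L2_set (\<lambda>i. \<psi> m i p) UNIV = L2_set (\<lambda>i. \<psi> m i p * \<alpha> m w) UNIV"
            using \<alpha>(2) by (simp add: L2_set_right_distrib mult.commute)
          ultimately have "L2_set (\<lambda>i. \<psi> m i p * \<alpha> m w) UNIV \<le> \<alpha> m w" by simp
          moreover have "L2_set (\<lambda>i. \<psi> m i p * \<alpha> m w + (\<Sum>m\<in>M. \<psi> m i p * \<alpha> m w)) UNIV
             \<le> L2_set (\<lambda>i. \<psi> m i p * \<alpha> m w) UNIV + L2_set (\<lambda>i. \<Sum>m\<in>M. \<psi> m i p * \<alpha> m w) UNIV"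
            by (rule L2_set_triangle_ineq)
          ultimately show ?case using insert by simp
        qed (simp add: L2_set_def)
      qed
      from this[of "{..<N}"] have "L2_set (\<lambda>i. \<Sum>m<N. \<psi> m i p * \<alpha> m w) UNIV \<le> (\<Sum>m<N. \<alpha> m w)" by simp
      then have "(L2_set (\<lambda>i. \<Sum>m<N. \<psi> m i p * \<alpha> m w) UNIV)\<^sup>2 \<le> (\<Sum>m<N. \<alpha> m w)\<^sup>2"
        by (intro power_mono) (auto simp: L2_set_nonneg)
      then have 1: "(\<Sum>i\<in>UNIV. (f (Inl i) z)\<^sup>2) \<le> (\<Sum>m<N. \<alpha> m w)\<^sup>2"
        by (simp add: f_def z L2_set_def sum_nonneg)
      have 2: "(\<Sum>j\<in>UNIV. (f (Inr j) z)\<^sup>2) \<le> (\<Sum>j\<in>UNIV. (\<beta> j w)\<^sup>2)"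
      proof (rule sum_mono)
        fix j
        have "(ct p)\<^sup>2 \<le> 1" using ct(2)[of p] by (simp add: power_le_one)
        then have "(ct p)\<^sup>2 * (\<beta> j w)\<^sup>2 \<le> 1 * (\<beta> j w)\<^sup>2" by (intro mult_right_mono) auto
        then show "(f (Inr j) z)\<^sup>2 \<le> (\<beta> j w)\<^sup>2" by (simp add: f_def z power_mult_distrib)
      qed
      have "(\<Sum>s\<in>UNIV. (f s z)\<^sup>2) = (\<Sum>i\<in>UNIV. (f (Inl i) z)\<^sup>2) + (\<Sum>j\<in>UNIV. (f (Inr j) z)\<^sup>2)"
        by (subst UNIV_Plus_UNIV[symmetric], subst sum.Plus) auto
      then show ?thesis using 1 2 le[of w] by linarith
    qed
    ultimately have "(f, G) \<in> tests" by (simp add: tests_def)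
    from P[OF this] have leP: "(LBINT z. indicator E z * diverg (prod_fields X) G z) \<le> P" .
    have eq: "indicator E z * diverg (prod_fields X) G z
       = (\<Sum>m<N. indicator E z * (diverg X (\<Psi> m) (fst z) * \<alpha> m (snd z))) + indicator E z * (ct (fst z) * b (snd z))" for z
    proof -
      obtain p w where z: "z = (p, w)" by (cases z)
      have "diverg (prod_fields X) G z = (\<Sum>i\<in>UNIV. G (Inl i) z \<bullet> prod_fields X (Inl i) z) + (\<Sum>j\<in>UNIV. G (Inr j) z \<bullet> prod_fields X (Inr j) z)"
        unfolding diverg_def by (subst UNIV_Plus_UNIV[symmetric], subst sum.Plus) auto
      also have "(\<Sum>i\<in>UNIV. G (Inl i) z \<bullet> prod_fields X (Inl i) z) = (\<Sum>i\<in>UNIV. \<Sum>m<N. \<alpha> m w * (\<Psi> m i p \<bullet> X i p))"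
        by (simp add: G_def z inner_sum_left)
      also have "\<dots> = (\<Sum>m<N. diverg X (\<Psi> m) p * \<alpha> m w)"
        unfolding diverg_def sum_distrib_right by (subst sum.swap) (simp add: mult.commute)
      also have "(\<Sum>j\<in>UNIV. G (Inr j) z \<bullet> prod_fields X (Inr j) z) = ct p * b w"
        by (simp add: G_def z b_def sum_distrib_left inner_axis)
      finally show ?thesis by (simp add: z sum_distrib_left distrib_left)
    qed
    have ic: "integrable lborel (\<lambda>z. indicator E z * (ct (fst z) * b (snd z)))"
    proof (rule slice_int_integral(1)[OF E])
      show "ct \<in> borel_measurable borel" using C1_measurable(1)[OF C1c_C1[OF ct(1)]] .
      show "\<bar>ct p\<bar> \<le> 1" for p using ct(2)[of p] by simp
      show "\<bar>b w\<bar> \<le> Bb" for w using Bb(2)[of w] by simp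
    qed simp
    have iS: "integrable lborel (\<lambda>z. \<Sum>m<N. indicator E z * (diverg X (\<Psi> m) (fst z) * \<alpha> m (snd z)))"
      by (rule Bochner_Integration.integrable_sum) (rule s1(1), simp)
    have "(LBINT z. indicator E z * diverg (prod_fields X) G z)
        = (LBINT z. (\<Sum>m<N. indicator E z * (diverg X (\<Psi> m) (fst z) * \<alpha> m (snd z)))) + (LBINT z. indicator E z * (ct (fst z) * b (snd z)))"
      unfolding eq by (rule Bochner_Integration.integral_add[OF iS ic])
    also have "(LBINT z. (\<Sum>m<N. indicator E z * (diverg X (\<Psi> m) (fst z) * \<alpha> m (snd z))))
        = (\<Sum>m<N. LBINT z. indicator E z * (diverg X (\<Psi> m) (fst z) * \<alpha> m (snd z)))"
      by (rule Bochner_Integration.integral_sum) (rule s1(1), simp)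
    also have "\<dots> = S1" unfolding S1_def by (rule sum.cong[OF refl]) (rule s1(2)[symmetric], simp)
    finally show ?thesis using leP by simp
  qed
  have "\<exists>c :: ('a \<Rightarrow> real) \<times> ('a \<Rightarrow> 'a). C1c (fst c) (snd c) \<and> (\<forall>p. 0 \<le> fst c p \<and> fst c p \<le> 1) \<and> (\<forall>p. norm p \<le> real (Suc n) \<longrightarrow> fst c p = 1)"
    for n :: nat
  proof -
    have "real (Suc n) > 0" by simp
    then show ?thesis
    proof (rule cutoff_exists[where 'a='a])
      fix ct :: "'a \<Rightarrow> real" and ct'
      assume "C1c ct ct'" "\<And>x. 0 \<le> ct x \<and> ct x \<le> 1" "\<And>x. norm x \<le> real (Suc n) \<Longrightarrow> ct x = 1"
      then show ?thesis by (intro exI[of _ "(ct, ct')"]) auto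
    qed
  qed
  then obtain c :: "nat \<Rightarrow> ('a \<Rightarrow> real) \<times> ('a \<Rightarrow> 'a)" where c: "\<And>n. C1c (fst (c n)) (snd (c n))" "\<And>n p. 0 \<le> fst (c n) p \<and> fst (c n) p \<le> 1"
    "\<And>n p. norm p \<le> real (Suc n) \<Longrightarrow> fst (c n) p = 1" by metis
  have m[measurable]: "fst (c n) \<in> borel_measurable borel" for n using C1_measurable(1)[OF C1c_C1[OF c(1)]] .
  have i1: "integrable lborel (\<lambda>z. indicator E z * (fst (c n) (fst z) * b (snd z)))" for n
    by (rule slice_int_integral(1)[OF E m bm, of _ 1 Bb]) (use c(2) Bb(2) in auto)
  have i2: "integrable lborel (\<lambda>z. indicator E z * (1 * b (snd z)))"
    and e2: "(LBINT w. b w * slice_int E (\<lambda>_. 1) w) = (LBINT z. indicator E z * (1 * b (snd z)))"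
    using slice_int_integral(1,3)[OF E borel_measurable_const bm, of "1" 1 Bb] Bb(2) by auto
  have "(\<lambda>n. LBINT z. indicator E z * (fst (c n) (fst z) * b (snd z))) \<longlonglongrightarrow> (LBINT z. indicator E z * (1 * b (snd z)))"
  proof (rule integral_dominated_convergence[where w="\<lambda>z. \<bar>indicator E z * (1 * b (snd z))\<bar>"])
    show "AE z in lborel. (\<lambda>n. indicator E z * (fst (c n) (fst z) * b (snd z))) \<longlonglongrightarrow> indicator E z * (1 * b (snd z))"
    proof (intro AE_I2 tendsto_intros)
      fix z :: "'a \<times> (real ^ 'k)"
      obtain n0 where "norm (fst z) \<le> real n0" using real_arch_simple by blast
      then have "fst (c n) (fst z) = 1" if "n \<ge> n0" for n using that by (intro c(3)) simp
      then show "(\<lambda>n. fst (c n) (fst z)) \<longlonglongrightarrow> 1"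
        by (intro tendsto_eventually) (auto simp: eventually_sequentially)
    qed
    show "AE z in lborel. norm (indicator E z * (fst (c n) (fst z) * b (snd z))) \<le> \<bar>indicator E z * (1 * b (snd z))\<bar>" for n
      using c(2) by (intro AE_I2) (auto simp: abs_mult indicator_def mult_left_le_one_le)
  qed (use i1 i2 in auto)
  then have "(\<lambda>n. S1 + (LBINT z. indicator E z * (fst (c n) (fst z) * b (snd z)))) \<longlonglongrightarrow> S1 + (LBINT z. indicator E z * (1 * b (snd z)))"
    by (intro tendsto_intros)
  then have "S1 + (LBINT z. indicator E z * (1 * b (snd z))) \<le> P"
    by (rule LIMSEQ_le_const2) (use key[OF c(1) c(2)] in auto)
  then show ?thesis using e2 unfolding S1_def b_def by linarith
qed

text \<open>\<open>'k option\<close> indexes vectors with one extra coordinate: \<open>None\<close>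
  for the slice coefficient, \<open>Some j\<close> for the directions of \<open>w\<close>.\<close>

lemma sum_option:
  fixes g :: "'k::finite option \<Rightarrow> real"
  shows "(\<Sum>i\<in>UNIV. g i) = g None + (\<Sum>j\<in>UNIV. g (Some j))"
  by (subst UNIV_option_conv, subst sum.insert) (auto simp: sum.reindex)

text \<open>Up to a sign that duality restores, the best coefficients at each point form the vector
  \<open>(U, D) / T\<close>, whose pairing with \<open>(U, D)\<close> is
  \<open>T = sqrt (U\<^sup>2 + (norm D)\<^sup>2)\<close>. They are only bounded and measurable, so
  their mollifications are tested and the kernel is moved onto \<open>h m\<close> and
  \<open>V\<close>. On \<open>V\<close> this gives exactly \<open>D\<close>, on \<open>h m\<close>
  the L1 errors on the right.\<close>

lemma mollified_test_inequality:
  fixes E :: "('a::euclidean_space \<times> (real ^ 'k::finite)) set" and X :: "'i::finite \<Rightarrow> 'a \<Rightarrow> 'a" and N :: nat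
    and \<Psi> :: "nat \<Rightarrow> 'i \<Rightarrow> 'a \<Rightarrow> 'a"
  defines "h \<equiv> \<lambda>m. slice_int E (diverg X (\<Psi> m))" and "V \<equiv> slice_int E (\<lambda>_. 1)"
  assumes E: "E \<in> sets borel" "emeasure lborel E < \<infinity>" and X: "\<And>i. continuous_on UNIV (X i)"
    and P: "\<And>f G. (f, G) \<in> tests \<Longrightarrow> (LBINT z. indicator E z * diverg (prod_fields X) G z) \<le> P"
    and \<psi>: "\<And>m. (\<psi> m, \<Psi> m) \<in> tests"
    and U[measurable]: "U \<in> borel_measurable borel" and U0: "\<And>w. 0 \<le> U w" and Uh: "\<And>w. \<exists>m<N. U w \<le> h m w"
    and k: "mollifier \<epsilon> k K" and ch: "\<And>m. m < N \<Longrightarrow> integrable lborel (conv (h m) k)"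
  shows "integrable lborel (\<lambda>y. indicator (cball 0 r) y * sqrt ((U y)\<^sup>2 + (norm (conv V K y))\<^sup>2))"
    and "(LBINT y. indicator (cball 0 r) y * sqrt ((U y)\<^sup>2 + (norm (conv V K y))\<^sup>2))
      \<le> P + (\<Sum>m<N. LBINT y. \<bar>conv (h m) k y - h m y\<bar>)"
proof -
  note km = mollifierD[OF k]
  have ih: "integrable lborel (h m)" for m
  proof -
    obtain B where "diverg X (\<Psi> m) \<in> borel_measurable borel" "\<And>p. \<bar>diverg X (\<Psi> m) p\<bar> \<le> B"
      by (rule diverg_bounds[where V=X, OF \<psi> X]) blast
    then show ?thesis unfolding h_def by (rule integrable_slice_int[OF E])
  qed
  have iV: "integrable lborel V" unfolding V_def by (rule integrable_slice_int[OF E, of _ 1]) auto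
  have hm[measurable]: "h m \<in> borel_measurable borel" for m using ih[of m] by auto
  define D where "D = conv V K"
  have "C1 (conv V k) D" unfolding D_def by (rule C1_conv[OF iV km(1)])
  then have Dm[measurable]: "D \<in> borel_measurable borel" using C1_measurable(2) by blast
  have Dj[measurable]: "(\<lambda>x. D x $ j) \<in> borel_measurable borel" for j
    by (rule measurable_compose[OF Dm]) (intro borel_measurable_continuous_onI continuous_intros)
  define T where "T y = sqrt ((U y)\<^sup>2 + (norm (D y))\<^sup>2)" for y
  have Tm[measurable]: "T \<in> borel_measurable borel" unfolding T_def by measurable
  have T0: "T y \<ge> 0" for y by (simp add: T_def)
  have T2: "(T y)\<^sup>2 = (U y)\<^sup>2 + (norm (D y))\<^sup>2" for y by (simp add: T_def)
  have UT: "U y \<le> T y" for y unfolding T_def using U0[of y] by (intro real_le_rsqrt) simp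
  have DT: "\<bar>D y $ j\<bar> \<le> T y" for y j
  proof -
    have "\<bar>D y $ j\<bar> \<le> norm (D y)" by (rule component_le_norm_cart)
    also have "\<dots> \<le> T y" unfolding T_def by (intro real_le_rsqrt) simp
    finally show ?thesis .
  qed
  define C where "C = cball (0 :: real ^ 'k) r"
  have Cm[measurable]: "C \<in> sets borel" by (simp add: C_def)
  have iC: "integrable lborel (indicat_real C)"
    unfolding C_def using emeasure_lborel_cball_finite[of "0 :: real ^ 'k" r] by (intro integrable_real_indicator) auto
  \<comment> \<open>Where \<open>T y = 0\<close>, division by zero makes the coefficients
    \<open>a\<close> and \<open>b\<close> vanish.\<close>
  define a where "a y = indicat_real C y * (U y / T y)" for y
  define b where "b j y = - (indicat_real C y * (D y $ j / T y))" for j y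
  have am[measurable]: "a \<in> borel_measurable borel" unfolding a_def by measurable
  have bm[measurable]: "b j \<in> borel_measurable borel" for j unfolding b_def by measurable
  have a0: "0 \<le> a y" and aC: "a y \<le> indicat_real C y" for y
    using U0[of y] T0[of y] UT[of y] by (auto simp: a_def indicator_def divide_le_eq)
  have bC: "\<bar>b j y\<bar> \<le> indicat_real C y" for j y
    using DT[of y j] T0[of y] by (auto simp: b_def indicator_def divide_le_eq abs_mult)
  have ab: "(a y)\<^sup>2 + (\<Sum>j\<in>UNIV. (b j y)\<^sup>2) \<le> 1" for y
  proof -
    have "(\<Sum>j\<in>UNIV. (D y $ j)\<^sup>2) = (norm (D y))\<^sup>2" by (simp add: norm_vec_def L2_set_def sum_nonneg)
    then have "(a y)\<^sup>2 + (\<Sum>j\<in>UNIV. (b j y)\<^sup>2) = indicat_real C y * (((U y)\<^sup>2 + (norm (D y))\<^sup>2) / (T y)\<^sup>2)"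
      by (simp add: a_def b_def indicator_def power_divide add_divide_distrib flip: sum_divide_distrib)
    also have "\<dots> \<le> 1" unfolding T2[symmetric] by (simp add: indicator_def)
    finally show ?thesis .
  qed
  \<comment> \<open>A measurable choice of a test field that attains the bound \<open>U y\<close> on
    the slice; by assumption some index below \<open>N\<close> does.\<close>
  define idx where "idx y = (LEAST m. U y \<le> h m y)" for y
  have idxm[measurable]: "idx \<in> measurable borel (count_space UNIV)" unfolding idx_def by measurable
  have idx: "idx y < N" "U y \<le> h (idx y) y" for y
  proof -
    obtain m where m: "m < N" "U y \<le> h m y" using Uh by blast
    show "U y \<le> h (idx y) y" unfolding idx_def by (rule LeastI[of "\<lambda>m. U y \<le> h m y", OF m(2)])
    show "idx y < N" unfolding idx_def using Least_le[of "\<lambda>m. U y \<le> h m y", OF m(2)] m(1) by linarith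
  qed
  \<comment> \<open>Distributes \<open>a\<close> over the disjoint regions on which index
    \<open>m\<close> is chosen, so that the \<open>A m\<close> add up to \<open>a\<close>.\<close>
  define A where "A m y = a y * (if idx y = m then 1 else 0)" for m y
  have Am[measurable]: "A m \<in> borel_measurable borel" for m unfolding A_def by measurable
  have A0: "0 \<le> A m y" and AC: "A m y \<le> indicat_real C y" for m y
    using a0[of y] aC[of y] by (auto simp: A_def)
  have As: "(\<Sum>m<N. A m y * x m) = a y * x (idx y)" for y x
  proof -
    have "(\<Sum>m<N. A m y * x m) = (\<Sum>m<N. if m = idx y then a y * x m else 0)"
      by (intro sum.cong) (auto simp: A_def)
    then show ?thesis using idx(1)[of y] by (simp add: sum.delta)
  qed
  have bnd: "integrable lborel g" if "g \<in> borel_measurable borel" "\<And>y. \<bar>g y\<bar> \<le> indicat_real C y" for g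
    by (rule Bochner_Integration.integrable_bound[OF iC]) (use that in auto)
  have ia: "integrable lborel a" by (rule bnd[OF am]) (use a0 aC in auto)
  have ib: "integrable lborel (b j)" for j by (rule bnd[OF bm bC])
  have iA: "integrable lborel (A m)" for m by (rule bnd[OF Am]) (use A0 AC in auto)
  have out: "a y = 0" "b j y = 0" "A m y = 0" if "norm y > r" for y j m
    using that by (auto simp: a_def b_def A_def C_def)
  obtain B where B: "\<And>x. \<bar>k x\<bar> \<le> B" using mollifier_bounded[OF k] by metis
  have iAk: "integrable lborel (\<lambda>y. A m y *\<^sub>R k (w - y))" for m w
    by (rule conv_integrable[OF iA km(8), of B]) (use B in auto)
  have "(\<Sum>m<N. LBINT w. conv (A m) k w * h m w) + (LBINT w. (\<Sum>j\<in>UNIV. conv (b j) K w $ j) * V w) \<le> P"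
    unfolding h_def V_def
  proof (rule product_test_inequality[OF E X P \<psi>])
    show "C1c (conv (A m) k) (conv (A m) K)" for m by (rule C1c_conv[OF iA km(1) out(3)])
    show "C1c (conv (b j) k) (conv (b j) K)" for j by (rule C1c_conv[OF ib km(1) out(2)])
    show "0 \<le> conv (A m) k w" for m w
      unfolding conv_def by (intro Bochner_Integration.integral_nonneg) (simp add: km(2) A0)
    show "(\<Sum>m<N. conv (A m) k w)\<^sup>2 + (\<Sum>j\<in>UNIV. (conv (b j) k w)\<^sup>2) \<le> 1" for w
    proof -
      have "(\<Sum>m<N. conv (A m) k w) = (LBINT y. (\<Sum>m<N. A m y *\<^sub>R k (w - y)))"
        unfolding conv_def by (rule Bochner_Integration.integral_sum[symmetric]) (rule iAk)
      also have "\<dots> = conv a k w"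
        unfolding conv_def real_scaleR_def using As[of _ "\<lambda>_. k (w - _)"]
        by (intro Bochner_Integration.integral_cong refl) (use As in blast)
      finally have s: "(\<Sum>m<N. conv (A m) k w) = conv a k w" .
      define c where "c i = (case i of None \<Rightarrow> a | Some j \<Rightarrow> b j)" for i
      have "(\<Sum>i\<in>(UNIV :: 'k option set). (conv (c i) k w)\<^sup>2) \<le> 1"
      proof (rule conv_unit_ball[OF _ _ _ k])
        show "integrable lborel (c i)" for i using ia ib by (simp add: c_def split: option.split)
        show "(\<Sum>i\<in>UNIV. (c i y)\<^sup>2) \<le> 1" for y using ab[of y] by (simp add: c_def sum_option)
      qed simp
      then show ?thesis unfolding s by (simp add: c_def sum_option)
    qed
  qed
  moreover have "(LBINT w. conv (A m) k w * h m w) = (LBINT y. A m y * conv (h m) k y)" for m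
  proof -
    have "k (- x) = 1 * k x" for x using km(4) by simp
    from conv_duality(1)[OF ih iA km(8) B this] show ?thesis by (simp add: mult.commute)
  qed
  moreover have "(LBINT w. (\<Sum>j\<in>UNIV. conv (b j) K w $ j) * V w) = (\<Sum>j\<in>UNIV. LBINT y. - (b j y * D y $ j))"
  proof -
    note du = conv_gradient_duality[OF iV ib k]
    have "(LBINT w. (\<Sum>j\<in>UNIV. conv (b j) K w $ j) * V w) = (LBINT w. (\<Sum>j\<in>UNIV. V w * (conv (b j) K w \<bullet> axis j 1)))"
      unfolding sum_distrib_right by (simp add: inner_axis mult.commute)
    also have "\<dots> = (\<Sum>j\<in>UNIV. LBINT w. V w * (conv (b j) K w \<bullet> axis j 1))"
      by (rule Bochner_Integration.integral_sum[OF du(2)])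
    also have "\<dots> = (\<Sum>j\<in>UNIV. LBINT y. - (b j y * D y $ j))"
      unfolding du(1) D_def by (simp add: inner_axis)
    finally show ?thesis .
  qed
  ultimately have L: "(\<Sum>m<N. LBINT y. A m y * conv (h m) k y) + (\<Sum>j\<in>UNIV. LBINT y. - (b j y * D y $ j)) \<le> P"
    by simp
  have ibD: "integrable lborel (\<lambda>y. - (b j y * D y $ j))" for j
    using conv_gradient_duality(2)[OF ib iV k, of j "axis j 1"] by (simp add: D_def inner_axis)
  have A1: "\<bar>A m y\<bar> \<le> 1" for m y using A0[of m y] AC[of m y] by (cases "y \<in> C") auto
  have iAg: "integrable lborel (\<lambda>y. A m y * g y)" if "integrable lborel g" for m g
  proof (rule Bochner_Integration.integrable_bound[OF that])
    show "(\<lambda>y. A m y * g y) \<in> borel_measurable lborel" using that by measurable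
    show "AE y in lborel. norm (A m y * g y) \<le> norm (g y)"
      using A1 by (intro AE_I2) (simp add: abs_mult mult_left_le_one_le)
  qed
  \<comment> \<open>The pairing of the coefficients with \<open>h m\<close> itself instead of its
    mollification; it dominates \<open>T\<close> on the ball.\<close>
  define Z where "Z y = (\<Sum>m<N. A m y * h m y) + (\<Sum>j\<in>UNIV. - (b j y * D y $ j))" for y
  have iZ: "integrable lborel Z" unfolding Z_def
    by (intro Bochner_Integration.integrable_add Bochner_Integration.integrable_sum iAg ih ibD)
  have TZ: "indicat_real C y * T y \<le> Z y" for y
  proof -
    have "(\<Sum>j\<in>UNIV. - (b j y * D y $ j)) = indicat_real C y * ((\<Sum>j\<in>UNIV. (D y $ j)\<^sup>2) / T y)"
      unfolding sum_divide_distrib sum_distrib_left by (intro sum.cong) (auto simp: b_def power2_eq_square)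
    also have "(\<Sum>j\<in>UNIV. (D y $ j)\<^sup>2) = (norm (D y))\<^sup>2" by (simp add: norm_vec_def L2_set_def sum_nonneg)
    finally have 1: "(\<Sum>j\<in>UNIV. - (b j y * D y $ j)) = indicat_real C y * ((norm (D y))\<^sup>2 / T y)" .
    have "(\<Sum>m<N. A m y * h m y) = a y * h (idx y) y" by (rule As)
    also have "\<dots> \<ge> a y * U y" using idx(2) a0 by (intro mult_left_mono)
    finally have 2: "indicat_real C y * ((U y)\<^sup>2 / T y) \<le> (\<Sum>m<N. A m y * h m y)"
      by (simp add: a_def power2_eq_square)
    have "T y = (T y)\<^sup>2 / T y" by (simp add: power2_eq_square)
    then have "T y = (U y)\<^sup>2 / T y + (norm (D y))\<^sup>2 / T y" unfolding T2 add_divide_distrib .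
    then have "indicat_real C y * T y = indicat_real C y * ((U y)\<^sup>2 / T y) + indicat_real C y * ((norm (D y))\<^sup>2 / T y)"
      by (metis distrib_left)
    then show ?thesis using 1 2 unfolding Z_def by linarith
  qed
  show iT: "integrable lborel (\<lambda>y. indicator (cball 0 r) y * sqrt ((U y)\<^sup>2 + (norm (conv V K y))\<^sup>2))"
    unfolding C_def[symmetric] D_def[symmetric] T_def[symmetric]
  proof (rule Bochner_Integration.integrable_bound[OF iZ])
    show "AE y in lborel. norm (indicat_real C y * T y) \<le> norm (Z y)"
      using TZ T0 by (intro AE_I2) (simp add: abs_mult order_trans[OF _ abs_ge_self])
  qed measurable
  have "(LBINT y. indicator (cball 0 r) y * sqrt ((U y)\<^sup>2 + (norm (conv V K y))\<^sup>2)) \<le> (LBINT y. Z y)"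
    using TZ iT iZ unfolding C_def D_def T_def by (intro integral_mono) auto
  also have "\<dots> = (\<Sum>m<N. LBINT y. A m y * h m y) + (\<Sum>j\<in>UNIV. LBINT y. - (b j y * D y $ j))"
  proof -
    have "(LBINT y. Z y) = (LBINT y. (\<Sum>m<N. A m y * h m y)) + (LBINT y. (\<Sum>j\<in>UNIV. - (b j y * D y $ j)))"
      unfolding Z_def by (intro Bochner_Integration.integral_add Bochner_Integration.integrable_sum iAg ih ibD)
    also have "(LBINT y. (\<Sum>m<N. A m y * h m y)) = (\<Sum>m<N. LBINT y. A m y * h m y)"
      by (rule Bochner_Integration.integral_sum) (rule iAg[OF ih])
    also have "(LBINT y. (\<Sum>j\<in>UNIV. - (b j y * D y $ j))) = (\<Sum>j\<in>UNIV. LBINT y. - (b j y * D y $ j))"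
      by (rule Bochner_Integration.integral_sum) (rule ibD)
    finally show ?thesis .
  qed
  also have "(\<Sum>m<N. LBINT y. A m y * h m y)
      \<le> (\<Sum>m<N. (LBINT y. A m y * conv (h m) k y) + (LBINT y. \<bar>conv (h m) k y - h m y\<bar>))"
  proof (rule sum_mono)
    fix m assume m: "m \<in> {..<N}"
    have c: "integrable lborel (conv (h m) k)" using ch m by simp
    have "(LBINT y. A m y * h m y) \<le> (LBINT y. A m y * conv (h m) k y + \<bar>conv (h m) k y - h m y\<bar>)"
    proof (rule integral_mono)
      show "integrable lborel (\<lambda>y. A m y * h m y)" by (rule iAg[OF ih])
      show "integrable lborel (\<lambda>y. A m y * conv (h m) k y + \<bar>conv (h m) k y - h m y\<bar>)"
        using iAg[OF c] c ih by (intro Bochner_Integration.integrable_add integrable_abs Bochner_Integration.integrable_diff)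
      fix y
      have "A m y * (h m y - conv (h m) k y) \<le> \<bar>A m y\<bar> * \<bar>h m y - conv (h m) k y\<bar>" by (simp flip: abs_mult)
      also have "\<dots> \<le> 1 * \<bar>h m y - conv (h m) k y\<bar>" by (intro mult_right_mono A1) auto
      finally show "A m y * h m y \<le> A m y * conv (h m) k y + \<bar>conv (h m) k y - h m y\<bar>"
        by (simp add: right_diff_distrib abs_minus_commute)
    qed
    also have "\<dots> = (LBINT y. A m y * conv (h m) k y) + (LBINT y. \<bar>conv (h m) k y - h m y\<bar>)"
      using iAg[OF c] c ih by (intro Bochner_Integration.integral_add integrable_abs Bochner_Integration.integrable_diff)
    finally show "(LBINT y. A m y * h m y) \<le> (LBINT y. A m y * conv (h m) k y) + (LBINT y. \<bar>conv (h m) k y - h m y\<bar>)" .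
  qed
  also have "\<dots> = (\<Sum>m<N. LBINT y. A m y * conv (h m) k y) + (\<Sum>m<N. LBINT y. \<bar>conv (h m) k y - h m y\<bar>)"
    by (rule sum.distrib)
  finally show "(LBINT y. indicator (cball 0 r) y * sqrt ((U y)\<^sup>2 + (norm (conv V K y))\<^sup>2))
      \<le> P + (\<Sum>m<N. LBINT y. \<bar>conv (h m) k y - h m y\<bar>)"
    using L by linarith
qed

section \<open>From slices to the product\<close>

lemma root_power_eq_powr:
  assumes "x \<ge> 0" "Q \<ge> 2"
  shows "root Q x ^ (Q - 1) = x powr ((real Q - 1) / real Q)"
proof (cases "x = 0")
  case False
  then have "root Q x = x powr (1 / Q)" using assms by (simp add: root_powr_inverse)
  then show ?thesis using False assms by (simp add: powr_realpow[symmetric] powr_powr of_nat_diff)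
qed (use assms in simp)

text \<open>The constant as it emerges from the body of revolution after division by the volume
  factor \<open>unit_ball_vol Q * (Q / c) ^ Q\<close>; it is the
  \<open>b\<^sub>d * (c / b\<^sub>Q) powr (Q / d)\<close> of the overview.\<close>

definition product_constant :: "nat \<Rightarrow> nat \<Rightarrow> real \<Rightarrow> real" where
  "product_constant Q d c = d * unit_ball_vol d powr (1 / d) * (unit_ball_vol Q * (Q / c) ^ Q) powr (- 1 / d)"

lemma C1c_profile_inequality_powr:
  fixes W :: "'b::euclidean_space \<Rightarrow> real" and q :: "'q::euclidean_space itself"
  defines "Q \<equiv> DIM('q)" and "d \<equiv> DIM('q) + DIM('b)"
  assumes W: "C1c W G" "\<And>w. 0 \<le> W w" and c: "c > 0" and Q2: "DIM('q) \<ge> 2" and I: "(LBINT w. W w) > 0"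
  shows "product_constant Q d c * (LBINT w. W w) powr ((real d - 1) / d)
     \<le> (LBINT w. sqrt ((c * W w powr ((real Q - 1) / Q))\<^sup>2 + (norm (G w))\<^sup>2))"
proof -
  define A where "A = unit_ball_vol Q * (Q / c) ^ Q"
  have d: "d > 0" by (simp add: d_def)
  have A: "A > 0" unfolding A_def using c Q2 by (intro mult_pos_pos zero_less_power divide_pos_pos) (auto simp: Q_def)
  define S where "S = (LBINT w. sqrt ((c * W w powr ((real Q - 1) / Q))\<^sup>2 + (norm (G w))\<^sup>2))"
  define II where "II = (LBINT w. W w)"
  have "d * unit_ball_vol d powr (1 / d) * (A * II) powr ((real d - 1) / d) \<le> A * S"
    using C1c_profile_inequality[OF W c Q2 I, unfolded root_power_eq_powr[OF W(2) Q2]]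
    unfolding A_def S_def II_def Q_def d_def .
  \<comment> \<open>The full factor \<open>A\<close> split off here cancels against the right-hand
    side; \<open>A powr (- 1 / d)\<close> is part of \<open>product_constant\<close>.\<close>
  moreover have "(A * II) powr ((real d - 1) / d) = A * (A powr (- 1 / d) * II powr ((real d - 1) / d))"
  proof -
    have "A powr ((real d - 1) / d) = A powr (1 + (- 1 / d))" using d by (simp add: field_simps)
    also have "\<dots> = A * A powr (- 1 / d)" using A by (subst powr_add) simp
    finally show ?thesis using A I by (simp add: powr_mult II_def)
  qed
  ultimately have "A * (product_constant Q d c * II powr ((real d - 1) / d)) \<le> A * S"
    by (simp add: product_constant_def A_def[symmetric] mult_ac)
  then show ?thesis using A by (simp add: II_def S_def)
qed

lemma slice_int_one: "slice_int E (\<lambda>_. 1) w = measure lborel ((\<lambda>p. (p, w)) -` E)"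
proof -
  have "(\<lambda>p. indicator E (p, w) * 1 :: real) = indicator ((\<lambda>p. (p, w)) -` E)" by (auto simp: indicator_def)
  then show ?thesis unfolding slice_int_def by simp
qed

text \<open>The admissible constant provides a nearly optimal test field for the slice, and density
  replaces it by a member of the sequence. This changes the slice integral by at most
  \<open>e * V\<close>, with \<open>e\<close> chosen for the given slice.\<close>

lemma admissible_slice:
  fixes E :: "('a::euclidean_space \<times> 'b::euclidean_space) set" and X :: "'i::finite \<Rightarrow> 'a \<Rightarrow> 'a"
  assumes E: "E \<in> sets borel" and X: "\<And>i. continuous_on UNIV (X i)" and adm: "admissible X Q c"
    and \<psi>: "\<And>n. (\<psi> n, \<Psi> n) \<in> tests" "\<And>p. diverg X (\<Psi> 0) p = 0"
    "\<And>f G e. (f, G) \<in> tests \<Longrightarrow> e > 0 \<Longrightarrow> \<exists>n. \<forall>p. \<bar>diverg X G p - diverg X (\<Psi> n) p\<bar> \<le> e"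
    and \<delta>: "\<delta> > 0"
  shows "\<exists>n. c * slice_int E (\<lambda>_. 1) w powr ((real Q - 1) / Q) - \<delta> < slice_int E (diverg X (\<Psi> n)) w"
proof -
  define F where "F = (\<lambda>p. (p, w)) -` E"
  have "(\<lambda>p::'a. (p, w)) \<in> borel_measurable borel"
    by (intro borel_measurable_continuous_onI continuous_intros)
  from measurable_sets[OF this E] have F[measurable]: "F \<in> sets borel" by (simp add: F_def)
  have iE: "indicator E (p, w) = indicat_real F p" for p by (auto simp: F_def indicator_def)
  define V where "V = measure lborel F"
  have V: "slice_int E (\<lambda>_. 1) w = V" by (simp add: slice_int_one V_def F_def)
  have V0: "V \<ge> 0" by (simp add: V_def)
  show ?thesis
  proof (cases "emeasure lborel F < \<infinity>")
    case False
    \<comment> \<open>A slice of infinite volume has \<open>measure\<close> zero by convention.\<close>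
    then have "V = 0" by (simp add: V_def measure_def less_top[symmetric])
    moreover have "slice_int E (diverg X (\<Psi> 0)) w = 0" by (simp add: slice_int_def \<psi>(2))
    ultimately show ?thesis using \<delta> by (intro exI[of _ 0]) (simp add: V)
  next
    case True
    have iF: "integrable lborel (indicat_real F)" using True by (intro integrable_real_indicator) auto
    have "F \<in> lmeasurable" using True F by (intro fmeasurableI) auto
    moreover have "measure lebesgue F = V" using F by (simp add: V_def measure_completion)
    ultimately have "ereal (c * V powr ((real Q - 1) / Q)) \<le> perimeter X F"
      using adm unfolding admissible_def by metis
    then have "ereal (c * V powr ((real Q - 1) / Q) - \<delta> / 2) < perimeter X F"
      by (rule less_le_trans[rotated]) (use \<delta> in simp)
    also have "perimeter X F = (SUP (f, G)\<in>tests. ereal (LBINT p. indicator F p * diverg X G p))"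
      by (rule perimeter_borel[where V=X, OF F X])
    finally obtain f G where fG: "(f, G) \<in> tests" "c * V powr ((real Q - 1) / Q) - \<delta> / 2 < (LBINT p. indicator F p * diverg X G p)"
      unfolding less_SUP_iff by (auto simp del: times_divide_eq_right)
    define e where "e = \<delta> / 2 / (V + 1)"
    have e: "e > 0" using \<delta> V0 by (simp add: e_def)
    obtain n where n: "\<And>p. \<bar>diverg X G p - diverg X (\<Psi> n) p\<bar> \<le> e" using \<psi>(3)[OF fG(1) e] by blast
    have i: "integrable lborel (\<lambda>p. indicator F p * diverg X G p)" if "(f, G) \<in> tests" for f and G :: "'i \<Rightarrow> 'a \<Rightarrow> 'a"
    proof -
      have "integrable lborel (diverg X G)" by (rule diverg_bounds[where V=X, OF that X])
      from integrable_mult_indicator[OF _ this, of F] show ?thesis by simp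
    qed
    have "(LBINT p. indicator F p * diverg X G p) \<le> (LBINT p. indicator F p * diverg X (\<Psi> n) p + e * indicator F p)"
    proof (rule integral_mono)
      show "integrable lborel (\<lambda>p. indicator F p * diverg X (\<Psi> n) p + e * indicator F p)"
        using i[OF \<psi>(1)] iF by auto
      show "indicator F p * diverg X G p \<le> indicator F p * diverg X (\<Psi> n) p + e * indicator F p" for p
        using n[of p] by (auto simp: indicator_def)
    qed (rule i[OF fG(1)])
    also have "\<dots> = slice_int E (diverg X (\<Psi> n)) w + e * V"
      using i[OF \<psi>(1)] iF F by (simp add: slice_int_def iE V_def)
    also have "e * V \<le> \<delta> / 2 * 1" unfolding e_def using \<delta> V0 by (intro divide_Suc_mult_le) auto
    finally show ?thesis using fG(2) V by (intro exI[of _ n]) simp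
  qed
qed

lemma conv_L1_finite:
  fixes g :: "'i \<Rightarrow> 'a::euclidean_space \<Rightarrow> real"
  assumes "finite I" "\<And>i. i \<in> I \<Longrightarrow> integrable lborel (g i)" "e > 0"
  shows "\<exists>d>0. \<forall>\<epsilon> k K. mollifier \<epsilon> k K \<longrightarrow> \<epsilon> < d \<longrightarrow>
     (\<forall>i\<in>I. integrable lborel (conv (g i) k) \<and> (LBINT x. \<bar>conv (g i) k x - g i x\<bar>) \<le> e)"
  using assms
proof (induction I)
  case empty
  show ?case by (intro exI[of _ 1]) auto
next
  case (insert i I)
  obtain d1 where d1: "d1 > 0" "\<forall>\<epsilon> k K. mollifier \<epsilon> k K \<longrightarrow> \<epsilon> < d1 \<longrightarrow>
     (\<forall>i\<in>I. integrable lborel (conv (g i) k) \<and> (LBINT x. \<bar>conv (g i) k x - g i x\<bar>) \<le> e)"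
    using insert.IH insert.prems by auto
  obtain d2 where d2: "d2 > 0" "\<forall>\<epsilon> k K. mollifier \<epsilon> k K \<longrightarrow> \<epsilon> < d2 \<longrightarrow>
     integrable lborel (conv (g i) k) \<and> (LBINT x. \<bar>conv (g i) k x - g i x\<bar>) \<le> e"
    using conv_L1[of "g i" e] insert.prems by auto
  show ?case by (intro exI[of _ "min d1 d2"]) (use d1 d2 in auto)
qed

text \<open>Subadditivity of the power gives \<open>\<bar>x - y\<bar> powr p\<close>, which is at
  most \<open>s powr p\<close> up to \<open>s\<close> and at most a linear function beyond. The
  bound is linear in \<open>\<bar>x - y\<bar>\<close>, so L1 closeness passes to the powers;
  \<open>s\<close> makes the constant term small.\<close>

lemma powr_diff_le:
  fixes x y p s :: real
  assumes "0 \<le> x" "0 \<le> y" "0 < p" "p \<le> 1" "s > 0"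
  shows "\<bar>x powr p - y powr p\<bar> \<le> s powr p + s powr (p - 1) * \<bar>x - y\<bar>"
proof -
  have sub: "b powr p - a powr p \<le> (b - a) powr p" if "0 \<le> a" "a \<le> b" for a b
  proof (cases "b = 0")
    case False
    then have b: "b > 0" using that by simp
    have "1 = a / b + (b - a) / b" using b by (simp add: field_simps)
    also have "\<dots> \<le> (a / b) powr p + ((b - a) / b) powr p"
    proof (intro add_mono)
      have "z \<le> z powr p" if "0 \<le> z" "z \<le> 1" for z :: real
        using powr_mono'[of p 1 z] assms that by (cases "z = 0") auto
      then show "a / b \<le> (a / b) powr p" "(b - a) / b \<le> ((b - a) / b) powr p"
        using that b by (auto simp: field_simps)
    qed
    finally have "b powr p * 1 \<le> b powr p * ((a / b) powr p + ((b - a) / b) powr p)" using b by (intro mult_left_mono) auto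
    also have "\<dots> = a powr p + (b - a) powr p" using b that by (simp add: powr_divide distrib_left)
    finally show ?thesis by simp
  qed (use that in simp)
  have t: "z powr p \<le> s powr p + s powr (p - 1) * z" if "z \<ge> 0" for z
  proof (cases "z \<le> s")
    case True
    then have "z powr p \<le> s powr p" using that assms by (intro powr_mono2) auto
    then show ?thesis using that by (simp add: add_increasing2)
  next
    case False
    then have "z powr p = z powr (p - 1) * z" using assms powr_add[of z "p - 1" 1] by simp
    also have "\<dots> \<le> s powr (p - 1) * z"
      using False assms by (intro mult_right_mono powr_mono2') auto
    finally show ?thesis by (simp add: add_increasing)
  qed
  have "\<bar>x powr p - y powr p\<bar> \<le> \<bar>x - y\<bar> powr p"
  proof (cases "x \<le> y")
    case True
    then show ?thesis using sub[of x y] assms powr_mono2[of p x y] by simp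
  next
    case False
    then show ?thesis using sub[of y x] assms powr_mono2[of p y x] by simp
  qed
  also have "\<dots> \<le> s powr p + s powr (p - 1) * \<bar>x - y\<bar>" by (rule t) simp
  finally show ?thesis .
qed

text \<open>All errors are tied to one \<open>\<delta>\<close>, and the order of choices matters:
  the number \<open>N\<close> of test fields and the parameter \<open>s\<close> precede the
  mollification radius, since the accuracy demanded of it depends on them. The profile inequality is
  applied to \<open>W\<close>, the mollified slice volume \<open>v\<close> times a cutoff, and its
  integrand is compared pointwise with the one that the test fields control.\<close>

lemma product_isoperimetric_aux:
  fixes E :: "('a::euclidean_space \<times> (real ^ 'k::finite)) set" and X :: "'i::finite \<Rightarrow> 'a \<Rightarrow> 'a"
    and q :: "'q::euclidean_space itself"
  defines "Q \<equiv> DIM('q)" and "d \<equiv> DIM('q) + CARD('k)"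
  assumes E: "E \<in> sets borel" "emeasure lborel E < \<infinity>" and X: "\<And>i. continuous_on UNIV (X i)"
    and adm: "admissible X Q c" and c: "c > 0" and Q2: "DIM('q) \<ge> 2"
    and P: "\<And>f G. (f, G) \<in> tests \<Longrightarrow> (LBINT z. indicator E z * diverg (prod_fields X) G z) \<le> P"
    and r: "r > 0" and a: "0 < a" "a < measure lborel (E \<inter> UNIV \<times> cball 0 r)"
  shows "product_constant Q d c * a powr ((real d - 1) / d) \<le> P + 4 / r * (measure lborel E + 1)"
proof -
  define p where "p = (real Q - 1) / Q"
  have p: "0 < p" "p < 1" using Q2 by (auto simp: p_def Q_def)
  define V where "V = slice_int E (\<lambda>_. 1)"
  have V0: "V w \<ge> 0" for w by (simp add: V_def slice_int_one)
  have iV: "integrable lborel V" unfolding V_def by (rule integrable_slice_int[OF E, of _ 1]) auto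
  have Vm[measurable]: "V \<in> borel_measurable borel" using iV by auto
  define m where "m = measure lborel E"
  have Vint: "(LBINT w. V w) = m"
    using slice_int_integral(3)[OF E borel_measurable_const borel_measurable_const, of 1 1 1 1] E by (simp add: V_def m_def)
  define mr where "mr = measure lborel (E \<inter> UNIV \<times> cball 0 r)"
  have Vr: "(LBINT w. indicator (cball 0 r) w * V w) = mr"
  proof -
    have "(LBINT w. indicator (cball 0 r) w * V w) = (LBINT z. indicator E z * (1 * indicat_real (cball 0 r) (snd z)))"
      unfolding V_def by (rule slice_int_integral(3)[OF E, of _ _ 1 1]) (auto simp: indicator_def)
    also have "\<dots> = (LBINT z. indicator (E \<inter> UNIV \<times> cball 0 r) z)"
      by (intro Bochner_Integration.integral_cong) (auto simp: indicator_def)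
    finally show ?thesis using E by (simp add: mr_def)
  qed
  obtain \<psi> :: "nat \<Rightarrow> 'i \<Rightarrow> 'a \<Rightarrow> real" and \<Psi> where \<psi>: "\<And>n. (\<psi> n, \<Psi> n) \<in> tests" "\<And>p. diverg X (\<Psi> 0) p = 0"
    "\<And>f G e. (f, G) \<in> tests \<Longrightarrow> e > 0 \<Longrightarrow> \<exists>n. \<forall>p. \<bar>diverg X G p - diverg X (\<Psi> n) p\<bar> \<le> e"
    by (rule tests_dense_sequence[of X, OF X]) blast
  define h where "h n = slice_int E (diverg X (\<Psi> n))" for n
  have ih: "integrable lborel (h n)" for n
  proof -
    obtain B where "diverg X (\<Psi> n) \<in> borel_measurable borel" "\<And>p. \<bar>diverg X (\<Psi> n) p\<bar> \<le> B"
      by (rule diverg_bounds[where V=X, OF \<psi>(1) X]) blast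
    then show ?thesis unfolding h_def by (rule integrable_slice_int[OF E])
  qed
  have hm[measurable]: "h n \<in> borel_measurable borel" for n using ih[of n] by auto
  have h0: "h 0 w = 0" for w by (simp add: h_def slice_int_def \<psi>(2))
  have hV: "\<exists>n. c * V w powr p - \<delta> < h n w" if "\<delta> > 0" for w \<delta>
    unfolding V_def h_def p_def by (rule admissible_slice[OF E(1) X adm \<psi> that])
  \<comment> \<open>The part of \<open>c * V w powr p\<close> reached by the test fields up to index
    \<open>N\<close>. Index 0 makes it nonnegative, and it tends to the full value as
    \<open>N\<close> grows.\<close>
  define U where "U N w = min (c * V w powr p) (Max ((\<lambda>n. h n w) ` {..N}))" for N w
  have Um[measurable]: "U N \<in> borel_measurable borel" for N
  proof -
    have [measurable]: "(\<lambda>w. Max ((\<lambda>n. h n w) ` {..N})) \<in> borel_measurable borel"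
      by (rule borel_measurable_Max) (use hm in auto)
    show ?thesis unfolding U_def by measurable
  qed
  have U0: "0 \<le> U N w" for N w
  proof -
    have "h 0 w \<le> Max ((\<lambda>n. h n w) ` {..N})" by (intro Max_ge) auto
    then show ?thesis using c h0[of w] by (simp add: U_def)
  qed
  have UV: "U N w \<le> c * V w powr p" for N w by (simp add: U_def)
  have Uh: "\<exists>n<Suc N. U N w \<le> h n w" for N w
  proof -
    have "Max ((\<lambda>n. h n w) ` {..N}) \<in> (\<lambda>n. h n w) ` {..N}" by (intro Max_in) auto
    then show ?thesis
    proof (rule imageE)
      fix n assume "Max ((\<lambda>n. h n w) ` {..N}) = h n w" "n \<in> {..N}"
      then show ?thesis by (intro exI[of _ n]) (auto simp: U_def)
    qed
  qed
  have Ulim: "(\<lambda>N. c * V w powr p - U N w) \<longlonglongrightarrow> 0" for w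
  proof (rule LIMSEQ_I)
    fix \<delta> :: real assume "\<delta> > 0"
    from hV[OF this, of w] obtain n where n: "c * V w powr p - \<delta> < h n w" by blast
    show "\<exists>no. \<forall>N\<ge>no. norm (c * V w powr p - U N w - 0) < \<delta>"
    proof (intro exI[of _ n] allI impI)
      fix N assume "n \<le> N"
      then have "h n w \<le> Max ((\<lambda>n. h n w) ` {..N})" by (intro Max_ge) auto
      then have "c * V w powr p - \<delta> < U N w" using n \<open>\<delta> > 0\<close> by (simp add: U_def)
      then show "norm (c * V w powr p - U N w - 0) < \<delta>" using UV[of N w] by simp
    qed
  qed
  define C where "C = cball (0 :: real ^ 'k) (2 * r)"
  have Cm[measurable]: "C \<in> sets borel" by (simp add: C_def)
  have iC: "integrable lborel (indicat_real C)"
    unfolding C_def using emeasure_lborel_cball_finite[of "0 :: real ^ 'k" "2 * r"] by (intro integrable_real_indicator) auto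
  \<comment> \<open>Makes \<open>V powr p\<close> integrable over the bounded set \<open>C\<close>,
    although \<open>V\<close> itself is only known to be integrable.\<close>
  have Vp: "x powr p \<le> 1 + x" if "x \<ge> 0" for x :: real
    using powr_diff_le[of x 0 p 1] p that by simp
  have iCV: "integrable lborel (\<lambda>w. indicat_real C w * (c * V w powr p))"
  proof (rule Bochner_Integration.integrable_bound)
    show "integrable lborel (\<lambda>w. c * (indicat_real C w + V w))" using iC iV by auto
    show "AE w in lborel. norm (indicat_real C w * (c * V w powr p)) \<le> norm (c * (indicat_real C w + V w))"
      using Vp[OF V0] V0 c by (intro AE_I2) (auto simp: indicator_def abs_mult)
  qed measurable
  have iCU: "integrable lborel (\<lambda>w. indicat_real C w * (c * V w powr p - U N w))" for N
  proof (rule Bochner_Integration.integrable_bound[OF iCV])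
    show "AE w in lborel. norm (indicat_real C w * (c * V w powr p - U N w)) \<le> norm (indicat_real C w * (c * V w powr p))"
    proof (intro AE_I2)
      fix w
      have "\<bar>c * V w powr p - U N w\<bar> \<le> \<bar>c * V w powr p\<bar>" using U0[of N w] UV[of N w] by linarith
      then show "norm (indicat_real C w * (c * V w powr p - U N w)) \<le> norm (indicat_real C w * (c * V w powr p))"
        by (simp add: indicator_def)
    qed
  qed measurable
  have "(\<lambda>N. LBINT w. indicat_real C w * (c * V w powr p - U N w)) \<longlonglongrightarrow> (\<integral>w. (0::real) \<partial>(lborel :: (real ^ 'k) measure))"
  proof (rule integral_dominated_convergence[OF _ _ iCV])
    show "AE w in lborel. (\<lambda>N. indicat_real C w * (c * V w powr p - U N w)) \<longlonglongrightarrow> 0"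
      using tendsto_mult_left[OF Ulim] by (intro AE_I2) simp
    show "AE w in lborel. norm (indicat_real C w * (c * V w powr p - U N w)) \<le> indicat_real C w * (c * V w powr p)" for N
    proof (intro AE_I2)
      fix w
      have "\<bar>c * V w powr p - U N w\<bar> \<le> c * V w powr p" using U0[of N w] UV[of N w] by linarith
      then show "norm (indicat_real C w * (c * V w powr p - U N w)) \<le> indicat_real C w * (c * V w powr p)"
        by (simp add: indicator_def)
    qed
  qed measurable
  then have Nlim: "(\<lambda>N. LBINT w. indicat_real C w * (c * V w powr p - U N w)) \<longlonglongrightarrow> 0" by simp
  have key: "product_constant Q d c * a powr ((real d - 1) / d) \<le> P + 4 / r * (m + 1) + 4 * \<delta>"
    if \<delta>: "0 < \<delta>" "\<delta> \<le> 1" "\<delta> \<le> mr - a" for \<delta>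
  proof -
    obtain N where N: "(LBINT w. indicat_real C w * (c * V w powr p - U N w)) < \<delta>"
      using order_tendstoD(2)[OF Nlim \<delta>(1)] by (auto simp: eventually_sequentially)
    define mC where "mC = measure lborel C"
    have mC: "mC \<ge> 0" by (simp add: mC_def)
    \<comment> \<open>The constant term of \<open>powr_diff_le\<close>, multiplied by
      \<open>c\<close> and integrated over \<open>C\<close>, is \<open>c * s powr p * mC\<close>,
      which this choice puts below \<open>\<delta>\<close>.\<close>
    define s where "s = (\<delta> / (c * mC + 1)) powr (1 / p)"
    have cmC: "c * mC \<ge> 0" using c mC by simp
    have s: "s > 0" "s powr p = \<delta> / (c * mC + 1)"
      using p \<delta> cmC by (auto simp: s_def powr_powr add_nonneg_eq_0_iff)
    \<comment> \<open>The first entry limits the loss of volume, the second the linear term of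
      \<open>powr_diff_le\<close>.\<close>
    define e where "e = min \<delta> (\<delta> / (c * s powr (p - 1) + 1))"
    have cs: "c * s powr (p - 1) \<ge> 0" using c by simp
    have e: "e > 0" "e \<le> \<delta>" "c * s powr (p - 1) * e \<le> \<delta>"
    proof -
      show "e > 0" using \<delta> cs by (simp add: e_def add_nonneg_pos)
      show "e \<le> \<delta>" by (simp add: e_def)
      have "c * s powr (p - 1) * e \<le> c * s powr (p - 1) * (\<delta> / (c * s powr (p - 1) + 1))"
        using cs by (intro mult_left_mono) (auto simp: e_def)
      also have "\<dots> = \<delta> / (c * s powr (p - 1) + 1) * (c * s powr (p - 1))" by (rule mult.commute)
      also have "\<dots> \<le> \<delta> * 1" using \<delta>(1) cs by (rule divide_Suc_mult_le)
      finally show "c * s powr (p - 1) * e \<le> \<delta>" by simp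
    qed
    obtain d1 where d1: "d1 > 0" "\<forall>\<epsilon> k K. mollifier \<epsilon> k K \<longrightarrow> \<epsilon> < d1 \<longrightarrow>
       integrable lborel (conv V k) \<and> (LBINT x. \<bar>conv V k x - V x\<bar>) \<le> e"
      using conv_L1[OF iV e(1)] by (elim exE conjE)
    have "\<delta> / real (Suc N) > 0" using \<delta> by simp
    from conv_L1_finite[of "{..<Suc N}" h, OF finite_lessThan ih this]
    obtain d2 where d2: "d2 > 0" "\<forall>\<epsilon> k K. mollifier \<epsilon> k K \<longrightarrow> \<epsilon> < d2 \<longrightarrow>
       (\<forall>n\<in>{..<Suc N}. integrable lborel (conv (h n) k) \<and> (LBINT x. \<bar>conv (h n) k x - h n x\<bar>) \<le> \<delta> / real (Suc N))"
      by (elim exE conjE)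
    define \<epsilon> where "\<epsilon> = min d1 d2 / 2"
    have \<epsilon>: "\<epsilon> > 0" "\<epsilon> < d1" "\<epsilon> < d2" using d1(1) d2(1) by (auto simp: \<epsilon>_def min_def)
    obtain k and K :: "real ^ 'k \<Rightarrow> real ^ 'k" where k: "mollifier \<epsilon> k K"
      by (rule mollifier_exists[OF \<epsilon>(1)])
    define v where "v = conv V k"
    define D where "D = conv V K"
    have iv: "integrable lborel v" and ve: "(LBINT x. \<bar>v x - V x\<bar>) \<le> e"
      using d1(2) k \<epsilon>(2) unfolding v_def by blast+
    have hk: "integrable lborel (conv (h n) k)" "(LBINT x. \<bar>conv (h n) k x - h n x\<bar>) \<le> \<delta> / real (Suc N)" if "n < Suc N" for n
      using d2(2) k \<epsilon>(3) that by blast+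
    have Cv: "C1 v D" unfolding v_def D_def by (rule C1_conv[OF iV mollifierD(1)[OF k]])
    note [measurable] = C1_measurable[OF Cv]
    have v0: "v x \<ge> 0" for x
      unfolding v_def conv_def using V0 by (intro Bochner_Integration.integral_nonneg) (simp add: mollifierD(2)[OF k])
    obtain ct :: "real ^ 'k \<Rightarrow> real" and Y where ct: "C1c ct Y" "\<And>x. 0 \<le> ct x \<and> ct x \<le> 1" "\<And>x. norm x \<le> r \<Longrightarrow> ct x = 1"
      "\<And>x. norm x \<ge> 2 * r \<Longrightarrow> ct x = 0" "\<And>x. norm (Y x) \<le> 4 / r"
      by (rule cutoff_exists[OF r, where 'a="real ^ 'k"]) blast
    define W where "W x = v x * ct x" for x
    define G where "G x = v x *\<^sub>R Y x + ct x *\<^sub>R D x" for x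
    have WG: "C1c W G" unfolding W_def G_def by (rule C1c_mult[OF Cv ct(1)])
    note [measurable] = C1_measurable[OF C1c_C1[OF WG]]
    have W0: "0 \<le> W x" for x using v0 ct(2) by (simp add: W_def)
    note iW = C1c_integrable(1)[OF WG]
    have iabs: "integrable lborel (\<lambda>x. \<bar>v x - V x\<bar>)" using iv iV by auto
    \<comment> \<open>The cutoff is 1 on the ball of radius \<open>r\<close>, so \<open>W\<close>
      keeps all of \<open>mr\<close> except the L1 error, which is at most
      \<open>mr - a\<close>.\<close>
    have aW: "a \<le> (LBINT x. W x)"
    proof -
      have irV: "integrable lborel (\<lambda>w. indicator (cball 0 r) w * V w)"
        using integrable_mult_indicator[OF _ iV, of "cball 0 r"] by simp
      have "mr - (LBINT x. \<bar>v x - V x\<bar>) = (LBINT w. indicator (cball 0 r) w * V w - \<bar>v w - V w\<bar>)"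
        using irV iabs Vr by simp
      also have "\<dots> \<le> (LBINT x. W x)"
      proof (rule integral_mono[OF Bochner_Integration.integrable_diff[OF irV iabs] iW])
        show "indicator (cball 0 r) x * V x - \<bar>v x - V x\<bar> \<le> W x" for x
          using ct(3)[of x] W0[of x] by (cases "norm x \<le> r") (auto simp: W_def)
      qed
      finally show ?thesis using ve e(2) \<delta>(3) by linarith
    qed
    define T where "T w = sqrt ((U N w)\<^sup>2 + (norm (D w))\<^sup>2)" for w
    note mt = mollified_test_inequality[where r="2 * r" and U="U N" and N="Suc N", OF E X P \<psi>(1) Um U0 Uh[unfolded h_def] k hk(1)[unfolded h_def]]
    have iT: "integrable lborel (\<lambda>w. indicator C w * T w)"
      and T: "(LBINT w. indicator C w * T w) \<le> P + \<delta>"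
    proof -
      show "integrable lborel (\<lambda>w. indicator C w * T w)" using mt(1) by (simp add: T_def C_def D_def V_def)
      have "(LBINT w. indicator C w * T w) \<le> P + (\<Sum>n<Suc N. LBINT y. \<bar>conv (h n) k y - h n y\<bar>)"
        using mt(2) unfolding T_def C_def D_def V_def h_def .
      also have "(\<Sum>n<Suc N. LBINT y. \<bar>conv (h n) k y - h n y\<bar>) \<le> (\<Sum>n<Suc N. \<delta> / real (Suc N))"
        by (rule sum_mono) (use hk(2) in blast)
      also have "\<dots> = \<delta>" by simp
      finally show "(LBINT w. indicator C w * T w) \<le> P + \<delta>" by simp
    qed
    define S where "S w = sqrt ((c * W w powr p)\<^sup>2 + (norm (G w))\<^sup>2)" for w
    \<comment> \<open>\<open>R1\<close> is what finitely many test fields miss, \<open>R2\<close>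
      the cost of exchanging \<open>V powr p\<close> for \<open>v powr p\<close>; the term
      \<open>4 / r * v w\<close> in \<open>SR\<close> comes from the gradient of the cutoff.\<close>
    define R1 where "R1 w = indicat_real C w * (c * V w powr p - U N w)" for w
    define R2 where "R2 w = c * s powr p * indicat_real C w + c * s powr (p - 1) * \<bar>v w - V w\<bar>" for w
    have i1: "integrable lborel R1" unfolding R1_def by (rule iCU)
    have i2: "integrable lborel R2" unfolding R2_def using iC iabs by auto
    have R20: "R2 w \<ge> 0" for w unfolding R2_def using c by simp
    have SR: "S w \<le> indicator C w * T w + (R1 w + R2 w) + 4 / r * v w" for w
    proof (cases "w \<in> C")
      case False
      then have "ct w = 0" using ct(4)[of w] by (simp add: C_def)
      then have "S w = v w * norm (Y w)" using p v0[of w] by (simp add: S_def W_def G_def)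
      also have "\<dots> \<le> v w * (4 / r)" by (intro mult_left_mono ct(5) v0)
      finally show ?thesis using False R20[of w] by (simp add: R1_def mult.commute)
    next
      case True
      define t where "t = \<bar>c * v w powr p - U N w\<bar>"
      have tle: "t \<le> R1 w + R2 w"
      proof -
        have "\<bar>v w powr p - V w powr p\<bar> \<le> s powr p + s powr (p - 1) * \<bar>v w - V w\<bar>"
          using v0 V0 p s by (intro powr_diff_le) auto
        then have "c * \<bar>v w powr p - V w powr p\<bar> \<le> c * (s powr p + s powr (p - 1) * \<bar>v w - V w\<bar>)"
          using c by (intro mult_left_mono) auto
        also have "\<dots> = R2 w" using True by (simp add: R2_def algebra_simps)
        finally have "\<bar>c * v w powr p - c * V w powr p\<bar> \<le> R2 w" using c by (simp add: abs_mult flip: right_diff_distrib)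
        moreover have "R1 w = c * V w powr p - U N w" using True by (simp add: R1_def)
        ultimately show ?thesis using UV[of N w] unfolding t_def by linarith
      qed
      have x: "c * W w powr p \<le> U N w + t"
      proof -
        have "W w \<le> v w" using v0[of w] ct(2)[of w] by (simp add: W_def mult_left_le)
        then have "c * W w powr p \<le> c * v w powr p" using W0[of w] p c by (intro mult_left_mono powr_mono2) auto
        then show ?thesis unfolding t_def by linarith
      qed
      \<comment> \<open>The square roots are norms of pairs, so the triangle inequality separates
        the errors from the main term \<open>T w\<close>.\<close>
      have "S w = norm (c * W w powr p, G w)" by (simp add: S_def norm_Pair)
      also have "\<dots> \<le> norm (U N w + t, G w)"
        unfolding norm_Pair using x c by (intro real_sqrt_le_mono add_right_mono) (auto simp: abs_le_square_iff[symmetric])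
      also have "(U N w + t, G w) = (U N w, ct w *\<^sub>R D w) + ((t, 0) + (0, v w *\<^sub>R Y w))" by (simp add: G_def)
      also have "norm \<dots> \<le> norm (U N w, ct w *\<^sub>R D w) + (norm (t, 0 :: real ^ 'k) + norm (0 :: real, v w *\<^sub>R Y w))"
        by (intro norm_triangle_le add_left_mono norm_triangle_ineq)
      also have "norm (U N w, ct w *\<^sub>R D w) \<le> T w"
      proof -
        have "(norm (ct w *\<^sub>R D w))\<^sup>2 \<le> (norm (D w))\<^sup>2"
          using ct(2)[of w] by (intro power_mono) (auto simp: mult_left_le_one_le)
        then show ?thesis unfolding norm_Pair T_def by (intro real_sqrt_le_mono add_left_mono) auto
      qed
      also have "norm (t, 0 :: real ^ 'k) = t" by (simp add: norm_Pair t_def)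
      also have "norm (0 :: real, v w *\<^sub>R Y w) \<le> 4 / r * v w"
        using mult_left_mono[OF ct(5) v0, of w w] v0[of w] by (simp add: norm_Pair mult.commute)
      finally show ?thesis using True tle by simp
    qed
    have iS: "integrable lborel S"
    proof (rule Bochner_Integration.integrable_bound)
      show "integrable lborel (\<lambda>w. indicator C w * T w + (R1 w + R2 w) + 4 / r * v w)"
        using iT i1 i2 iv by auto
      show "S \<in> borel_measurable lborel" unfolding S_def by measurable
      show "AE w in lborel. norm (S w) \<le> norm (indicator C w * T w + (R1 w + R2 w) + 4 / r * v w)"
      proof (intro AE_I2)
        fix w
        have "0 \<le> S w" by (simp add: S_def)
        then show "norm (S w) \<le> norm (indicator C w * T w + (R1 w + R2 w) + 4 / r * v w)"
          using SR[of w] by simp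
      qed
    qed
    have Ipos: "(LBINT x. W x) > 0" using aW a by linarith
    have pc: "product_constant Q d c \<ge> 0" unfolding product_constant_def by simp
    have "product_constant Q d c * a powr ((real d - 1) / d) \<le> product_constant Q d c * (LBINT x. W x) powr ((real d - 1) / d)"
      using aW a pc Q2 by (intro mult_left_mono powr_mono2) (auto simp: d_def)
    also have "\<dots> \<le> (LBINT w. S w)"
      using C1c_profile_inequality_powr[OF WG W0 c Q2 Ipos] unfolding S_def p_def Q_def d_def by simp
    also have "\<dots> \<le> (LBINT w. indicator C w * T w + (R1 w + R2 w) + 4 / r * v w)"
      using iS iT i1 i2 iv SR by (intro integral_mono) auto
    also have "\<dots> = (LBINT w. indicator C w * T w) + ((LBINT w. R1 w) + (LBINT w. R2 w)) + 4 / r * (LBINT w. v w)"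
      using iT i1 i2 iv by simp
    \<comment> \<open>One \<open>\<delta>\<close> from the mollified tests, one from
      \<open>R1\<close> and two from \<open>R2\<close>.\<close>
    also have "\<dots> \<le> (P + \<delta>) + (\<delta> + (\<delta> + \<delta>)) + 4 / r * (m + 1)"
    proof (intro add_mono T mult_left_mono)
      show "(LBINT w. R1 w) \<le> \<delta>" using N by (simp add: R1_def)
      have "(LBINT w. R2 w) = c * s powr p * mC + c * s powr (p - 1) * (LBINT x. \<bar>v x - V x\<bar>)"
        unfolding R2_def using iC iabs by (simp add: mC_def)
      also have "c * s powr p * mC = \<delta> / (c * mC + 1) * (c * mC)" by (simp add: s(2))
      also have "\<dots> \<le> \<delta> * 1" using \<delta>(1) cmC by (rule divide_Suc_mult_le)
      also have "c * s powr (p - 1) * (LBINT x. \<bar>v x - V x\<bar>) \<le> c * s powr (p - 1) * e"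
        by (intro mult_left_mono ve cs)
      also have "\<dots> \<le> \<delta>" by (rule e(3))
      finally show "(LBINT w. R2 w) \<le> \<delta> + \<delta>" by simp
      have "(LBINT w. v w) = m + (LBINT w. v w - V w)" using iv iV Vint by simp
      also have "(LBINT w. v w - V w) \<le> (LBINT w. \<bar>v w - V w\<bar>)"
        using iv iV by (intro integral_mono) auto
      finally show "(LBINT w. v w) \<le> m + 1" using ve e(2) \<delta>(2) by linarith
    qed (use r in auto)
    finally show ?thesis by simp
  qed
  have "product_constant Q d c * a powr ((real d - 1) / d) \<le> P + 4 / r * (m + 1)"
  proof (rule field_le_epsilon)
    fix e :: real assume e: "e > 0"
    define \<delta> where "\<delta> = min (e / 4) (min 1 (mr - a))"
    have "0 < \<delta>" "\<delta> \<le> 1" "\<delta> \<le> mr - a" "\<delta> \<le> e / 4" using e a(2) unfolding \<delta>_def mr_def[symmetric] by (auto simp: min_def)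
    from key[OF this(1-3)] this(4) show "product_constant Q d c * a powr ((real d - 1) / d) \<le> P + 4 / r * (m + 1) + e"
      by linarith
  qed
  then show ?thesis by (simp add: m_def)
qed

text \<open>The type \<open>'q\<close> supplies a Euclidean space of dimension \<open>Q\<close> for
  the model balls. In the preceding estimate the radius is sent to infinity and
  \<open>a = s * M\<close> to the full volume.\<close>

lemma admissible_product:
  fixes X :: "'i::finite \<Rightarrow> 'a::euclidean_space \<Rightarrow> 'a" and q :: "'q::euclidean_space itself"
  assumes X: "\<And>i. continuous_on UNIV (X i)" and adm: "admissible X DIM('q) c" and c: "c > 0" and Q2: "DIM('q) \<ge> 2"
    and PX: "\<And>i. continuous_on UNIV (prod_fields X i :: 'a \<times> (real ^ 'k::finite) \<Rightarrow> _)"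
  shows "admissible (prod_fields X :: 'i + 'k \<Rightarrow> 'a \<times> (real ^ 'k) \<Rightarrow> _) (DIM('q) + CARD('k)) (product_constant DIM('q) (DIM('q) + CARD('k)) c)"
  unfolding admissible_def
proof
  fix E :: "('a \<times> (real ^ 'k)) set" assume E: "E \<in> lmeasurable"
  define d where "d = DIM('q) + CARD('k)"
  define \<kappa> where "\<kappa> = product_constant DIM('q) d c"
  define p where "p = (real d - 1) / real d"
  let ?X = "prod_fields X :: 'i + 'k \<Rightarrow> 'a \<times> (real ^ 'k) \<Rightarrow> _"
  obtain F where F: "F \<in> sets borel" "emeasure lborel F < \<infinity>" "measure lborel F = measure lebesgue E"
    "AE x in lebesgue. x \<in> E \<longleftrightarrow> x \<in> F" by (rule lmeasurable_borel_rep[OF E])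
  have eq: "perimeter ?X E = (SUP (f, G)\<in>tests. ereal (LBINT p. indicator F p * diverg ?X G p))"
    by (rule perimeter_SUP[where V="?X", OF _ F(1,4) PX]) (use E in auto)
  have "ereal (\<kappa> * measure lborel F powr p) \<le> perimeter ?X E"
  proof (cases "measure lborel F = 0 \<or> perimeter ?X E = \<infinity>")
    case True
    then show ?thesis using perimeter_nonneg[of ?X E] by (auto simp: zero_ereal_def)
  next
    case False
    then obtain P where P: "perimeter ?X E = ereal P"
      using perimeter_nonneg[of ?X E] by (cases "perimeter ?X E") auto
    define M where "M = measure lborel F"
    have M: "M > 0" using False by (simp add: M_def zero_less_measure_iff)
    have le: "(LBINT z. indicator F z * diverg ?X G z) \<le> P" if "(f, G) \<in> tests" for f and G :: "'i + 'k \<Rightarrow> 'a \<times> (real ^ 'k) \<Rightarrow> 'a \<times> (real ^ 'k)"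
    proof -
      have "ereal (LBINT z. indicator F z * diverg ?X G z) \<le> perimeter ?X E"
        unfolding eq using that by (auto intro: SUP_upper2)
      then show ?thesis by (simp add: P)
    qed
    have lim: "(\<lambda>n. measure lborel (F \<inter> UNIV \<times> cball 0 (real n))) \<longlonglongrightarrow> M"
    proof -
      have cm: "UNIV \<times> cball 0 t \<in> sets (borel :: ('a \<times> (real ^ 'k)) measure)" for t
        by (intro borel_closed closed_Times) auto
      have "(\<lambda>n. measure lborel (F \<inter> UNIV \<times> cball 0 (real n))) \<longlonglongrightarrow> measure lborel (\<Union>n. F \<inter> UNIV \<times> cball 0 (real n))"
      proof (rule Lim_measure_incseq)
        have "emeasure lborel (\<Union>n. F \<inter> UNIV \<times> cball 0 (real n)) \<le> emeasure lborel F"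
          using F(1) by (intro emeasure_mono) auto
        then show "emeasure lborel (\<Union>n. F \<inter> UNIV \<times> cball 0 (real n)) \<noteq> \<infinity>" using F(2) by (auto simp: top_unique)
      qed (use F(1) cm in \<open>auto simp: incseq_def\<close>)
      moreover have "(\<Union>n. F \<inter> UNIV \<times> cball 0 (real n)) = F" using real_arch_simple by auto
      ultimately show ?thesis by (simp add: M_def)
    qed
    have s: "\<kappa> * (s * M) powr p \<le> P" if s: "0 < s" "s < 1" for s
    proof (rule tendsto_lowerbound)
      have "(\<lambda>n. P + 4 * inverse (real n) * (measure lborel F + 1)) \<longlonglongrightarrow> P + 4 * 0 * (measure lborel F + 1)"
        by (intro tendsto_intros lim_inverse_n)
      then show "(\<lambda>n. P + 4 / real n * (measure lborel F + 1)) \<longlonglongrightarrow> P" by (simp add: divide_inverse)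
      have "eventually (\<lambda>n. s * M < measure lborel (F \<inter> UNIV \<times> cball 0 (real n))) sequentially"
        using lim s M by (intro order_tendstoD(1)) auto
      then show "eventually (\<lambda>n. \<kappa> * (s * M) powr p \<le> P + 4 / real n * (measure lborel F + 1)) sequentially"
        using eventually_gt_at_top[of 0]
      proof eventually_elim
        case (elim n)
        show ?case
          unfolding \<kappa>_def p_def d_def
          by (rule product_isoperimetric_aux[OF F(1,2) X adm c Q2 le]) (use elim s M in auto)
      qed
    qed auto
    have "((\<lambda>s. \<kappa> * (s * M) powr p) \<longlongrightarrow> \<kappa> * (1 * M) powr p) (at_left 1)"
      using M by (intro tendsto_intros) auto
    moreover have "eventually (\<lambda>s. \<kappa> * (s * M) powr p \<le> P) (at_left 1)"
      using s eventually_at_left_real[of 0 "1::real"] by (auto elim!: eventually_mono)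
    ultimately have "\<kappa> * (1 * M) powr p \<le> P" by (intro tendsto_upperbound) auto
    then show ?thesis by (simp add: P M_def)
  qed
  then show "ereal (product_constant DIM('q) (DIM('q) + CARD('k)) c * measure lebesgue E powr ((real (DIM('q) + CARD('k)) - 1) / real (DIM('q) + CARD('k)))) \<le> perimeter ?X E"
    by (simp add: F(3) \<kappa>_def p_def d_def)
qed

section \<open>Identification of the constant and conclusion\<close>

text \<open>With \<open>b = Q * \<omega> powr (1 / Q)\<close> the factor
  \<open>\<omega> * (Q / c) ^ Q\<close> is \<open>(b / c) powr Q\<close>, so its power
  \<open>- 1 / d\<close> is \<open>(c / b) powr (Q / d)\<close>.\<close>

lemma product_constant_eq:
  assumes c: "c > 0" and Q: "Q > 0" and d: "d > 0"
  shows "product_constant Q d c = d * unit_ball_vol d powr (1 / d) * (c / (Q * unit_ball_vol Q powr (1 / Q))) powr (Q / d)"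
proof -
  define \<omega> where "\<omega> = unit_ball_vol (real Q)"
  have \<omega>: "\<omega> > 0" by (simp add: \<omega>_def)
  define b where "b = Q * \<omega> powr (1 / Q)"
  have b: "b > 0" using Q \<omega> by (simp add: b_def)
  have "\<omega> * (Q / c) ^ Q = (b / c) powr Q"
  proof -
    have "b powr Q = Q powr Q * \<omega>"
      unfolding b_def using Q \<omega> by (simp add: powr_mult powr_powr)
    then show ?thesis using Q b c by (simp add: powr_divide powr_realpow[symmetric])
  qed
  then have "(\<omega> * (Q / c) ^ Q) powr (- 1 / d) = (b / c) powr (- (Q / d))"
    by (simp add: powr_powr)
  also have "\<dots> = (c / b) powr (Q / d)" using b c by (simp add: powr_minus powr_divide field_simps)
  finally show ?thesis by (simp add: product_constant_def \<omega>_def[symmetric] b_def)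
qed

theorem theorem11p8:
  "I_heis_prod TYPE('n::finite) TYPE('k::finite) \<ge>
     I_euclid TYPE(('n + 'n + 2) + 'k) *
     (I_heis TYPE('n) / I_euclid TYPE('n + 'n + 2))
       powr (real (2 * CARD('n) + 2) / real (2 * CARD('n) + 2 + CARD('k)))"
proof -
  define c where "c = I_heis TYPE('n)"
  define Q where "Q = 2 * CARD('n) + 2"
  define d where "d = Q + CARD('k)"
  define b where "b n = real n * unit_ball_vol n powr (1 / n)" for n :: nat
  have cardQ: "CARD('n + 'n + 2) = Q" "CARD(('n + 'n + 2) + 'k) = d"
    by (simp_all add: Q_def d_def)
  \<comment> \<open>\<open>real ^ ('n + 'n + 2)\<close> is the space whose balls model the
    slices.\<close>
  have dimQ: "DIM(real ^ ('n + 'n + 2)) = Q" by (simp add: Q_def)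
  have Q2: "Q \<ge> 2" by (simp add: Q_def)
  have "unit_ball_vol (real Q) > 0" by simp
  then have "unit_ball_vol (real Q) powr (1 / Q) > 0" unfolding powr_gt_zero by (metis less_irrefl)
  then have bQ: "b Q > 0" using Q2 by (simp add: b_def)
  have c0: "c \<ge> 0" unfolding c_def I_heis_def by (rule isoperimetric_constant_nonneg[OF shear_heis_fields])
  have prod0: "I_heis_prod TYPE('n) TYPE('k) \<ge> 0"
    unfolding I_heis_prod_def by (rule isoperimetric_constant_nonneg[OF shear_heis_prod_fields])
  show ?thesis
  proof (cases "c = 0")
    \<comment> \<open>\<open>product_constant\<close> divides by \<open>c\<close>; for
      \<open>c = 0\<close> the right-hand side is 0 and nonnegativity suffices.\<close>
    case True
    then show ?thesis using prod0 by (simp add: c_def)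
  next
    case False
    then have c: "c > 0" using c0 by simp
    \<comment> \<open>Each Euclidean constant is compared with \<open>b\<close> in the direction
      that enlarges the right-hand side: the divisor is bounded from below, the factor from
      above.\<close>
    have IQ: "b Q \<le> I_euclid TYPE('n + 'n + 2)"
      unfolding I_euclid_def b_def
      using isoperimetric_constant_ge[OF shear_euclid_fields admissible_euclid[where 'd="'n + 'n + 2"]] unfolding cardQ .
    have Id: "I_euclid TYPE(('n + 'n + 2) + 'k) \<le> b d"
      using I_euclid_le[where 'd="('n + 'n + 2) + 'k"] unfolding cardQ b_def .
    have "admissible (heis_fields :: _ \<Rightarrow> 'n heis \<Rightarrow> _) Q c"
      unfolding c_def I_heis_def Q_def by (rule admissible_isoperimetric_constant[OF shear_heis_fields])
    then have adm: "admissible (heis_fields :: _ \<Rightarrow> 'n heis \<Rightarrow> _) DIM(real ^ ('n + 'n + 2)) c" by (simp only: dimQ)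
    have "admissible (prod_fields heis_fields :: _ \<Rightarrow> 'n heis \<times> (real ^ 'k) \<Rightarrow> _) d (product_constant Q d c)"
      using admissible_product[where 'k='k, OF shear_continuous[OF shear_heis_fields] adm c _ shear_continuous[OF shear_heis_prod_fields[unfolded heis_prod_fields_eq]]] Q2
      unfolding dimQ d_def by blast
    then have "product_constant Q d c \<le> I_heis_prod TYPE('n) TYPE('k)"
      unfolding I_heis_prod_def heis_prod_fields_eq[symmetric] Q_def d_def
      by (rule isoperimetric_constant_ge[OF shear_heis_prod_fields])
    moreover have "I_euclid TYPE(('n + 'n + 2) + 'k) * (c / I_euclid TYPE('n + 'n + 2)) powr (real Q / real d) \<le> b d * (c / b Q) powr (real Q / real d)"
    proof (rule mult_mono)
      show "(c / I_euclid TYPE('n + 'n + 2)) powr (real Q / real d) \<le> (c / b Q) powr (real Q / real d)"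
        using IQ bQ c by (intro powr_mono2 divide_left_mono mult_pos_pos) auto
      show "0 \<le> b d" by (simp add: b_def)
    qed (use Id in auto)
    moreover have "product_constant Q d c = b d * (c / b Q) powr (real Q / real d)"
      unfolding b_def by (rule product_constant_eq[OF c]) (use Q2 in \<open>auto simp: d_def\<close>)
    ultimately show ?thesis unfolding c_def[symmetric] Q_def[symmetric] d_def[symmetric] by linarith
  qed
qed

end
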